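(* Let $n,m,r,s,r',s'$ be nonnegative integers with $r+s\le n$, $r'+s'\le m$ and $1\le r'\le r<s$, and let $U\subset\mathbb P^n$ be a connected open set such that $U\cap\partial\mathbb B^n_{r,s}\neq\emptyset$. If $f:U\to\mathbb P^m$ is a holomorphic map such that $f(U\cap\mathbb B^n_{r,s})\subset\mathbb B^m_{r',s'}$ and $f(U\cap\partial\mathbb B^n_{r,s})\subset\partial\mathbb B^m_{r',s'}$, then $r=r'$, $s\le s'$, and there exist $\Xi\in\mathrm{Aut}(\mathbb B^n_{r,s})$, $\Phi\in\mathrm{Aut}(\mathbb B^m_{r',s'})$, an open set $U'\subset\mathbb P^n$ containing $[1,0,\ldots,0]$ (contained in $\{z_0\ne0\}\cap\Xi^{-1}(U)$), and holomorphic functions $\psi_1,\ldots,\psi_{m-r'-s'}$ on $U'$ such that $$\Phi\circ f\circ\Xi([1,z_1,\ldots,z_n])=[1,z_1,\ldots,z_{r+s},0,\dots,0,\psi_1,\ldots,\psi_{m-r'-s'}]$$ for all $[1,z_1,\dots,z_n]\in U'$, where the block of zeros has length $s'-s$ and the $\psi_j$ are evaluated at $[1,z_1,\dots,z_n]$.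
   Context: $\mathbb P^n$ is complex projective space with homogeneous coordinates $[z_0,\dots,z_n]$. For nonnegative integers $r,s$ with $r+s\le n$, $$\mathbb B^n_{r,s}=\Big\{[z_0,\dots,z_n]\in\mathbb P^n:\ \sum_{i=0}^r|z_i|^2>\sum_{j=r+1}^{r+s}|z_j|^2\Big\},$$ and $\partial\mathbb B^n_{r,s}$ is its topological boundary in $\mathbb P^n$. $\mathrm{Aut}(\mathbb B^n_{r,s})$ denotes the group of automorphisms of $\mathbb B^n_{r,s}$ given by projective linear transformations of $\mathbb P^n$ that map $\mathbb B^n_{r,s}$ onto itself (so they are defined on all of $\mathbb P^n$). *)

theory Defs
  imports "HOL-Analysis.Analysis"
begin

section \<open>Complex projective space\<close>

text \<open>The projective space of \<open>complex ^ 'a\<close>; it has dimension \<open>n\<close> when \<open>CARD('a) = n + 1\<close>.\<close>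

definition proj_rel :: "complex ^ 'a \<Rightarrow> complex ^ 'a \<Rightarrow> bool" where
  "proj_rel x y \<longleftrightarrow> x \<noteq> 0 \<and> y \<noteq> 0 \<and> (\<exists>c. c \<noteq> 0 \<and> y = c *s x)"

lemma part_equivp_proj_rel: "part_equivp (proj_rel :: complex ^ 'a::finite \<Rightarrow> _)"
proof (rule part_equivpI)
  have "proj_rel (\<chi> i. 1) ((\<chi> i. 1) :: complex ^ 'a)"
    by (auto simp: proj_rel_def vec_eq_iff intro!: exI[of _ 1])
  then show "\<exists>x :: complex ^ 'a. proj_rel x x" ..
  show "symp (proj_rel :: complex ^ 'a \<Rightarrow> _)"
  proof (rule sympI)
    fix x y :: "complex ^ 'a"
    assume "proj_rel x y"
    then obtain c where "x \<noteq> 0" "y \<noteq> 0" "c \<noteq> 0" "y = c *s x"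
      by (auto simp: proj_rel_def)
    then show "proj_rel y x"
      by (auto simp: proj_rel_def vector_smult_assoc intro!: exI[of _ "inverse c"])
  qed
  show "transp (proj_rel :: complex ^ 'a \<Rightarrow> _)"
  proof (rule transpI)
    fix x y z :: "complex ^ 'a"
    assume "proj_rel x y" "proj_rel y z"
    then obtain c d where "x \<noteq> 0" "z \<noteq> 0" "c \<noteq> 0" "d \<noteq> 0" "y = c *s x" "z = d *s y"
      by (auto simp: proj_rel_def)
    then show "proj_rel x z"
      by (auto simp: proj_rel_def vector_smult_assoc intro!: exI[of _ "d * c"])
  qed
qed

quotient_type (overloaded) 'a cproj = "complex ^ 'a::finite" / partial: proj_rel
  morphisms rep_cproj line
  by (rule part_equivp_proj_rel)

text \<open>\<open>line v\<close> is the point of projective space represented by \<open>v \<noteq> 0\<close>; \<open>line 0\<close> is unspecified.\<close>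

lemma line_eq_iff:
  fixes v w :: "complex ^ 'a::finite"
  assumes "v \<noteq> 0" "w \<noteq> 0"
  shows "line v = line w \<longleftrightarrow> (\<exists>c. c \<noteq> 0 \<and> w = c *s v)"
proof -
  have "proj_rel u u" if "u \<noteq> 0" for u :: "complex ^ 'a"
    using that by (auto simp: proj_rel_def intro!: exI[of _ 1])
  then have "line v = line w \<longleftrightarrow> proj_rel v w"
    using Quotient_rel[OF Quotient_cproj, of v w] assms by blast
  then show ?thesis
    using assms by (simp add: proj_rel_def)
qed

lemma ex_line: "\<exists>v. v \<noteq> 0 \<and> p = line v"
  using Quotient_rep_reflp[OF Quotient_cproj, of p] Quotient_abs_rep[OF Quotient_cproj, of p]
  by (metis proj_rel_def)

text \<open>The quotient topology of the nonzero vectors.\<close>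

instantiation cproj :: (finite) topological_space
begin

definition open_cproj :: "'a cproj set \<Rightarrow> bool" where
  "open_cproj U \<longleftrightarrow> open {v :: complex ^ 'a. v \<noteq> 0 \<and> line v \<in> U}"

instance
proof
  have "{v :: complex ^ 'a. v \<noteq> 0 \<and> line v \<in> UNIV} = - {0}" by auto
  then show "open (UNIV :: 'a cproj set)"
    unfolding open_cproj_def by (simp only:) (intro open_Compl closed_singleton)
next
  fix S T :: "'a cproj set"
  assume "open S" "open T"
  moreover have "{v. v \<noteq> 0 \<and> line v \<in> S \<inter> T} =
      {v. v \<noteq> 0 \<and> line v \<in> S} \<inter> {v. v \<noteq> 0 \<and> line v \<in> T}" by auto
  ultimately show "open (S \<inter> T)"
    unfolding open_cproj_def by (simp only: open_Int)
next
  fix K :: "'a cproj set set"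
  assume "\<forall>S\<in>K. open S"
  moreover have "{v. v \<noteq> 0 \<and> line v \<in> \<Union>K} = (\<Union>S\<in>K. {v. v \<noteq> 0 \<and> line v \<in> S})" by auto
  ultimately show "open (\<Union>K)"
    unfolding open_cproj_def by (simp only: open_UN)
qed

end

text \<open>The order of the index type numbers the coordinates \<open>0, 1, \<dots>, n\<close>.
  \<open>hpt z\<close> is the point \<open>[z 0, \<dots>, z n]\<close>; values of \<open>z\<close> beyond \<open>n\<close> play no role.\<close>

definition pos :: "'a::{finite,linorder} \<Rightarrow> nat" where
  "pos k = card {..<k}"

definition hpt :: "(nat \<Rightarrow> complex) \<Rightarrow> 'a::{finite,linorder} cproj" where
  "hpt z = line (\<chi> k. z (pos k))"

lemma bij_betw_pos: "bij_betw pos (UNIV :: 'a::{finite,linorder} set) {..<CARD('a)}"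
proof -
  have "strict_mono (pos :: 'a \<Rightarrow> nat)"
    unfolding strict_mono_def pos_def
    by (intro allI impI psubset_card_mono) (auto simp: psubset_eq)
  then have inj: "inj (pos :: 'a \<Rightarrow> nat)"
    by (rule strict_mono_imp_inj_on)
  have "pos k < CARD('a)" for k :: 'a
    unfolding pos_def by (rule psubset_card_mono) auto
  then have "range (pos :: 'a \<Rightarrow> nat) \<subseteq> {..<CARD('a)}" by auto
  moreover have "card (range (pos :: 'a \<Rightarrow> nat)) = CARD('a)"
    using inj by (rule card_image)
  ultimately have "range (pos :: 'a \<Rightarrow> nat) = {..<CARD('a)}"
    by (intro card_subset_eq) simp_all
  with inj show ?thesis by (simp add: bij_betw_def)
qed


section \<open>Holomorphic functions and maps\<close>

text \<open>Complex differentiability on a set \<open>S\<close> that is open in \<open>complex ^ 'a\<close> or in a complex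
  affine subspace.\<close>

definition holo_on :: "(complex ^ 'a::finite \<Rightarrow> complex) \<Rightarrow> (complex ^ 'a) set \<Rightarrow> bool" where
  "holo_on g S \<longleftrightarrow>
     (\<forall>z\<in>S. \<exists>D. Vector_Spaces.linear (*s) (*) D \<and> (g has_derivative D) (at z within S))"

text \<open>The standard chart on \<open>{z\<^sub>k \<noteq> 0}\<close> sends \<open>[z]\<close> to \<open>z / z\<^sub>k\<close>. Its image is the hyperplane
  \<open>{z. z $ k = 1}\<close>, which is \<open>n\<close>-dimensional complex affine space, and its inverse is \<open>line\<close>.\<close>

definition chart_dom :: "'a::finite \<Rightarrow> 'a cproj set" where
  "chart_dom k = {line v | v. v $ k \<noteq> 0}"

definition chart :: "'a::finite \<Rightarrow> 'a cproj \<Rightarrow> complex ^ 'a" where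
  "chart k p = (THE z. z $ k = 1 \<and> line z = p)"

lemma chart_line:
  assumes "v $ k \<noteq> 0"
  shows "chart k (line v) = inverse (v $ k) *s v"
  unfolding chart_def
proof (rule the_equality)
  have v: "v \<noteq> 0" using assms by auto
  have w: "inverse (v $ k) *s v \<noteq> 0" using assms v by simp
  have "line v = line (inverse (v $ k) *s v)"
    unfolding line_eq_iff[OF v w] using assms by (intro exI[of _ "inverse (v $ k)"]) simp
  then show "(inverse (v $ k) *s v) $ k = 1 \<and> line (inverse (v $ k) *s v) = line v"
    using assms by simp
  fix z assume z: "z $ k = 1 \<and> line z = line v"
  then have "z \<noteq> 0" by auto
  then obtain c where "c \<noteq> 0" "z = c *s v"
    using z line_eq_iff[OF v, of z] by auto
  with z assms show "z = inverse (v $ k) *s v"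
    by (auto simp: field_simps)
qed

definition cproj_holo_fun_on :: "('a::finite cproj \<Rightarrow> complex) \<Rightarrow> 'a cproj set \<Rightarrow> bool" where
  "cproj_holo_fun_on g U \<longleftrightarrow> (\<forall>k. holo_on (\<lambda>z. g (line z)) {z. z $ k = 1 \<and> line z \<in> U})"

definition cproj_holo_map_on :: "('a::finite cproj \<Rightarrow> 'b::finite cproj) \<Rightarrow> 'a cproj set \<Rightarrow> bool" where
  "cproj_holo_map_on f U \<longleftrightarrow> continuous_on U f \<and>
     (\<forall>l j. cproj_holo_fun_on (\<lambda>p. chart l (f p) $ j) {p \<in> U. f p \<in> chart_dom l})"


section \<open>Generalized balls and their automorphisms\<close>

definition gen_ball :: "nat \<Rightarrow> nat \<Rightarrow> 'a::{finite,linorder} cproj set" where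
  "gen_ball r s =
     {hpt z | z. (\<Sum>i=0..r. (cmod (z i))\<^sup>2) > (\<Sum>j=r+1..r+s. (cmod (z j))\<^sup>2)}"

definition proj_linear :: "('a::finite cproj \<Rightarrow> 'a cproj) \<Rightarrow> bool" where
  "proj_linear T \<longleftrightarrow>
     (\<exists>A :: complex ^ 'a ^ 'a. invertible A \<and> (\<forall>v. v \<noteq> 0 \<longrightarrow> T (line v) = line (A *v v)))"

definition proj_Aut :: "'a::finite cproj set \<Rightarrow> ('a cproj \<Rightarrow> 'a cproj) set" where
  "proj_Aut B = {T. proj_linear T \<and> T ` B = B}"

end

(*
  Polarizing along the totally isotropic subspaces of dimension r + 1 shows that f maps each of them
  into a totally isotropic subspace, whose span has dimension at most r' + 1 <= r + 1 modulo the
  radical. The isometries form a real form of the linear group, so by a Cayley transform and the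
  identity theorem this bound on the rank passes to all subspaces of dimension r + 1. If the rank
  stopped growing along a flag, the whole image would be isotropic, contrary to the positive points
  of the ball; hence it grows by at least one in each step, and f maps lines to lines without having
  its image in a line. Such a map is induced by a linear map D: with a fixed, f(a + z) lies on the
  line through f(a) and f(z), which singles out a representative L(z) of f(z) with
  f(a + z) = [f(a) + L(z)], and comparing the two ways of bracketing f(a + b + c) gives
  L(b + c) = L(b) + L(c). Since D maps null vectors to null vectors, it multiplies the form by a
  constant, and Witt's theorem brings it into diagonal form.
*)

theory Submission
  imports Defs "HOL-Complex_Analysis.Conformal_Mappings"
begin

text \<open>The hypothesis \<open>r < s\<close> provides the totally isotropic subspaces of
  dimension \<open>r + 1\<close>: the positive axes are paired with \<open>r + 1\<close> of the
  negative ones. Since \<open>1 \<le> r'\<close> and \<open>r' \<le> r\<close>, this dimension is at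
  least 2, so the flags contain projective lines and see three independent image points. The
  obstacles are locality and degeneracy. The map lives only near one boundary point, and a subspace
  may leave its domain; hence only the first vector of a flag is required to lie there, and the
  other points are contracted towards it before two flags are joined. Both forms may have a radical.
  A boundary point can be sent into the radical of the target, where projection to the nondegenerate
  block is undefined; so a null point whose image has a nonzero positive coordinate is found before
  the radical coordinates are cut off. In the source, the Cayley argument needs operators that
  annihilate the radical. All holomorphic arguments run along complex lines or curves, and the
  domains are convex so that the slices by complex lines are connected.\<close>

section \<open>Holomorphic functions on open sets\<close>

lemma holo_on_subset: "holo_on g S \<Longrightarrow> T \<subseteq> S \<Longrightarrow> holo_on g T"
  unfolding holo_on_def by (meson has_derivative_subset subsetD)

lemma holo_on_continuous_on: "holo_on g S \<Longrightarrow> continuous_on S g"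
  unfolding holo_on_def continuous_on_eq_continuous_within
  by (meson has_derivative_continuous)

lemma holo_onE:
  assumes "holo_on g S" "z \<in> S"
  obtains D where "Vector_Spaces.linear (*s) (*) D" "(g has_derivative D) (at z within S)"
proof -
  have "\<exists>D. Vector_Spaces.linear (*s) (*) D \<and> (g has_derivative D) (at z within S)"
    using assms(1) unfolding holo_on_def by (rule bspec) (rule assms(2))
  then show thesis using that by (elim exE conjE)
qed

lemma holo_on_openE:
  assumes "holo_on g S" "open S" "z \<in> S"
  obtains D where "Vector_Spaces.linear (*s) (*) D" "(g has_derivative D) (at z)"
proof -
  obtain D where D: "Vector_Spaces.linear (*s) (*) D" "(g has_derivative D) (at z within S)"
    using assms(1,3) by (rule holo_onE)
  from D(2) have "(g has_derivative D) (at z)"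
    by (simp only: at_within_open[OF assms(3,2)])
  with D(1) show thesis by (rule that)
qed

lemma holo_on_cong: "holo_on g S \<Longrightarrow> (\<And>z. z \<in> S \<Longrightarrow> g z = h z) \<Longrightarrow> holo_on h S"
  unfolding holo_on_def by (metis has_derivative_transform)

lemma linear_fun_scale: "Vector_Spaces.linear (*s) (*) D \<Longrightarrow> D (c *s v) = c * D v"
  for D :: "complex ^ 'a::finite \<Rightarrow> complex"
  by (simp add: Vector_Spaces.linear_iff)

lemma linear_fun_add: "Vector_Spaces.linear (*s) (*) D \<Longrightarrow> D (v + w) = D v + D w"
  for D :: "complex ^ 'a::finite \<Rightarrow> complex"
  by (simp add: Vector_Spaces.linear_iff)

lemma linear_funI:
  fixes D :: "complex ^ 'a::finite \<Rightarrow> complex"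
  assumes "\<And>v w. D (v + w) = D v + D w" "\<And>c v. D (c *s v) = c * D v"
  shows "Vector_Spaces.linear (*s) (*) D"
  by (simp add: Vector_Spaces.linear_iff assms vec.vector_space_axioms
      vector_space_over_itself.vector_space_axioms)

lemma scaleR_vec_eq: "c *\<^sub>R v = complex_of_real c *s v" for v :: "complex ^ 'a"
  unfolding vec_eq_iff vector_scaleR_component vector_smult_component
  by (simp add: scaleR_conv_of_real)

lemma holo_on_const: "holo_on (\<lambda>z. c) S"
  unfolding holo_on_def by (intro ballI exI[of _ "\<lambda>_. 0"]) (auto intro!: linear_funI)

lemma holo_on_nth: "holo_on (\<lambda>z. z $ k) S"
  unfolding holo_on_def
  by (intro ballI exI[of _ "\<lambda>z. z $ k"])
    (auto intro!: linear_funI bounded_linear_imp_has_derivative bounded_linear_vec_nth)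

lemma holo_on_add:
  assumes "holo_on g S" "holo_on h S"
  shows "holo_on (\<lambda>z. g z + h z) S"
  unfolding holo_on_def
proof
  fix z assume "z \<in> S"
  then obtain D E where D: "Vector_Spaces.linear (*s) (*) D" "(g has_derivative D) (at z within S)"
    and E: "Vector_Spaces.linear (*s) (*) E" "(h has_derivative E) (at z within S)"
    using assms unfolding holo_on_def by meson
  note lin = linear_fun_add[OF D(1)] linear_fun_add[OF E(1)] linear_fun_scale[OF D(1)]
    linear_fun_scale[OF E(1)]
  show "\<exists>D. Vector_Spaces.linear (*s) (*) D \<and>
      ((\<lambda>z. g z + h z) has_derivative D) (at z within S)"
    by (intro exI[of _ "\<lambda>v. D v + E v"] conjI linear_funI has_derivative_add D E)
      (simp_all add: lin algebra_simps)
qed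

lemma holo_on_mult:
  assumes "holo_on g S" "holo_on h S"
  shows "holo_on (\<lambda>z. g z * h z) S"
  unfolding holo_on_def
proof
  fix z assume "z \<in> S"
  then obtain D E where D: "Vector_Spaces.linear (*s) (*) D" "(g has_derivative D) (at z within S)"
    and E: "Vector_Spaces.linear (*s) (*) E" "(h has_derivative E) (at z within S)"
    using assms unfolding holo_on_def by meson
  note lin = linear_fun_add[OF D(1)] linear_fun_add[OF E(1)] linear_fun_scale[OF D(1)]
    linear_fun_scale[OF E(1)]
  show "\<exists>D. Vector_Spaces.linear (*s) (*) D \<and>
      ((\<lambda>z. g z * h z) has_derivative D) (at z within S)"
    by (intro exI[of _ "\<lambda>v. g z * E v + D v * h z"] conjI linear_funI has_derivative_mult D E)
      (simp_all add: lin algebra_simps)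
qed

lemma holo_on_sum:
  "finite I \<Longrightarrow> (\<And>i. i \<in> I \<Longrightarrow> holo_on (g i) S) \<Longrightarrow> holo_on (\<lambda>z. \<Sum>i\<in>I. g i z) S"
  by (induction I rule: finite_induct) (auto intro!: holo_on_const holo_on_add)

lemma holo_on_inverse:
  assumes "holo_on g S" "\<And>z. z \<in> S \<Longrightarrow> g z \<noteq> 0"
  shows "holo_on (\<lambda>z. inverse (g z)) S"
  unfolding holo_on_def
proof
  fix z assume "z \<in> S"
  then obtain D where D: "Vector_Spaces.linear (*s) (*) D" "(g has_derivative D) (at z within S)"
    using assms unfolding holo_on_def by meson
  have "((\<lambda>z. inverse (g z)) has_derivative (\<lambda>v. - (inverse (g z) * D v * inverse (g z))))
      (at z within S)"
    using \<open>z \<in> S\<close> assms(2) by (intro Deriv.has_derivative_inverse D(2)) auto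
  then show "\<exists>D. Vector_Spaces.linear (*s) (*) D \<and>
      ((\<lambda>z. inverse (g z)) has_derivative D) (at z within S)"
    by (intro exI[of _ "\<lambda>v. - (inverse (g z) * D v * inverse (g z))"] conjI linear_funI)
      (simp_all add: linear_fun_add[OF D(1)] linear_fun_scale[OF D(1)] algebra_simps)
qed

lemma holo_on_divide:
  assumes "holo_on g S" "holo_on h S" "\<And>z. z \<in> S \<Longrightarrow> h z \<noteq> 0"
  shows "holo_on (\<lambda>z. g z / h z) S"
  unfolding divide_inverse by (intro holo_on_mult holo_on_inverse assms)

text \<open>Composition with a map into a possibly smaller set, for instance an affine chart, on which
  the outer function is only known to be differentiable relative to that set.\<close>

lemma holo_on_compose:
  fixes \<phi> :: "complex ^ 'a::finite \<Rightarrow> complex ^ 'b::finite"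
  assumes g: "holo_on g T" and \<phi>: "\<And>k. holo_on (\<lambda>z. \<phi> z $ k) S" and sub: "\<phi> ` S \<subseteq> T"
  shows "holo_on (\<lambda>z. g (\<phi> z)) S"
  unfolding holo_on_def
proof
  fix z assume z: "z \<in> S"
  with sub have "\<phi> z \<in> T" by blast
  with g obtain D where D: "Vector_Spaces.linear (*s) (*) D"
      "(g has_derivative D) (at (\<phi> z) within T)"
    by (rule holo_onE)
  have "\<forall>k. \<exists>E. Vector_Spaces.linear (*s) (*) E \<and>
      ((\<lambda>z. \<phi> z $ k) has_derivative E) (at z within S)"
    using \<phi>[unfolded holo_on_def, THEN bspec, OF z] by (rule allI)
  then obtain E where E: "\<And>k. Vector_Spaces.linear (*s) (*) (E k)"
      "\<And>k. ((\<lambda>z. \<phi> z $ k) has_derivative E k) (at z within S)"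
    by metis
  define E' where "E' v = (\<chi> k. E k v)" for v
  have \<phi>': "(\<phi> has_derivative E') (at z within S)"
  proof -
    have "((\<lambda>z. \<phi> z \<bullet> i) has_derivative (\<lambda>v. E' v \<bullet> i)) (at z within S)"
      if i: "i \<in> Basis" for i :: "complex ^ 'b"
    proof -
      obtain k u where "i = axis k u" using i by (auto simp: Basis_vec_def)
      then have "x \<bullet> i = x $ k \<bullet> u" for x
        by (simp add: inner_axis)
      then show ?thesis
        by (auto simp: E'_def intro!: has_derivative_inner_left E)
    qed
    then show ?thesis by (simp add: has_derivative_componentwise_within[of \<phi>])
  qed
  have "((\<lambda>z. g (\<phi> z)) has_derivative (\<lambda>v. D (E' v))) (at z within S)"
    by (rule has_derivative_in_compose[OF \<phi>' has_derivative_subset[OF D(2) sub]])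
  moreover have "Vector_Spaces.linear (*s) (*) (\<lambda>v. D (E' v))"
  proof (rule linear_funI)
    have "E' (v + w) = E' v + E' w" "E' (c *s v) = c *s E' v" for c v w
      by (simp_all add: E'_def vec_eq_iff linear_fun_add[OF E(1)] linear_fun_scale[OF E(1)])
    then show "D (E' (v + w)) = D (E' v) + D (E' w)" "D (E' (c *s v)) = c * D (E' v)" for c v w
      by (simp_all add: linear_fun_add[OF D(1)] linear_fun_scale[OF D(1)])
  qed
  ultimately show "\<exists>D. Vector_Spaces.linear (*s) (*) D \<and>
      ((\<lambda>z. g (\<phi> z)) has_derivative D) (at z within S)"
    by blast
qed

text \<open>Everything is reduced to one complex variable: composition with a holomorphic curve
  makes the one-variable identity theorem available. Complex linearity of \<open>D\<close> turns the
  derivative into multiplication by one complex number.\<close>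

lemma holo_on_curve:
  fixes \<phi> :: "complex \<Rightarrow> complex ^ 'b::finite"
  assumes g: "holo_on g S" and "open S" and \<phi>: "\<And>k. (\<lambda>t. \<phi> t $ k) holomorphic_on T" and "open T"
    and sub: "\<phi> ` T \<subseteq> S"
  shows "(\<lambda>t. g (\<phi> t)) holomorphic_on T"
  unfolding holomorphic_on_open[OF \<open>open T\<close>]
proof
  fix z assume z: "z \<in> T"
  with sub have "\<phi> z \<in> S" by blast
  with g \<open>open S\<close> obtain D where
    D: "Vector_Spaces.linear (*s) (*) D" "(g has_derivative D) (at (\<phi> z))"
    by (rule holo_on_openE)
  have e: "((\<lambda>t. \<phi> t $ k) has_field_derivative deriv (\<lambda>t. \<phi> t $ k) z) (at z)" for k
    using \<phi> \<open>open T\<close> z by (rule holomorphic_derivI)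
  define e where "e k = deriv (\<lambda>t. \<phi> t $ k) z" for k
  define E' where "E' v = v *s (\<chi> k. e k)" for v
  have \<phi>': "(\<phi> has_derivative E') (at z)"
  proof -
    have "((\<lambda>z. \<phi> z \<bullet> i) has_derivative (\<lambda>v. E' v \<bullet> i)) (at z)"
      if i: "i \<in> Basis" for i :: "complex ^ 'b"
    proof -
      obtain k u where "i = axis k u" using i by (auto simp: Basis_vec_def)
      then have *: "x \<bullet> i = x $ k \<bullet> u" for x
        by (simp add: inner_axis)
      have "((\<lambda>t. \<phi> t $ k) has_derivative (\<lambda>v. v * e k)) (at z)"
        using e[of k] by (simp add: has_field_derivative_def e_def mult_commute_abs)
      then show ?thesis
        unfolding * by (auto simp: E'_def intro!: has_derivative_inner_left)
    qed
    then show ?thesis by (simp add: has_derivative_componentwise_within[of \<phi>])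
  qed
  have "((\<lambda>z. g (\<phi> z)) has_derivative (\<lambda>v. D (E' v))) (at z)"
    by (rule has_derivative_compose[OF \<phi>' D(2)])
  then have "((\<lambda>z. g (\<phi> z)) has_field_derivative D (\<chi> k. e k)) (at z)"
    unfolding has_field_derivative_def E'_def linear_fun_scale[OF D(1)]
    by (simp add: mult_commute_abs)
  then show "\<exists>f'. ((\<lambda>t. g (\<phi> t)) has_field_derivative f') (at z)" by blast
qed

lemma holo_on_nth_matrix: "holo_on (\<lambda>z. (A *v z) $ k) S"
  unfolding matrix_vector_mult_def
  by (auto intro!: holo_on_sum holo_on_mult holo_on_const holo_on_nth)

section \<open>The identity theorem along complex lines\<close>

definition cline :: "complex ^ 'a::finite \<Rightarrow> complex ^ 'a \<Rightarrow> complex \<Rightarrow> complex ^ 'a" where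
  "cline z w t = z + t *s (w - z)"

lemma cline_0 [simp]: "cline z w 0 = z" and cline_1 [simp]: "cline z w 1 = w"
  by (simp_all add: cline_def)

lemma continuous_on_cline: "continuous_on T (cline z w)"
proof -
  have "continuous_on T (\<lambda>t. (\<chi> k. z $ k + t * (w $ k - z $ k)) :: complex ^ 'a)"
    by (intro continuous_intros)
  moreover have "cline z w = (\<lambda>t. \<chi> k. z $ k + t * (w $ k - z $ k))"
    by (rule ext) (simp add: cline_def vec_eq_iff algebra_simps)
  ultimately show ?thesis by simp
qed

lemma open_cline_vimage: "open S \<Longrightarrow> open (cline z w -` S)"
  using continuous_open_vimage[of S "cline z w"] continuous_on_cline[of UNIV z w]
  by (simp add: continuous_on_open_vimage)

text \<open>Convexity of the domains is used in this way: the parameters at which a complex line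
  lies in the domain form a connected set, as the identity theorem requires.\<close>

lemma convex_cline_vimage:
  assumes "convex S" shows "convex (cline z w -` S)"
proof (rule convexI)
  fix s t u v assume *: "s \<in> cline z w -` S" "t \<in> cline z w -` S" "(0::real) \<le> u" "0 \<le> v" "u + v = 1"
  have "cline z w (u *\<^sub>R s + v *\<^sub>R t) = u *\<^sub>R cline z w s + v *\<^sub>R cline z w t"
  proof -
    have "complex_of_real u + of_real v = 1" by (metis *(5) of_real_1 of_real_add)
    then have v: "complex_of_real v = 1 - of_real u" by (simp add: algebra_simps)
    show ?thesis
      unfolding vec_eq_iff by (simp add: cline_def scaleR_vec_eq scaleR_conv_of_real v algebra_simps)
  qed
  then show "u *\<^sub>R s + v *\<^sub>R t \<in> cline z w -` S"
    using * assms by (auto simp: convex_def)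
qed

lemma holomorphic_on_cline_nth: "(\<lambda>t. cline z w t $ k) holomorphic_on T"
  by (auto simp: cline_def intro!: holomorphic_intros)

lemma holo_on_cline:
  assumes "holo_on g S" "open S"
  shows "(\<lambda>t. g (cline z w t)) holomorphic_on (cline z w -` S)"
  by (rule holo_on_curve[OF assms holomorphic_on_cline_nth open_cline_vimage]) (use assms in auto)

lemma eventually_at_0_imp_zero:
  assumes "g holomorphic_on D" "open D" "connected D" "0 \<in> D" "z \<in> D"
    and "\<forall>\<^sub>F t in at_right 0. g (complex_of_real t) = 0"
  shows "g z = 0"
proof -
  obtain b where b: "b > 0" "\<And>t. 0 < t \<Longrightarrow> t < b \<Longrightarrow> g (complex_of_real t) = 0"
    using assms(6) unfolding eventually_at_right[OF zero_less_one] by blast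
  obtain e where e: "e > 0" "ball 0 e \<subseteq> D" using assms by (meson open_contains_ball)
  define Z where "Z = complex_of_real ` {0<..<min b e}"
  have "0 islimpt Z"
    unfolding islimpt_approachable
  proof (intro allI impI)
    fix d :: real assume "d > 0"
    define t where "t = min d (min b e) / 2"
    then have "0 < t" "t < d" "t < min b e" using b e \<open>d > 0\<close> by auto
    then show "\<exists>x'\<in>Z. x' \<noteq> 0 \<and> dist x' 0 < d"
      by (intro bexI[of _ "of_real t"]) (auto simp: Z_def)
  qed
  then show ?thesis
    by (intro analytic_continuation[OF assms(1-3) _ assms(4) _ _ assms(5), of Z])
      (use b e in \<open>auto simp: Z_def dist_norm\<close>)
qed

text \<open>The real points determine a holomorphic function. This serves both polarization and the
  passage from real parameters, at which \<open>skew_line\<close> is skew-Hermitian, to the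
  parameter \<open>\<i>\<close>.\<close>

lemma zero_on_reals_imp_zero:
  assumes g: "g holomorphic_on D" and "open D" "connected D" "0 \<in> D" "z \<in> D"
    and zero: "\<And>x. of_real x \<in> D \<Longrightarrow> g (of_real x) = 0"
  shows "g z = 0"
proof (rule eventually_at_0_imp_zero[OF assms(1-5)])
  have "isCont complex_of_real 0" by simp
  then have "\<forall>\<^sub>F t in at (0::real). complex_of_real t \<in> D"
    using assms(2,4) unfolding isCont_def by (metis of_real_0 topological_tendstoD)
  then have "\<forall>\<^sub>F t in at (0::real). g (complex_of_real t) = 0"
    by (rule eventually_mono) (rule zero)
  then show "\<forall>\<^sub>F t in at_right 0. g (complex_of_real t) = 0"
    by (simp add: eventually_at_split)
qed

text \<open>On the complex line from a point of \<open>T\<close> to \<open>w\<close> the function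
  vanishes for small parameters, and the parameters with values in the convex set \<open>S\<close>
  are connected.\<close>

lemma holo_on_identity:
  assumes g: "holo_on g S" and S: "open S" "convex S" and "open T" "T \<inter> S \<noteq> {}"
    and zero: "\<And>z. z \<in> T \<inter> S \<Longrightarrow> g z = 0" and w: "w \<in> S"
  shows "g w = 0"
proof -
  obtain z where z: "z \<in> T" "z \<in> S" using assms by auto
  let ?D = "cline z w -` S"
  have D: "(\<lambda>t. g (cline z w t)) holomorphic_on ?D" "open ?D" "connected ?D" "0 \<in> ?D" "1 \<in> ?D"
    using z w by (simp_all add: holo_on_cline[OF g S(1)] open_cline_vimage[OF S(1)]
        convex_connected[OF convex_cline_vimage[OF S(2)]])
  have "isCont complex_of_real 0" by simp
  moreover have "open (cline z w -` (T \<inter> S))"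
    using \<open>open T\<close> S(1) by (intro open_cline_vimage open_Int)
  moreover have "complex_of_real 0 \<in> cline z w -` (T \<inter> S)" using z by simp
  ultimately have "\<forall>\<^sub>F t in at (0::real). complex_of_real t \<in> cline z w -` (T \<inter> S)"
    unfolding isCont_def by (rule topological_tendstoD)
  then have "\<forall>\<^sub>F t in at (0::real). g (cline z w (complex_of_real t)) = 0"
    by (rule eventually_mono) (simp add: zero)
  then have "\<forall>\<^sub>F t in at_right 0. g (cline z w (complex_of_real t)) = 0"
    by (simp add: eventually_at_split)
  then have "g (cline z w 1) = 0"
    by (rule eventually_at_0_imp_zero[OF D])
  then show ?thesis by simp
qed

section \<open>Polarization\<close>

text \<open>In the variables \<open>t = x + i y\<close>, \<open>s = x - i y\<close> the diagonal \<open>s = cnj t\<close> becomes the real points.\<close>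

lemma polarization_ball:
  fixes a :: "'i::finite \<Rightarrow> complex \<Rightarrow> complex"
  assumes a: "\<And>j. a j holomorphic_on ball 0 e"
    and zero: "\<And>t. cmod t < e \<Longrightarrow> (\<Sum>j\<in>UNIV. of_real (\<epsilon> j) * a j t * cnj (a j t)) = 0"
    and t: "cmod t < e / 4"
  shows "(\<Sum>j\<in>UNIV. of_real (\<epsilon> j) * a j t * cnj (a j 0)) = 0"
proof -
  let ?B = "ball (0::complex) (e / 2)"
  have e: "e > 0" using t norm_ge_zero[of t] by linarith
  \<comment> \<open>The holomorphic substitute for conjugation: at \<open>cnj t\<close> it takes the
    value \<open>cnj (a j t)\<close>.\<close>
  define b where "b j s = cnj (a j (cnj s))" for j s
  have b: "b j holomorphic_on ball 0 e" for j
  proof -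
    have "cnj ` ball 0 e = ball 0 e"
      by (auto simp: image_iff intro!: bexI[of _ "cnj x" for x])
    with a[of j] have "(cnj \<circ> a j \<circ> cnj) holomorphic_on ball 0 e"
      by (intro holomorphic_on_compose_cnj_cnj) auto
    then show ?thesis by (simp add: b_def[abs_def] o_def)
  qed
  define \<phi> where "\<phi> x y = (\<Sum>j\<in>UNIV. of_real (\<epsilon> j) * a j (x + \<i> * y) * b j (x - \<i> * y))" for x y
  have in_ball: "x + \<i> * y \<in> ball 0 e" "x - \<i> * y \<in> ball 0 e" if "x \<in> ?B" "y \<in> ?B" for x y
    using that norm_triangle_ineq[of x "\<i> * y"] norm_triangle_ineq4[of x "\<i> * y"]
    by (auto simp: norm_mult)
  have hol: "(\<lambda>y. \<phi> x y) holomorphic_on ?B" if "x \<in> ?B" for x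
    unfolding \<phi>_def using that
    by (intro holomorphic_intros holomorphic_on_compose_gen[OF _ a, unfolded o_def]
        holomorphic_on_compose_gen[OF _ b, unfolded o_def]) (auto simp del: mem_ball intro: in_ball)
  have hol': "(\<lambda>x. \<phi> x y) holomorphic_on ?B" if "y \<in> ?B" for y
    unfolding \<phi>_def using that
    by (intro holomorphic_intros holomorphic_on_compose_gen[OF _ a, unfolded o_def]
        holomorphic_on_compose_gen[OF _ b, unfolded o_def]) (auto simp del: mem_ball intro: in_ball)
  have "\<phi> (of_real x) (of_real y) = 0" if "of_real x \<in> ?B" "of_real y \<in> ?B" for x y
    using zero[of "of_real x + \<i> * of_real y"] in_ball[OF that]
    by (simp add: \<phi>_def b_def)
  \<comment> \<open>The variables are freed from being real one at a time: first \<open>y\<close>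
    with \<open>x\<close> real, then \<open>x\<close> for every \<open>y\<close>.\<close>
  then have "\<phi> (of_real x) y = 0" if "of_real x \<in> ?B" "y \<in> ?B" for x y
    using that zero_on_reals_imp_zero[OF hol[of "of_real x"], of y] e by auto
  then have *: "\<phi> x y = 0" if "x \<in> ?B" "y \<in> ?B" for x y
    using that zero_on_reals_imp_zero[OF hol'[of y], of x] e by auto
  \<comment> \<open>These values give \<open>x + \<i> * y = t\<close> and
    \<open>x - \<i> * y = 0\<close>.\<close>
  have "\<phi> (t / 2) (t / (2 * \<i>)) = 0"
    using t e by (intro *) (auto simp: norm_divide norm_mult)
  then show ?thesis by (simp add: \<phi>_def b_def field_simps)
qed

text \<open>With the second argument frozen at 0 the sum is holomorphic in \<open>t\<close>, so its
  vanishing on a small ball spreads over the connected set \<open>D\<close>.\<close>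

lemma polarization_segment:
  fixes a :: "'i::finite \<Rightarrow> complex \<Rightarrow> complex"
  assumes a: "\<And>j. a j holomorphic_on D" and D: "open D" "connected D" "0 \<in> D" and t: "t \<in> D"
    and zero: "\<And>t. t \<in> D \<Longrightarrow> (\<Sum>j\<in>UNIV. of_real (\<epsilon> j) * a j t * cnj (a j t)) = 0"
  shows "(\<Sum>j\<in>UNIV. of_real (\<epsilon> j) * a j t * cnj (a j 0)) = 0"
proof -
  obtain e where e: "e > 0" "ball 0 e \<subseteq> D" using D by (meson open_contains_ball)
  have "(\<Sum>j\<in>UNIV. of_real (\<epsilon> j) * a j s * cnj (a j 0)) = 0" if "cmod s < e / 4" for s
    by (rule polarization_ball[of a e]) (use that e zero a in \<open>auto intro: holomorphic_on_subset\<close>)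
  then have "\<forall>\<^sub>F s in at_right 0. (\<Sum>j\<in>UNIV. of_real (\<epsilon> j) * a j (of_real s) * cnj (a j 0)) = 0"
    unfolding eventually_at_right[OF zero_less_one]
    using e by (intro bexI[of _ "min 1 (e / 4)"] exI[of _ "e/4"]) auto
  then show ?thesis
    by (intro eventually_at_0_imp_zero[OF _ D t]) (auto intro!: holomorphic_intros a)
qed

section \<open>Diagonal Hermitian forms\<close>

definition hform :: "('a::finite \<Rightarrow> real) \<Rightarrow> complex ^ 'a \<Rightarrow> complex ^ 'a \<Rightarrow> complex" where
  "hform \<epsilon> z w = (\<Sum>k\<in>UNIV. of_real (\<epsilon> k) * z $ k * cnj (w $ k))"

definition hq :: "('a::finite \<Rightarrow> real) \<Rightarrow> complex ^ 'a \<Rightarrow> real" where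
  "hq \<epsilon> z = (\<Sum>k\<in>UNIV. \<epsilon> k * (cmod (z $ k))\<^sup>2)"

lemma hform_self: "hform \<epsilon> z z = of_real (hq \<epsilon> z)"
  unfolding hform_def hq_def of_real_sum
  by (intro sum.cong refl) (simp add: complex_norm_square mult.assoc del: of_real_power)

lemma hform_add_left: "hform \<epsilon> (x + y) z = hform \<epsilon> x z + hform \<epsilon> y z"
  by (simp add: hform_def algebra_simps sum.distrib)

lemma hform_add_right: "hform \<epsilon> z (x + y) = hform \<epsilon> z x + hform \<epsilon> z y"
  by (simp add: hform_def algebra_simps sum.distrib)

lemma hform_diff_left: "hform \<epsilon> (x - y) z = hform \<epsilon> x z - hform \<epsilon> y z"
  by (simp add: hform_def algebra_simps sum_subtractf)

lemma hform_diff_right: "hform \<epsilon> z (x - y) = hform \<epsilon> z x - hform \<epsilon> z y"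
  by (simp add: hform_def algebra_simps sum_subtractf)

lemma hform_scale_left: "hform \<epsilon> (c *s x) z = c * hform \<epsilon> x z"
  by (simp add: hform_def sum_distrib_left algebra_simps)

lemma hform_scale_right: "hform \<epsilon> z (c *s x) = cnj c * hform \<epsilon> z x"
  by (simp add: hform_def sum_distrib_left algebra_simps)

lemma hform_zero_left [simp]: "hform \<epsilon> 0 z = 0" and hform_zero_right [simp]: "hform \<epsilon> z 0 = 0"
  by (simp_all add: hform_def)

lemma hform_minus_left: "hform \<epsilon> (- x) z = - hform \<epsilon> x z"
  and hform_minus_right: "hform \<epsilon> z (- x) = - hform \<epsilon> z x"
  by (simp_all add: hform_def sum_negf)

lemma hform_cnj: "cnj (hform \<epsilon> z w) = hform \<epsilon> w z"
  by (simp add: hform_def algebra_simps)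

lemmas hform_simps = hform_add_left hform_add_right hform_diff_left hform_diff_right
  hform_scale_left hform_scale_right hform_minus_left hform_minus_right

lemma hform_axis_right: "hform \<epsilon> z (axis k 1) = of_real (\<epsilon> k) * z $ k"
  by (simp add: hform_def axis_def if_distrib[of cnj] if_distrib[of "(*) _"] cong: if_cong)

lemma hform_axis_left: "hform \<epsilon> (axis k 1) z = of_real (\<epsilon> k) * cnj (z $ k)"
  using hform_cnj[of \<epsilon> z "axis k 1"] by (simp add: hform_axis_right)

lemma hform_axis_axis: "hform \<epsilon> (axis i 1) (axis j 1) = (if i = j then of_real (\<epsilon> i) else 0)"
  unfolding hform_axis_right by (simp add: axis_def)

lemma hq_scale: "hq \<epsilon> (c *s z) = (cmod c)\<^sup>2 * hq \<epsilon> z"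
  by (simp add: hq_def sum_distrib_left norm_mult power_mult_distrib algebra_simps)

lemma continuous_on_hq: "continuous_on S (hq \<epsilon>)"
  unfolding hq_def by (intro continuous_intros)

lemma hq_cong: "(\<And>k. \<epsilon> k \<noteq> 0 \<Longrightarrow> z $ k = z' $ k) \<Longrightarrow> hq \<epsilon> z = hq \<epsilon> z'"
  unfolding hq_def by (intro sum.cong refl) (metis mult_zero_left)

text \<open>Projection to the coordinates with \<open>\<epsilon> k > 0\<close> is injective on
  \<open>S\<close>: on its kernel all terms of \<open>hq\<close> are nonpositive, so all of them
  vanish, and \<open>block\<close> takes care of the coordinates where \<open>\<epsilon>\<close> is
  0.\<close>

lemma dim_nonneg_subspace_le:
  fixes S :: "(complex ^ 'a::finite) set"
  assumes S: "vec.subspace S" and block: "\<And>v k. v \<in> S \<Longrightarrow> \<epsilon> k = 0 \<Longrightarrow> v $ k = 0"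
    and nonneg: "\<And>v. v \<in> S \<Longrightarrow> hq \<epsilon> v \<ge> 0"
  shows "vec.dim S \<le> card {k. \<epsilon> k > 0}"
proof -
  define P where "P = (\<chi> i j. if i = j \<and> \<epsilon> i > 0 then 1 else (0::complex))"
  have P: "(P *v v) $ k = (if \<epsilon> k > 0 then v $ k else 0)" for v k
    by (simp add: P_def matrix_vector_mult_def if_distrib[of "\<lambda>x. x * _"] cong: if_cong)
  have "v = 0" if v: "v \<in> S" and "P *v v = 0" for v
  proof -
    have pos0: "v $ k = 0" if "\<epsilon> k > 0" for k
      using P[of v k] that \<open>P *v v = 0\<close> by simp
    have le: "\<epsilon> k * (cmod (v $ k))\<^sup>2 \<le> 0" for k
      using pos0[of k] by (cases "\<epsilon> k > 0") (auto simp: mult_nonpos_nonneg)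
    have "(\<Sum>k\<in>UNIV. - (\<epsilon> k * (cmod (v $ k))\<^sup>2)) \<ge> 0"
      using le by (intro sum_nonneg) simp
    then have "(\<Sum>k\<in>UNIV. - (\<epsilon> k * (cmod (v $ k))\<^sup>2)) = 0"
      using nonneg[OF v] by (simp add: hq_def sum_negf)
    then have "\<forall>k\<in>UNIV. - (\<epsilon> k * (cmod (v $ k))\<^sup>2) = 0"
      by (subst (asm) sum_nonneg_eq_0_iff) (use le in auto)
    then have "\<epsilon> k * (cmod (v $ k))\<^sup>2 = 0" for k
      by simp
    then have "v $ k = 0" for k
      using block[OF v, of k] by (cases "\<epsilon> k = 0") auto
    then show ?thesis by (simp add: vec_eq_iff)
  qed
  then have "inj_on ((*v) P) S"
    using vec.linear_inj_on_iff_eq_0[OF matrix_vector_mul_linear_gen S] by blast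
  then have "vec.dim ((*v) P ` S) = vec.dim S"
    using vec.dim_image_eq[OF matrix_vector_mul_linear_gen] vec.span_eq_iff[of S] S by metis
  moreover have "vec.dim ((*v) P ` S) \<le> vec.dim {x::complex ^ 'a. \<forall>i. i \<notin> {k. \<epsilon> k > 0} \<longrightarrow> x $ i = 0}"
    by (rule vec.dim_subset) (auto simp: P)
  ultimately show ?thesis by (simp only: dim_substandard_cart)
qed

text \<open>As \<open>\<epsilon>\<close> may vanish at some coordinates, preserving the form does
  not imply invertibility, which is therefore demanded separately.\<close>

definition isometry :: "('a::finite \<Rightarrow> real) \<Rightarrow> complex ^ 'a ^ 'a \<Rightarrow> bool" where
  "isometry \<epsilon> \<Phi> \<longleftrightarrow> invertible \<Phi> \<and> (\<forall>v w. hform \<epsilon> (\<Phi> *v v) (\<Phi> *v w) = hform \<epsilon> v w)"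

lemma isometry_hform: "isometry \<epsilon> \<Phi> \<Longrightarrow> hform \<epsilon> (\<Phi> *v v) (\<Phi> *v w) = hform \<epsilon> v w"
  by (simp add: isometry_def)

lemma isometry_hq: "isometry \<epsilon> \<Phi> \<Longrightarrow> hq \<epsilon> (\<Phi> *v v) = hq \<epsilon> v"
  using isometry_hform[of \<epsilon> \<Phi> v v] by (simp add: hform_self)

lemma isometry_mult: "isometry \<epsilon> \<Phi> \<Longrightarrow> isometry \<epsilon> \<Psi> \<Longrightarrow> isometry \<epsilon> (\<Phi> ** \<Psi>)"
  by (simp add: isometry_def invertible_mult matrix_vector_mul_assoc[symmetric])

lemma isometry_mat_1: "isometry \<epsilon> (mat 1)"
  by (auto simp: isometry_def invertible_def)

lemma invertible_inverseE:
  fixes A :: "complex ^ 'a::finite ^ 'a"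
  assumes "invertible A"
  obtains B where "A ** B = mat 1" "B ** A = mat 1"
  using assms by (auto simp: invertible_def)

lemma isometry_inverseE:
  assumes "isometry \<epsilon> \<Phi>"
  obtains \<Psi> where "isometry \<epsilon> \<Psi>" "\<Phi> ** \<Psi> = mat 1" "\<Psi> ** \<Phi> = mat 1"
proof -
  obtain \<Psi> where \<Psi>: "\<Phi> ** \<Psi> = mat 1" "\<Psi> ** \<Phi> = mat 1"
    using assms invertible_inverseE by (auto simp: isometry_def)
  have "hform \<epsilon> (\<Psi> *v v) (\<Psi> *v w) = hform \<epsilon> v w" for v w
    using isometry_hform[OF assms, of "\<Psi> *v v" "\<Psi> *v w"]
    by (simp add: matrix_vector_mul_assoc \<Psi>)
  then have "isometry \<epsilon> \<Psi>"
    using \<Psi> by (auto simp: isometry_def invertible_def)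
  then show thesis using \<Psi> that by blast
qed

lemma invertibleI_injective:
  fixes A :: "complex ^ 'a::finite ^ 'a"
  assumes "\<And>v. A *v v = 0 \<Longrightarrow> v = 0"
  shows "invertible A"
proof -
  have "inj ((*v) A)"
    using vec.linear_inj_iff_eq_0[OF matrix_vector_mul_linear_gen, of A] assms by blast
  then show ?thesis
    by (simp add: invertible_left_inverse matrix_left_invertible_injective)
qed

section \<open>Reflections and Witt's theorem\<close>

text \<open>A complex reflection along \<open>w - e\<close>; the multiplier \<open>hform \<epsilon> v u / a\<close> is the one that sends
  \<open>w\<close> to \<open>e\<close>, and it is automatically unitary because \<open>hform \<epsilon> u u = a + cnj a\<close>.\<close>

lemma exists_reflection:
  fixes w e :: "complex ^ 'a::finite"
  assumes eq: "hform \<epsilon> w w = hform \<epsilon> e e" and ne: "hform \<epsilon> w (w - e) \<noteq> 0"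
  shows "\<exists>\<Phi>. isometry \<epsilon> \<Phi> \<and> \<Phi> *v w = e \<and>
    (\<forall>v. hform \<epsilon> v w = 0 \<and> hform \<epsilon> v e = 0 \<longrightarrow> \<Phi> *v v = v) \<and>
    (\<forall>k v. w $ k = 0 \<and> e $ k = 0 \<longrightarrow> (\<Phi> *v v) $ k = v $ k)"
proof -
  define u where "u = w - e"
  define a where "a = hform \<epsilon> w u"
  define \<Phi> where "\<Phi> = matrix (\<lambda>v. v - (hform \<epsilon> v u / a) *s u)"
  have a: "a \<noteq> 0" using ne by (simp add: a_def u_def)
  have "Vector_Spaces.linear (*s) (*s) (\<lambda>v. v - (hform \<epsilon> v u / a) *s u)"
    by (simp add: Vector_Spaces.linear_iff vec.vector_space_axioms hform_simps vec_eq_iff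
        add_divide_distrib algebra_simps)
  then have \<Phi>: "\<Phi> *v v = v - (hform \<epsilon> v u / a) *s u" for v
    unfolding \<Phi>_def by (rule matrix_works)
  have uu: "hform \<epsilon> u u = a + cnj a"
    by (simp add: a_def u_def hform_simps hform_cnj eq)
  have uv: "hform \<epsilon> u v = cnj (hform \<epsilon> v u)" for v
    by (simp add: hform_cnj)
  have iso: "hform \<epsilon> (\<Phi> *v v) (\<Phi> *v v') = hform \<epsilon> v v'" for v v'
    unfolding \<Phi> hform_simps uv[of v'] uu using a by (simp add: field_simps)
  have "v = 0" if "\<Phi> *v v = 0" for v
  proof -
    \<comment> \<open>A vector of the kernel is orthogonal to \<open>u\<close>, hence not moved by
      the reflection at all.\<close>
    have "hform \<epsilon> v u = 0"
      using iso[of v u] that by simp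
    then show ?thesis using that by (simp add: \<Phi>)
  qed
  then have "isometry \<epsilon> \<Phi>"
    using iso by (auto simp: isometry_def intro: invertibleI_injective)
  moreover have "\<Phi> *v w = e"
    unfolding \<Phi> using a by (simp flip: a_def) (simp add: u_def)
  moreover have "\<Phi> *v v = v" if "hform \<epsilon> v w = 0" "hform \<epsilon> v e = 0" for v
    unfolding \<Phi> using that by (simp add: u_def hform_simps)
  moreover have "(\<Phi> *v v) $ k = v $ k" if "w $ k = 0" "e $ k = 0" for k v
    unfolding \<Phi> using that by (simp add: u_def)
  ultimately show ?thesis by blast
qed

text \<open>One reflection fails only if \<open>w\<close> is orthogonal to \<open>w - e\<close>.
  Then neither the pair \<open>w\<close>, \<open>- e\<close> nor the pair \<open>- e\<close>,
  \<open>e\<close> has this defect, and two reflections compose to the required map.\<close>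

lemma exists_isometry:
  fixes w e :: "complex ^ 'a::finite"
  assumes eq: "hform \<epsilon> w w = hform \<epsilon> e e" and ne: "hform \<epsilon> e e \<noteq> 0"
  shows "\<exists>\<Phi>. isometry \<epsilon> \<Phi> \<and> \<Phi> *v w = e \<and>
    (\<forall>v. hform \<epsilon> v w = 0 \<and> hform \<epsilon> v e = 0 \<longrightarrow> \<Phi> *v v = v) \<and>
    (\<forall>k v. w $ k = 0 \<and> e $ k = 0 \<longrightarrow> (\<Phi> *v v) $ k = v $ k)"
proof (cases "hform \<epsilon> w (w - e) = 0")
  case False
  then show ?thesis by (rule exists_reflection[OF eq])
next
  case True
  then have we: "hform \<epsilon> w e = hform \<epsilon> e e" using eq by (simp add: hform_simps)
  obtain \<Phi> where \<Phi>: "isometry \<epsilon> \<Phi>" "\<Phi> *v w = - e"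
    "\<And>v. hform \<epsilon> v w = 0 \<Longrightarrow> hform \<epsilon> v (- e) = 0 \<Longrightarrow> \<Phi> *v v = v"
    "\<And>k v. w $ k = 0 \<Longrightarrow> (- e) $ k = 0 \<Longrightarrow> (\<Phi> *v v) $ k = v $ k"
    using exists_reflection[of \<epsilon> w "- e"] eq ne we by (auto simp: hform_simps)
  obtain \<Psi> where \<Psi>: "isometry \<epsilon> \<Psi>" "\<Psi> *v (- e) = e"
    "\<And>v. hform \<epsilon> v (- e) = 0 \<Longrightarrow> hform \<epsilon> v e = 0 \<Longrightarrow> \<Psi> *v v = v"
    "\<And>k v. (- e) $ k = 0 \<Longrightarrow> e $ k = 0 \<Longrightarrow> (\<Psi> *v v) $ k = v $ k"
  proof -
    have "hform \<epsilon> (- e) (- e - e) \<noteq> 0" "hform \<epsilon> (- e) (- e) = hform \<epsilon> e e"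
      using ne by (simp_all only: hform_simps minus_minus) simp
    then show ?thesis using that exists_reflection[of \<epsilon> "- e" e] by blast
  qed
  show ?thesis
    by (rule exI[of _ "\<Psi> ** \<Phi>"])
      (use \<Phi> \<Psi> in \<open>simp add: isometry_mult matrix_vector_mul_assoc[symmetric] hform_simps\<close>)
qed

text \<open>One vector is moved at a time. The isometry for the first \<open>n\<close> vectors sends
  \<open>w n\<close> to a vector orthogonal to the earlier \<open>e i\<close>, and the next one,
  taking it to \<open>e n\<close>, fixes what is orthogonal to both. The last two conclusions
  control the radical: vectors orthogonal to everything stay fixed, and coordinates absent from all
  given vectors are untouched.\<close>

lemma witt_extension:
  fixes w e :: "nat \<Rightarrow> complex ^ 'a::finite"
  assumes "\<And>i j. i < n \<Longrightarrow> j < n \<Longrightarrow> hform \<epsilon> (w i) (w j) = hform \<epsilon> (e i) (e j)"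
    and "\<And>i j. i < n \<Longrightarrow> j < n \<Longrightarrow> i \<noteq> j \<Longrightarrow> hform \<epsilon> (e i) (e j) = 0"
    and "\<And>i. i < n \<Longrightarrow> hform \<epsilon> (e i) (e i) \<noteq> 0"
  shows "\<exists>\<Phi>. isometry \<epsilon> \<Phi> \<and> (\<forall>i<n. \<Phi> *v w i = e i) \<and>
    (\<forall>v. (\<forall>i<n. hform \<epsilon> v (w i) = 0 \<and> hform \<epsilon> v (e i) = 0) \<longrightarrow> \<Phi> *v v = v) \<and>
    (\<forall>k v. (\<forall>i<n. w i $ k = 0 \<and> e i $ k = 0) \<longrightarrow> (\<Phi> *v v) $ k = v $ k)"
  using assms
proof (induction n)
  case 0
  show ?case by (intro exI[of _ "mat 1"]) (simp add: isometry_mat_1)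
next
  case (Suc n)
  have "\<exists>\<Phi>. isometry \<epsilon> \<Phi> \<and> (\<forall>i<n. \<Phi> *v w i = e i) \<and>
    (\<forall>v. (\<forall>i<n. hform \<epsilon> v (w i) = 0 \<and> hform \<epsilon> v (e i) = 0) \<longrightarrow> \<Phi> *v v = v) \<and>
    (\<forall>k v. (\<forall>i<n. w i $ k = 0 \<and> e i $ k = 0) \<longrightarrow> (\<Phi> *v v) $ k = v $ k)"
    by (rule Suc.IH) (simp_all add: Suc.prems)
  then obtain \<Phi> where \<Phi>: "isometry \<epsilon> \<Phi>" "\<And>i. i < n \<Longrightarrow> \<Phi> *v w i = e i"
    "\<And>v. (\<And>i. i < n \<Longrightarrow> hform \<epsilon> v (w i) = 0 \<and> hform \<epsilon> v (e i) = 0) \<Longrightarrow> \<Phi> *v v = v"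
    "\<And>k v. (\<And>i. i < n \<Longrightarrow> w i $ k = 0 \<and> e i $ k = 0) \<Longrightarrow> (\<Phi> *v v) $ k = v $ k"
    by blast
  define w' where "w' = \<Phi> *v w n"
  have "hform \<epsilon> w' w' = hform \<epsilon> (e n) (e n)"
    using Suc.prems(1)[of n n] by (simp add: w'_def isometry_hform[OF \<Phi>(1)])
  then obtain \<Psi> where \<Psi>: "isometry \<epsilon> \<Psi>" "\<Psi> *v w' = e n"
    "\<And>v. hform \<epsilon> v w' = 0 \<Longrightarrow> hform \<epsilon> v (e n) = 0 \<Longrightarrow> \<Psi> *v v = v"
    "\<And>k v. w' $ k = 0 \<Longrightarrow> e n $ k = 0 \<Longrightarrow> (\<Psi> *v v) $ k = v $ k"
    using exists_isometry[of \<epsilon> w' "e n"] Suc.prems(3)[of n] by auto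
  have *: "(\<Psi> ** \<Phi>) *v v = \<Psi> *v (\<Phi> *v v)" for v
    by (simp add: matrix_vector_mul_assoc)
  have 1: "(\<Psi> ** \<Phi>) *v w i = e i" if i: "i < Suc n" for i
  proof (cases "i = n")
    case True
    then show ?thesis using \<Psi>(2) by (simp add: * w'_def)
  next
    case False
    with i have i: "i < n" by simp
    have "hform \<epsilon> (e i) w' = hform \<epsilon> (w i) (w n)"
      using isometry_hform[OF \<Phi>(1), of "w i" "w n"] \<Phi>(2)[OF i] by (simp add: w'_def)
    also have "\<dots> = 0" using Suc.prems(1,2)[of i n] i by simp
    finally have "\<Psi> *v e i = e i"
      using \<Psi>(3) Suc.prems(2)[of i n] i by simp
    then show ?thesis using \<Phi>(2)[OF i] by (simp add: *)
  qed
  have 2: "(\<Psi> ** \<Phi>) *v v = v"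
    if v: "\<forall>i<Suc n. hform \<epsilon> v (w i) = 0 \<and> hform \<epsilon> v (e i) = 0" for v
  proof -
    have v': "\<Phi> *v v = v" using v \<Phi>(3) by simp
    moreover have "hform \<epsilon> v w' = 0"
      using isometry_hform[OF \<Phi>(1), of v "w n"] v' v by (simp add: w'_def)
    ultimately show ?thesis using v \<Psi>(3) by (simp add: *)
  qed
  have 3: "((\<Psi> ** \<Phi>) *v v) $ k = v $ k"
    if k: "\<forall>i<Suc n. w i $ k = 0 \<and> e i $ k = 0" for k v
  proof -
    have \<Phi>k: "(\<Phi> *v v) $ k = v $ k" for v
      using \<Phi>(4)[of k] k by simp
    have "w' $ k = 0" using k by (simp add: w'_def \<Phi>k)
    then show ?thesis using \<Psi>(4)[of k] k \<Phi>k by (simp add: *)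
  qed
  show ?case
    using isometry_mult[OF \<Psi>(1) \<Phi>(1)] 1 2 3 by blast
qed

section \<open>Skew-Hermitian operators and the Cayley transform\<close>

definition hskew :: "('a::finite \<Rightarrow> real) \<Rightarrow> complex ^ 'a ^ 'a \<Rightarrow> bool" where
  "hskew \<epsilon> X \<longleftrightarrow> (\<forall>v w. hform \<epsilon> (X *v v) w + hform \<epsilon> v (X *v w) = 0)"

lemma hskewI:
  assumes "\<And>i j. of_real (\<epsilon> i) * X $ i $ j + of_real (\<epsilon> j) * cnj (X $ j $ i) = 0"
  shows "hskew \<epsilon> X"
proof -
  have "hform \<epsilon> (X *v v) w + hform \<epsilon> v (X *v w) = 0" for v w
  proof -
    have "hform \<epsilon> (X *v v) w = (\<Sum>i\<in>UNIV. \<Sum>j\<in>UNIV. of_real (\<epsilon> i) * X $ i $ j * v $ j * cnj (w $ i))"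
      by (simp add: hform_def matrix_vector_mult_def sum_distrib_left sum_distrib_right mult.assoc)
    moreover have "hform \<epsilon> v (X *v w) =
        (\<Sum>j\<in>UNIV. \<Sum>i\<in>UNIV. of_real (\<epsilon> j) * cnj (X $ j $ i) * v $ j * cnj (w $ i))"
      by (simp add: hform_def matrix_vector_mult_def sum_distrib_left sum_distrib_right mult.assoc
          mult.left_commute)
    moreover have "\<dots> =
        (\<Sum>i\<in>UNIV. \<Sum>j\<in>UNIV. of_real (\<epsilon> j) * cnj (X $ j $ i) * v $ j * cnj (w $ i))"
      by (rule sum.swap)
    ultimately have "hform \<epsilon> (X *v v) w + hform \<epsilon> v (X *v w) = (\<Sum>i\<in>UNIV. \<Sum>j\<in>UNIV.
        (of_real (\<epsilon> i) * X $ i $ j + of_real (\<epsilon> j) * cnj (X $ j $ i)) * v $ j * cnj (w $ i))"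
      by (simp add: sum.distrib distrib_right)
    then show ?thesis by (simp add: assms)
  qed
  then show ?thesis by (simp add: hskew_def)
qed

text \<open>Skewness makes the mixed terms cancel. Applied to preimages under \<open>1 - X\<close>,
  this says that the Cayley transform \<open>(1 + X) / (1 - X)\<close> is an isometry.\<close>

lemma hskew_cayley:
  assumes "hskew \<epsilon> X"
  shows "hform \<epsilon> (u + X *v u) (v + X *v v) = hform \<epsilon> (u - X *v u) (v - X *v v)"
proof -
  have "hform \<epsilon> u (X *v v) = - hform \<epsilon> (X *v u) v"
    using assms by (simp add: hskew_def eq_neg_iff_add_eq_0 add.commute)
  then show ?thesis by (simp add: hform_simps)
qed

text \<open>The skew-Hermitian operators form a real form of all operators: \<open>skew_line \<epsilon> X \<tau>\<close> is the
  skew part of \<open>X\<close> plus \<open>\<tau>\<close> times the other one, so that \<open>\<tau> = \<i>\<close> recovers \<open>X\<close>.\<close>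

definition skew_line :: "('a::finite \<Rightarrow> real) \<Rightarrow> complex ^ 'a ^ 'a \<Rightarrow> complex \<Rightarrow> complex ^ 'a ^ 'a" where
  "skew_line \<epsilon> X \<tau> = (\<chi> i j. (X $ i $ j - of_real (\<epsilon> i * \<epsilon> j) * cnj (X $ j $ i)) / 2 +
     \<tau> * ((X $ i $ j + of_real (\<epsilon> i * \<epsilon> j) * cnj (X $ j $ i)) / (2 * \<i>)))"

lemma skew_line_i: "skew_line \<epsilon> X \<i> = X"
  by (simp add: skew_line_def vec_eq_iff field_simps)

lemma matrix_vector_axis: "(X *v axis k 1) $ i = X $ i $ k"
  for X :: "complex ^ 'a::finite ^ 'b::finite"
  by (simp add: matrix_vector_mult_def axis_def if_distrib[of "(*) _"] cong: if_cong)

lemma skew_line_column: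
  assumes "\<epsilon> k = 0" "X *v axis k 1 = 0" shows "skew_line \<epsilon> X \<tau> *v axis k 1 = 0"
proof -
  have "X $ i $ k = 0" for i
    using assms(2) matrix_vector_axis[of X k i] by simp
  then show ?thesis
    using assms(1) by (simp add: vec_eq_iff matrix_vector_axis skew_line_def)
qed

text \<open>Where the form is nondegenerate, the adjoint of \<open>X\<close> has the entries
  \<open>\<epsilon> i * \<epsilon> j * cnj (X $ j $ i)\<close>, and a self-adjoint operator divided
  by \<open>\<i>\<close> is skew; so real combinations of the two parts are skew. On the radical
  this formula gives 0 instead of an adjoint, which is harmless because the columns of
  \<open>X\<close> vanish there.\<close>

lemma hskew_skew_line:
  assumes \<epsilon>: "\<And>k. \<epsilon> k = 1 \<or> \<epsilon> k = -1 \<or> \<epsilon> k = 0" and X: "\<And>k. \<epsilon> k = 0 \<Longrightarrow> X *v axis k 1 = 0"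
  shows "hskew \<epsilon> (skew_line \<epsilon> X (of_real t))"
proof (rule hskewI)
  fix i j
  have X0: "X $ i $ k = 0" if "\<epsilon> k = 0" for i k
    using X[OF that] matrix_vector_axis[of X k i] by simp
  show "of_real (\<epsilon> i) * skew_line \<epsilon> X (of_real t) $ i $ j +
      of_real (\<epsilon> j) * cnj (skew_line \<epsilon> X (of_real t) $ j $ i) = 0"
    using \<epsilon>[of i] \<epsilon>[of j] X0[of i j] X0[of j i]
    by (elim disjE) (simp_all add: skew_line_def field_simps)
qed

section \<open>Holomorphic collineations are linear\<close>

text \<open>Comparing the coordinate \<open>l\<close>, which is 1 for all three vectors, forces the
  two coefficients to have sum 1; a linear dependence becomes a position on an affine line.\<close>

lemma in_span_two:
  fixes A B X :: "complex ^ 'b::finite"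
  assumes "vec.dim {A, B, X} \<le> 2" "A $ l = 1" "B $ l = 1" "X $ l = 1" "A \<noteq> B"
  shows "\<exists>\<beta>. X = (1 - \<beta>) *s A + \<beta> *s B"
proof -
  have nz: "A \<noteq> 0" "B \<noteq> 0" using assms(2,3) by auto
  have "B \<notin> vec.span {A}"
  proof
    assume "B \<in> vec.span {A}"
    then obtain k where "B = k *s A" by (auto simp: vec.span_singleton)
    with assms show False by auto
  qed
  then have "vec.dim {B, A} = 2" using nz by (simp add: vec.dim_insert)
  moreover have "vec.dim {X, B, A} \<le> 2" using assms(1) by (simp add: insert_commute)
  ultimately have "X \<in> vec.span {B, A}"
    by (cases "X \<in> vec.span {B, A}") (simp_all add: vec.dim_insert[of X])
  then obtain \<beta> k where "X - \<beta> *s B = k *s A"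
    by (auto simp: vec.span_breakdown_eq[of X B "{A}"] vec.span_singleton)
  then have X: "X = k *s A + \<beta> *s B" by (simp add: algebra_simps)
  from arg_cong[OF this, of "\<lambda>v. v $ l"] have "k = 1 - \<beta>"
    using assms by (simp add: algebra_simps)
  with X show ?thesis by blast
qed

text \<open>Additivity transports the derivative at 0 to every point of the ball, so
  \<open>g - D\<close> is constant, with value \<open>g 0 = 0\<close>.\<close>

lemma additive_holo_on_linear:
  assumes g: "holo_on g (ball 0 e)" and e: "e > 0"
    and add: "\<And>v w. norm v < e \<Longrightarrow> norm w < e \<Longrightarrow> norm (v + w) < e \<Longrightarrow> g (v + w) = g v + g w"
  shows "\<exists>D. Vector_Spaces.linear (*s) (*) D \<and> (\<forall>v. norm v < e \<longrightarrow> g v = D v)"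
proof -
  obtain D where D: "Vector_Spaces.linear (*s) (*) D" "(g has_derivative D) (at 0)"
    using holo_on_openE[OF g open_ball, of 0] e by auto
  interpret D: bounded_linear D using D(2) by (rule has_derivative_bounded_linear)
  have g0: "g 0 = 0" using add[of 0 0] e by simp
  have "((\<lambda>v. g v - D v) has_derivative (\<lambda>h. 0)) (at v within ball 0 e)" if v: "v \<in> ball 0 e" for v
  proof -
    have "((\<lambda>w. w - v) has_derivative (\<lambda>h. h)) (at v)"
      by (auto intro!: derivative_eq_intros)
    moreover have "(g has_derivative D) (at (v - v))" using D(2) by simp
    ultimately have "((\<lambda>w. g (w - v)) has_derivative D) (at v)"
      by (rule has_derivative_compose)
    then have "((\<lambda>w. g v + g (w - v)) has_derivative D) (at v)"
      by (auto intro!: derivative_eq_intros)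
    moreover have "open (ball 0 e \<inter> ball v e)" by (intro open_Int open_ball)
    ultimately have "(g has_derivative D) (at v)"
    proof (rule has_derivative_transform_within_open)
      show "v \<in> ball 0 e \<inter> ball v e" using v e by simp
      show "g v + g (w - v) = g w" if "w \<in> ball 0 e \<inter> ball v e" for w
        using add[of v "w - v"] that v by (simp add: dist_norm norm_minus_commute)
    qed
    then have "((\<lambda>v. g v - D v) has_derivative (\<lambda>h. D h - D h)) (at v)"
      by (intro has_derivative_diff D.has_derivative) (auto intro: derivative_intros)
    then show ?thesis by (simp add: has_derivative_at_withinI)
  qed
  then obtain c where "\<And>v. v \<in> ball 0 e \<Longrightarrow> g v - D v = c"
    using has_derivative_zero_constant[of "ball 0 e" "\<lambda>v. g v - D v"] by auto
  moreover from this[of 0] have "c = 0" using e g0 by simp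
  ultimately have "g v = D v" if "norm v < e" for v using that by simp
  with D(1) show ?thesis by blast
qed

text \<open>A projective map is represented by its values in the chart where coordinate
  \<open>l\<close> is 1, on a convex cone of representatives. \<open>lines\<close> speaks only of
  sums, which within a cone reach all positive combinations. \<open>rank\<close> says that the image
  is not contained in a projective line.\<close>

locale collineation =
  fixes C :: "(complex ^ 'a::finite) set" and G :: "complex ^ 'a \<Rightarrow> complex ^ 'b::finite" and l :: 'b
  assumes open_C: "open C" and convex_C: "convex C"
    and cone_C: "\<And>t z. t > 0 \<Longrightarrow> z \<in> C \<Longrightarrow> t *\<^sub>R z \<in> C"
    and holo_G: "\<And>k. holo_on (\<lambda>z. G z $ k) C"
    and G_l: "\<And>z. z \<in> C \<Longrightarrow> G z $ l = 1"
    and G_scale: "\<And>t z. t > 0 \<Longrightarrow> z \<in> C \<Longrightarrow> G (t *\<^sub>R z) = G z"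
    and lines: "\<And>z w. z \<in> C \<Longrightarrow> w \<in> C \<Longrightarrow> vec.dim {G z, G w, G (z + w)} \<le> 2"
    and rank: "vec.dim (G ` C) \<ge> 3"
begin

lemma add_C: "z \<in> C \<Longrightarrow> w \<in> C \<Longrightarrow> z + w \<in> C"
proof -
  assume "z \<in> C" "w \<in> C"
  then have "(1/2) *\<^sub>R z + (1/2) *\<^sub>R w \<in> C" using convex_C by (intro convexD) auto
  then have "2 *\<^sub>R ((1/2) *\<^sub>R z + (1/2) *\<^sub>R w) \<in> C" by (intro cone_C) auto
  then show ?thesis by (simp add: scaleR_add_right)
qed

lemma line_eq:
  assumes "z \<in> C" "w \<in> C" "G z \<noteq> G w"
  shows "\<exists>\<beta>. G (z + w) = (1 - \<beta>) *s G z + \<beta> *s G w"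
  using in_span_two[OF lines[OF assms(1,2)] G_l[OF assms(1)] G_l[OF assms(2)] G_l[OF add_C[OF assms(1,2)]]]
    assms(3) by blast

text \<open>As coordinate \<open>l\<close> of all values on \<open>C\<close> is 1, this is the minor
  of \<open>G a\<close>, \<open>G b\<close>, \<open>G c\<close> in the rows \<open>l\<close>,
  \<open>i\<close>, \<open>j\<close>; if it is nonzero, the three values are independent.\<close>

definition \<Delta> :: "'b \<Rightarrow> 'b \<Rightarrow> complex ^ 'a \<Rightarrow> complex ^ 'a \<Rightarrow> complex ^ 'a \<Rightarrow> complex" where
  "\<Delta> i j a b c = (G b $ i - G a $ i) * (G c $ j - G a $ j) - (G b $ j - G a $ j) * (G c $ i - G a $ i)"

lemma nonconstant: "\<exists>a\<in>C. \<exists>b\<in>C. \<exists>j. G a $ j \<noteq> G b $ j"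
proof (rule ccontr)
  assume *: "\<not> ?thesis"
  have "C \<noteq> {}" using rank by auto
  then obtain a where a: "a \<in> C" by blast
  have "G c = G a" if "c \<in> C" for c
    unfolding vec_eq_iff using * a that by blast
  then have "G ` C \<subseteq> {G a}" by blast
  then have "vec.dim (G ` C) \<le> vec.dim {G a}" by (rule vec.dim_subset)
  then show False using rank by (simp split: if_splits)
qed

text \<open>If all minors vanished, two values differing in a coordinate \<open>i\<close> would
  affinely determine every other value, and the image would have rank at most 2.\<close>

lemma exists_\<Delta>_nonzero: "\<exists>i j. \<exists>a\<in>C. \<exists>b\<in>C. \<exists>c\<in>C. \<Delta> i j a b c \<noteq> 0"
proof (rule ccontr)
  assume *: "\<not> ?thesis"
  obtain a b i where ab: "a \<in> C" "b \<in> C" "G a $ i \<noteq> G b $ i" using nonconstant by blast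
  have "G c \<in> vec.span {G a, G b}" if c: "c \<in> C" for c
  proof -
    define x where "x = (G c $ i - G a $ i) / (G b $ i - G a $ i)"
    have "G c $ j = G a $ j + x * (G b $ j - G a $ j)" for j
    proof -
      have "\<Delta> i j a b c = 0" using * ab c by blast
      then have "(G c $ j - G a $ j) * (G b $ i - G a $ i) = (G c $ i - G a $ i) * (G b $ j - G a $ j)"
        by (simp add: \<Delta>_def algebra_simps)
      then have "G c $ j - G a $ j = (G c $ i - G a $ i) * (G b $ j - G a $ j) / (G b $ i - G a $ i)"
        using ab(3) by (subst eq_divide_eq) auto
      then show ?thesis by (simp add: x_def algebra_simps)
    qed
    then have Gc: "G c = (1 - x) *s G a + x *s G b"
      by (simp add: vec_eq_iff algebra_simps)
    show ?thesis unfolding Gc by (intro vec.span_add vec.span_scale vec.span_base) auto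
  qed
  then have "G ` C \<subseteq> vec.span {G a, G b}" by blast
  then have "vec.dim (G ` C) \<le> card {G a, G b}" by (intro vec.dim_le_card) auto
  also have "\<dots> \<le> 2" by (simp add: card_insert_if)
  finally show False using rank by simp
qed

lemma \<Delta>_independent:
  assumes "\<Delta> i j a b c \<noteq> 0" "a \<in> C" "b \<in> C" "c \<in> C"
    and "x *s G a + y *s G b + z *s G c = 0"
  shows "x = 0" "y = 0" "z = 0"
proof -
  have e: "x * G a $ k + y * G b $ k + z * G c $ k = 0" for k
    using arg_cong[OF assms(5), of "\<lambda>v. v $ k"] by simp
  have x: "x = - y - z" using e[of l] assms G_l by (simp add: eq_neg_iff_add_eq_0 algebra_simps)
  have e': "y * (G b $ k - G a $ k) + z * (G c $ k - G a $ k) = 0" for k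
    using e[of k] by (simp add: x algebra_simps)
  have "y * \<Delta> i j a b c = (y * (G b $ i - G a $ i) + z * (G c $ i - G a $ i)) * (G c $ j - G a $ j)
      - (y * (G b $ j - G a $ j) + z * (G c $ j - G a $ j)) * (G c $ i - G a $ i)"
    by (simp add: \<Delta>_def algebra_simps)
  then show y: "y = 0" using e'[of i] e'[of j] assms(1) by simp
  have "z * \<Delta> i j a b c = (y * (G b $ j - G a $ j) + z * (G c $ j - G a $ j)) * (G b $ i - G a $ i)
      - (y * (G b $ i - G a $ i) + z * (G c $ i - G a $ i)) * (G b $ j - G a $ j)"
    by (simp add: \<Delta>_def algebra_simps)
  then show "z = 0" using e'[of i] e'[of j] assms(1) by simp
  then show "x = 0" using x y by simp
qed

text \<open>\<open>G (a + z)\<close> is proportional to \<open>G a + scl a j z *s G z\<close>. The vector \<open>scl a j z *s G z\<close> is the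
  candidate for the value at \<open>z\<close> of the linear map inducing \<open>G\<close>.\<close>

definition scl :: "complex ^ 'a \<Rightarrow> 'b \<Rightarrow> complex ^ 'a \<Rightarrow> complex" where
  "scl a j z = (G (a + z) $ j - G a $ j) / (G z $ j - G (a + z) $ j)"

text \<open>If \<open>\<beta>\<close> is the parameter of \<open>G (a + z)\<close> on the line
  through \<open>G a\<close> and \<open>G z\<close>, then \<open>scl a j z\<close> is
  \<open>\<beta> / (1 - \<beta>)\<close>. A coordinate \<open>j\<close> can be used to read it off
  if it separates \<open>G z\<close> from \<open>G (a + z)\<close>, which also excludes
  \<open>\<beta> = 1\<close>.\<close>

lemma scl_eq:
  assumes "a \<in> C" "z \<in> C" "G a \<noteq> G z" "G z $ j \<noteq> G (a + z) $ j"
  shows "1 + scl a j z \<noteq> 0" "(1 + scl a j z) *s G (a + z) = G a + scl a j z *s G z"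
proof -
  obtain \<beta> where \<beta>: "G (a + z) = (1 - \<beta>) *s G a + \<beta> *s G z"
    using line_eq[OF assms(1-3)] by blast
  have d: "G z $ j - G (a + z) $ j = (1 - \<beta>) * (G z $ j - G a $ j)"
    by (simp add: \<beta> algebra_simps)
  with assms(4) have nz: "1 - \<beta> \<noteq> 0" "G z $ j - G a $ j \<noteq> 0" by auto
  have "G (a + z) $ j - G a $ j = \<beta> * (G z $ j - G a $ j)"
    by (simp add: \<beta> algebra_simps)
  with d nz have h: "scl a j z = \<beta> / (1 - \<beta>)" by (simp add: scl_def)
  have h1: "1 + scl a j z = 1 / (1 - \<beta>)" using nz by (simp add: h field_simps)
  then show "1 + scl a j z \<noteq> 0" using nz by simp
  show "(1 + scl a j z) *s G (a + z) = G a + scl a j z *s G z"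
  proof -
    define \<gamma> where "\<gamma> = 1 - \<beta>"
    have \<gamma>: "\<gamma> \<noteq> 0" "\<beta> = 1 - \<gamma>" using nz by (simp_all add: \<gamma>_def)
    show ?thesis
      unfolding h1 unfolding h \<beta> unfolding \<gamma>(2) using \<gamma>(1) by (simp add: vec_eq_iff field_simps)
  qed
qed

text \<open>The point \<open>G (a + (b + c))\<close> is expanded in the independent vectors
  \<open>G a\<close>, \<open>G b\<close>, \<open>G c\<close> for three bracketings. The bracketing
  \<open>(a + b) + c\<close> fixes the ratio of the first two coefficients,
  \<open>(a + c) + b\<close> that of the first and the third; the unknown parameters
  \<open>\<gamma>\<close> and the factors \<open>Kb\<close>, \<open>Kc\<close> cancel in these
  ratios.\<close>

lemma scl_add:
  assumes C: "a \<in> C" "b \<in> C" "c \<in> C" and \<Delta>: "\<Delta> i i' a b c \<noteq> 0"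
    and ne: "G b $ j \<noteq> G (a + b) $ j" "G c $ j \<noteq> G (a + c) $ j" "G (b + c) $ j \<noteq> G (a + (b + c)) $ j"
  shows "scl a j (b + c) *s G (b + c) = scl a j b *s G b + scl a j c *s G c"
proof -
  note ind = \<Delta>_independent[OF \<Delta> C]
  have indep: "x = x' \<and> y = y' \<and> z = z'"
    if "x *s G a + y *s G b + z *s G c = x' *s G a + y' *s G b + z' *s G c" for x y z x' y' z'
  proof -
    have "(x - x') *s G a + (y - y') *s G b + (z - z') *s G c = 0"
      using that by (simp add: algebra_simps)
    from ind[OF this] show ?thesis by simp
  qed
  have ab: "G a \<noteq> G b" using indep[of 1 0 0 0 1 0] by auto
  have ac: "G a \<noteq> G c" using indep[of 1 0 0 0 0 1] by auto
  have bc: "G b \<noteq> G c" using indep[of 0 1 0 0 0 1] by auto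
  obtain \<beta> where \<beta>: "G (b + c) = (1 - \<beta>) *s G b + \<beta> *s G c"
    using line_eq[OF C(2,3) bc] by blast
  have abc: "G a \<noteq> G (b + c)" using indep[of 1 0 0 0 "1 - \<beta>" \<beta>] by (auto simp: \<beta>)
  let ?h = "scl a j"
  note hb = scl_eq[OF C(1,2) ab ne(1)] and hc = scl_eq[OF C(1,3) ac ne(2)]
    and hbc = scl_eq[OF C(1) add_C[OF C(2,3)] abc ne(3)]
  define P where "P = (1 + ?h (b + c)) *s G (a + (b + c))"
  have P: "P = 1 *s G a + (?h (b + c) * (1 - \<beta>)) *s G b + (?h (b + c) * \<beta>) *s G c"
    unfolding P_def hbc(2) \<beta> by (simp add: vec_eq_iff algebra_simps)
  define Kb where "Kb = inverse (1 + ?h b)"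
  have Gab: "G (a + b) = Kb *s G a + (Kb * ?h b) *s G b"
  proof -
    have "Kb * (1 + ?h b) = 1" using hb(1) by (simp add: Kb_def)
    then have "G (a + b) = (Kb * (1 + ?h b)) *s G (a + b)" by (simp only: vec.scale_one)
    also have "\<dots> = Kb *s ((1 + ?h b) *s G (a + b))" by (simp only: vector_smult_assoc)
    also have "\<dots> = Kb *s (G a + ?h b *s G b)" by (simp only: hb(2))
    finally show ?thesis by (simp add: vec_eq_iff algebra_simps)
  qed
  define Kc where "Kc = inverse (1 + ?h c)"
  have Gac: "G (a + c) = Kc *s G a + (Kc * ?h c) *s G c"
  proof -
    have "Kc * (1 + ?h c) = 1" using hc(1) by (simp add: Kc_def)
    then have "G (a + c) = (Kc * (1 + ?h c)) *s G (a + c)" by (simp only: vec.scale_one)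
    also have "\<dots> = Kc *s ((1 + ?h c) *s G (a + c))" by (simp only: vector_smult_assoc)
    also have "\<dots> = Kc *s (G a + ?h c *s G c)" by (simp only: hc(2))
    finally show ?thesis by (simp add: vec_eq_iff algebra_simps)
  qed
  have 1: "?h (b + c) * (1 - \<beta>) = ?h b"
  proof -
    have "G (a + b) \<noteq> G c"
    proof
      assume "G (a + b) = G c"
      then have "Kb *s G a + (Kb * ?h b) *s G b + 0 *s G c = 0 *s G a + 0 *s G b + 1 *s G c"
        unfolding Gab by simp
      from indep[OF this] show False by simp
    qed
    then obtain \<gamma> where \<gamma>: "G ((a + b) + c) = (1 - \<gamma>) *s G (a + b) + \<gamma> *s G c"
      using line_eq[OF add_C[OF C(1,2)] C(3)] by blast
    have "P = ((1 + ?h (b + c)) * (1 - \<gamma>) * Kb) *s G a +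
        ((1 + ?h (b + c)) * (1 - \<gamma>) * Kb * ?h b) *s G b + ((1 + ?h (b + c)) * \<gamma>) *s G c"
      unfolding P_def add.assoc[symmetric] \<gamma> Gab by (simp add: vec_eq_iff algebra_simps)
    from indep[OF P[symmetric, THEN trans, OF this]] show ?thesis
      by (metis mult_1)
  qed
  have 2: "?h (b + c) * \<beta> = ?h c"
  proof -
    have "G (a + c) \<noteq> G b"
    proof
      assume "G (a + c) = G b"
      then have "Kc *s G a + 0 *s G b + (Kc * ?h c) *s G c = 0 *s G a + 1 *s G b + 0 *s G c"
        unfolding Gac by simp
      from indep[OF this] show False by simp
    qed
    then obtain \<gamma> where \<gamma>: "G ((a + c) + b) = (1 - \<gamma>) *s G (a + c) + \<gamma> *s G b"
      using line_eq[OF add_C[OF C(1,3)] C(2)] by blast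
    have abc': "a + (b + c) = (a + c) + b" by (simp add: algebra_simps)
    have "P = ((1 + ?h (b + c)) * (1 - \<gamma>) * Kc) *s G a +
        ((1 + ?h (b + c)) * \<gamma>) *s G b + ((1 + ?h (b + c)) * (1 - \<gamma>) * Kc * ?h c) *s G c"
      unfolding P_def abc' \<gamma> Gac by (simp add: vec_eq_iff algebra_simps)
    from indep[OF P[symmetric, THEN trans, OF this]] show ?thesis
      by (metis mult_1)
  qed
  have "?h (b + c) *s G (b + c) = (?h (b + c) * (1 - \<beta>)) *s G b + (?h (b + c) * \<beta>) *s G c"
    unfolding \<beta> by (simp add: vec_eq_iff algebra_simps)
  then show ?thesis by (simp only: 1 2)
qed

text \<open>Holomorphy along three complex lines traversed simultaneously: just enough to compare
  two triples of points by the one-variable identity theorem.\<close>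

definition lhol :: "(complex ^ 'a \<Rightarrow> complex ^ 'a \<Rightarrow> complex ^ 'a \<Rightarrow> complex) \<Rightarrow> bool" where
  "lhol \<phi> \<longleftrightarrow> (\<forall>a a' b b' c c'. (\<lambda>t. \<phi> (cline a a' t) (cline b b' t) (cline c c' t)) holomorphic_on
     (cline a a' -` C \<inter> cline b b' -` C \<inter> cline c c' -` C))"

lemma lhol_mult: "lhol \<phi> \<Longrightarrow> lhol \<psi> \<Longrightarrow> lhol (\<lambda>a b c. \<phi> a b c * \<psi> a b c)"
  and lhol_diff: "lhol \<phi> \<Longrightarrow> lhol \<psi> \<Longrightarrow> lhol (\<lambda>a b c. \<phi> a b c - \<psi> a b c)"
  unfolding lhol_def by (intro allI holomorphic_on_mult holomorphic_on_diff; blast)+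

lemma cline_add: "cline a a' t + cline b b' t = cline (a + b) (a' + b') t"
  by (simp add: cline_def algebra_simps)

lemma lhol_G:
  "lhol (\<lambda>a b c. G a $ k)" "lhol (\<lambda>a b c. G b $ k)" "lhol (\<lambda>a b c. G c $ k)"
  "lhol (\<lambda>a b c. G (a + b) $ k)" "lhol (\<lambda>a b c. G (a + c) $ k)" "lhol (\<lambda>a b c. G (b + c) $ k)"
  "lhol (\<lambda>a b c. G (a + (b + c)) $ k)"
proof -
  have *: "(\<lambda>t. G (cline a a' t) $ k) holomorphic_on T" if "T \<subseteq> cline a a' -` C" for a a' T
    using holo_on_cline[OF holo_G open_C] that by (rule holomorphic_on_subset)
  have C2: "cline (a + b) (a' + b') t \<in> C" if "cline a a' t \<in> C" "cline b b' t \<in> C" for a a' b b' t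
    using add_C[OF that] by (simp add: cline_add)
  show "lhol (\<lambda>a b c. G a $ k)" "lhol (\<lambda>a b c. G b $ k)" "lhol (\<lambda>a b c. G c $ k)"
    unfolding lhol_def by (intro allI *; blast)+
  show "lhol (\<lambda>a b c. G (a + b) $ k)" "lhol (\<lambda>a b c. G (a + c) $ k)" "lhol (\<lambda>a b c. G (b + c) $ k)"
    "lhol (\<lambda>a b c. G (a + (b + c)) $ k)"
    unfolding lhol_def cline_add by (intro allI * subsetI; auto intro!: C2)+
qed

text \<open>Lets one triple satisfy several genericity conditions. On the lines joining the two
  given triples \<open>f\<close> is nonzero near 0, so a vanishing product would make
  \<open>g\<close> vanish near 0 and hence at 1.\<close>

lemma lhol_product_nonzero:
  assumes "lhol \<phi>" "lhol \<psi>"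
    and \<phi>: "\<exists>a\<in>C. \<exists>b\<in>C. \<exists>c\<in>C. \<phi> a b c \<noteq> 0" and \<psi>: "\<exists>a\<in>C. \<exists>b\<in>C. \<exists>c\<in>C. \<psi> a b c \<noteq> 0"
  shows "\<exists>a\<in>C. \<exists>b\<in>C. \<exists>c\<in>C. \<phi> a b c * \<psi> a b c \<noteq> 0"
proof -
  obtain a b c where abc: "a \<in> C" "b \<in> C" "c \<in> C" "\<phi> a b c \<noteq> 0" using \<phi> by blast
  obtain a' b' c' where abc': "a' \<in> C" "b' \<in> C" "c' \<in> C" "\<psi> a' b' c' \<noteq> 0" using \<psi> by blast
  let ?D = "cline a a' -` C \<inter> cline b b' -` C \<inter> cline c c' -` C"
  define f where "f t = \<phi> (cline a a' t) (cline b b' t) (cline c c' t)" for t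
  define g where "g t = \<psi> (cline a a' t) (cline b b' t) (cline c c' t)" for t
  have hol: "f holomorphic_on ?D" "g holomorphic_on ?D"
    using assms(1,2) unfolding lhol_def f_def g_def by blast+
  have D: "open ?D" "connected ?D" "0 \<in> ?D" "1 \<in> ?D"
    using abc abc' by (auto intro!: open_Int open_cline_vimage open_C convex_connected convex_Int
        convex_cline_vimage convex_C)
  show ?thesis
  proof (rule ccontr)
    assume "\<not> ?thesis"
    then have fg: "f t * g t = 0" if "t \<in> ?D" for t using that by (auto simp: f_def g_def)
    have "isCont f 0"
      using hol(1) D by (meson continuous_on_eq_continuous_at holomorphic_on_imp_continuous_on)
    moreover have "isCont complex_of_real 0" by simp
    ultimately have "isCont (\<lambda>t. f (complex_of_real t)) 0"
      using isCont_o2[of 0 complex_of_real f] by simp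
    moreover have "f (complex_of_real 0) \<noteq> 0" using abc(4) by (simp add: f_def)
    ultimately have "\<forall>\<^sub>F t in at (0::real). f (complex_of_real t) \<noteq> 0"
      unfolding isCont_def by (rule tendsto_imp_eventually_ne)
    moreover have "\<forall>\<^sub>F t in at (0::real). complex_of_real t \<in> ?D"
      by (rule topological_tendstoD[OF \<open>isCont complex_of_real 0\<close>[unfolded isCont_def] D(1)])
        (use D(3) in simp)
    ultimately have "\<forall>\<^sub>F t in at (0::real). g (complex_of_real t) = 0"
      by eventually_elim (use fg in auto)
    then have "\<forall>\<^sub>F t in at_right 0. g (complex_of_real t) = 0"
      by (simp add: eventually_at_split)
    then have "g 1 = 0"
      by (rule eventually_at_0_imp_zero[OF hol(2) D])
    then show False using abc'(4) by (simp add: g_def)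
  qed
qed

theorem collineation_linear:
  shows "\<exists>D :: complex ^ 'a ^ 'b. (\<exists>z\<in>C. (D *v z) $ l \<noteq> 0) \<and> (\<forall>z\<in>C. (D *v z) $ l *s G z = D *v z)"
proof -
  obtain i i' where \<Delta>: "\<exists>a\<in>C. \<exists>b\<in>C. \<exists>c\<in>C. \<Delta> i i' a b c \<noteq> 0" using exists_\<Delta>_nonzero by blast
  obtain p q j where pq: "p \<in> C" "q \<in> C" "G p $ j \<noteq> G q $ j" using nonconstant by blast
  \<comment> \<open>Its nonvanishing collects the nondegeneracy conditions of
    \<open>scl_add\<close>.\<close>
  define \<phi> where "\<phi> a b c = \<Delta> i i' a b c * (G b $ j - G (a + b) $ j) * (G c $ j - G (a + c) $ j) *
    (G (b + c) $ j - G (a + (b + c)) $ j)" for a b c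
  have half: "(1/2) *\<^sub>R z \<in> C" "(1/2) *\<^sub>R z + (1/2) *\<^sub>R z = z" if "z \<in> C" for z
    using that by (auto intro: cone_C simp flip: scaleR_add_left)
  have ne: "\<exists>a\<in>C. \<exists>b\<in>C. G b $ j - G (a + b) $ j \<noteq> 0"
  proof (rule ccontr)
    assume "\<not> ?thesis"
    then have "G b $ j = G (a + b) $ j" if "a \<in> C" "b \<in> C" for a b using that by auto
    from this[of p q] this[of q p] pq show False by (simp add: add.commute)
  qed
  have n5: "\<exists>a\<in>C. \<exists>b\<in>C. \<exists>c\<in>C. G (a + b) $ j - G a $ j \<noteq> 0"
  proof -
    obtain a b where "a \<in> C" "b \<in> C" "G b $ j - G (a + b) $ j \<noteq> 0" using ne by blast
    then show ?thesis
      by (intro bexI[of _ b] bexI[of _ a]) (auto simp: add.commute)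
  qed
  have n2: "\<exists>a\<in>C. \<exists>b\<in>C. \<exists>c\<in>C. G b $ j - G (a + b) $ j \<noteq> 0" using ne by blast
  have n3: "\<exists>a\<in>C. \<exists>b\<in>C. \<exists>c\<in>C. G c $ j - G (a + c) $ j \<noteq> 0" using ne by blast
  have n4: "\<exists>a\<in>C. \<exists>b\<in>C. \<exists>c\<in>C. G (b + c) $ j - G (a + (b + c)) $ j \<noteq> 0"
  proof -
    obtain a b where ab: "a \<in> C" "b \<in> C" "G b $ j - G (a + b) $ j \<noteq> 0" using ne by blast
    \<comment> \<open>The point \<open>b\<close> is written as a sum of two halves, which lie in the
      cone.\<close>
    show ?thesis
    proof (intro bexI)
      show "G ((1/2) *\<^sub>R b + (1/2) *\<^sub>R b) $ j - G (a + ((1/2) *\<^sub>R b + (1/2) *\<^sub>R b)) $ j \<noteq> 0"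
        unfolding half(2)[OF ab(2)] by (rule ab(3))
    qed (use ab half(1) in auto)
  qed
  have l\<Delta>: "lhol (\<Delta> i i')" unfolding \<Delta>_def by (intro lhol_diff lhol_mult lhol_G)
  \<comment> \<open>The additional factor makes \<open>scl a j b\<close> nonzero, which is what
    finally shows that the linear map is not trivial.\<close>
  have "\<exists>a\<in>C. \<exists>b\<in>C. \<exists>c\<in>C. \<phi> a b c * (G (a + b) $ j - G a $ j) \<noteq> 0"
    unfolding \<phi>_def
    by (intro lhol_product_nonzero n2 n3 n4 n5 \<Delta> l\<Delta> lhol_mult lhol_diff lhol_G)
  then obtain a b c where C: "a \<in> C" "b \<in> C" "c \<in> C" and \<phi>0: "\<phi> a b c \<noteq> 0"
    and ab: "G (a + b) $ j \<noteq> G a $ j" by auto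
  define L where "L z = scl a j z *s G z" for z
  have contG: "continuous_on C (\<lambda>z. G z $ k)" for k
    using holo_G by (rule holo_on_continuous_on)
  let ?S = "{x \<in> C \<times> C. \<phi> a (fst x) (snd x) \<noteq> 0}"
  have "continuous_on (C \<times> C) (\<lambda>x. \<phi> a (fst x) (snd x))"
  proof -
    have cc: "continuous_on (C \<times> C) (\<lambda>x. G (f x) $ k)"
      if "continuous_on (C \<times> C) f" "f ` (C \<times> C) \<subseteq> C" for f k
      by (rule continuous_on_compose2[OF contG that])
    have c: "continuous_on (C \<times> C) (\<lambda>x. G (fst x) $ k)" "continuous_on (C \<times> C) (\<lambda>x. G (snd x) $ k)"
      "continuous_on (C \<times> C) (\<lambda>x. G (a + fst x) $ k)" "continuous_on (C \<times> C) (\<lambda>x. G (a + snd x) $ k)"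
      "continuous_on (C \<times> C) (\<lambda>x. G (fst x + snd x) $ k)"
      "continuous_on (C \<times> C) (\<lambda>x. G (a + (fst x + snd x)) $ k)" for k
      by (rule cc; use add_C C(1) in \<open>force intro!: continuous_intros\<close>)+
    show ?thesis
      unfolding \<phi>_def \<Delta>_def
      by (intro continuous_on_mult continuous_on_diff continuous_on_const c)
  qed
  then have "open (C \<times> C \<inter> (\<lambda>x. \<phi> a (fst x) (snd x)) -` (- {0}))"
    by (rule continuous_open_preimage) (auto intro: open_Times open_C)
  moreover have "C \<times> C \<inter> (\<lambda>x. \<phi> a (fst x) (snd x)) -` (- {0}) = ?S" by auto
  ultimately have "open ?S" by simp
  moreover have "(b, c) \<in> ?S" using C \<phi>0 by simp
  ultimately obtain A B where AB: "open A" "open B" "(b, c) \<in> A \<times> B" "A \<times> B \<subseteq> ?S"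
    by (rule open_prod_elim)
  obtain e1 where e1: "e1 > 0" "ball b e1 \<subseteq> A" using AB by (meson mem_Sigma_iff open_contains_ball)
  obtain e2 where e2: "e2 > 0" "ball c e2 \<subseteq> B" using AB by (meson mem_Sigma_iff open_contains_ball)
  define e where "e = min e1 e2"
  have e: "e > 0" using e1 e2 by (simp add: e_def)
  have inb: "b + v \<in> A" and inc: "c + v \<in> B" if "norm v < e" for v
    using that e1(2) e2(2) by (auto simp: e_def subset_iff dist_norm)
  \<comment> \<open>Additivity is available only for one summand near \<open>b\<close> and the other
    near \<open>c\<close>, not for two points of the same neighbourhood.\<close>
  have L_add: "L (z + w) = L z + L w" if "z \<in> A" "w \<in> B" for z w
  proof -
    have "z \<in> C" "w \<in> C" "\<phi> a z w \<noteq> 0" using that AB(4) by auto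
    then show ?thesis unfolding L_def \<phi>_def
      by (intro scl_add[OF C(1)]) (auto simp: add.assoc)
  qed
  have AC: "A \<subseteq> C" and A_ne: "z \<in> A \<Longrightarrow> G z $ j - G (a + z) $ j \<noteq> 0" for z
    using AB(3,4) by (auto simp: \<phi>_def)
  have holoL: "holo_on (\<lambda>z. L z $ k) A" for k
  proof -
    have "holo_on (\<lambda>z. G (a + z) $ j) A"
      using holo_G
    proof (rule holo_on_compose)
      show "holo_on (\<lambda>z. (a + z) $ k) A" for k
        by (simp add: holo_on_add holo_on_const holo_on_nth)
      show "(+) a ` A \<subseteq> C" using AC add_C[OF C(1)] by auto
    qed
    moreover have "holo_on (\<lambda>z. G z $ k) A" for k
      using holo_G AC by (rule holo_on_subset)
    ultimately have "holo_on (\<lambda>z. (G (a + z) $ j + (- 1) * G a $ j) /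
        (G z $ j + (- 1) * G (a + z) $ j) * G z $ k) A"
      using A_ne by (intro holo_on_mult holo_on_divide holo_on_add holo_on_const) auto
    then show ?thesis by (simp add: L_def scl_def)
  qed
  \<comment> \<open>Passing to increments at \<open>b\<close> cures this: an increment can be moved
    from \<open>b\<close> to \<open>c\<close> and back, so \<open>\<Lambda>\<close> is additive near
    0.\<close>
  define \<Lambda> where "\<Lambda> v = L (b + v) - L b" for v
  have \<Lambda>_add: "\<Lambda> (v + w) = \<Lambda> v + \<Lambda> w" if "norm v < e" "norm w < e" "norm (v + w) < e" for v w
  proof -
    have "L (b + (v + w)) = L (b + v) + L (c + w) - L c"
      using L_add[OF inb[OF that(3)], of c] L_add[OF inb[OF that(1)] inc[OF that(2)]] AB(3)
      by (simp add: algebra_simps)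
    moreover have "L (c + w) = L (b + w) + L c - L b"
      using L_add[OF inb[OF that(2)], of c] L_add[OF _ inc[OF that(2)], of b] AB(3)
      by (simp add: algebra_simps)
    ultimately show ?thesis by (simp add: \<Lambda>_def)
  qed
  have holo\<Lambda>: "holo_on (\<lambda>v. \<Lambda> v $ k) (ball 0 e)" for k
  proof -
    have "holo_on (\<lambda>v. L (b + v) $ k) (ball 0 e)"
      using holoL
    proof (rule holo_on_compose)
      show "holo_on (\<lambda>z. (b + z) $ k) (ball 0 e)" for k
        by (simp add: holo_on_add holo_on_const holo_on_nth)
      show "(+) b ` ball 0 e \<subseteq> A" by (intro image_subsetI inb) simp
    qed
    then have "holo_on (\<lambda>v. L (b + v) $ k + - (L b $ k)) (ball 0 e)"
      by (intro holo_on_add holo_on_const)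
    then show ?thesis by (simp add: \<Lambda>_def)
  qed
  have "\<exists>D. Vector_Spaces.linear (*s) (*) D \<and> (\<forall>v. norm v < e \<longrightarrow> \<Lambda> v $ k = D v)" for k
  proof -
    have add: "\<Lambda> (v + w) $ k = \<Lambda> v $ k + \<Lambda> w $ k"
      if "norm v < e" "norm w < e" "norm (v + w) < e" for v w
      using \<Lambda>_add[OF that] by simp
    show ?thesis by (rule additive_holo_on_linear[OF holo\<Lambda> e add])
  qed
  note ex = this
  define D where "D k = (SOME D. Vector_Spaces.linear (*s) (*) D \<and>
    (\<forall>v. norm v < e \<longrightarrow> \<Lambda> v $ k = D v))" for k
  have "Vector_Spaces.linear (*s) (*) (D k) \<and> (\<forall>v. norm v < e \<longrightarrow> \<Lambda> v $ k = D k v)" for k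
    unfolding D_def by (rule someI_ex[OF ex])
  then have D: "\<And>k. Vector_Spaces.linear (*s) (*) (D k)"
    "\<And>k v. norm v < e \<Longrightarrow> \<Lambda> v $ k = D k v" by simp_all
  define M where "M = matrix (\<lambda>v. \<chi> k. D k v)"
  have "Vector_Spaces.linear (*s) (*s) (\<lambda>v. \<chi> k. D k v)"
    by (simp add: Vector_Spaces.linear_iff vec.vector_space_axioms vec_eq_iff
        linear_fun_add[OF D(1)] linear_fun_scale[OF D(1)])
  then have M: "M *v v = (\<chi> k. D k v)" for v unfolding M_def by (rule matrix_works)
  \<comment> \<open>At this stage \<open>L\<close> is only affine near \<open>b\<close>, with
    \<open>\<kappa>\<close> as its constant term.\<close>
  define \<kappa> where "\<kappa> = L b - M *v b"
  have L: "L z = M *v z + \<kappa>" if "z \<in> ball b e" for z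
  proof -
    have "norm (z - b) < e" using that by (simp add: dist_norm norm_minus_commute)
    then have "\<Lambda> (z - b) = M *v (z - b)" by (simp add: vec_eq_iff D(2) M)
    then show ?thesis by (simp add: \<Lambda>_def \<kappa>_def matrix_vector_mult_diff_distrib algebra_simps)
  qed
  have "ball b e \<subseteq> ball b e1" by (auto simp: e_def)
  with e1(2) AC have ballC: "ball b e \<subseteq> C" by blast
  \<comment> \<open>Replacing \<open>z\<close> by \<open>t *\<^sub>R z\<close> leaves
    \<open>G\<close> unchanged and multiplies the linear part by \<open>t\<close>, but not
    \<open>\<kappa>\<close>. Subtracting the two relations removes \<open>\<kappa>\<close>.\<close>
  have near: "(M *v z) $ l *s G z = M *v z" if z: "z \<in> ball b e" for z
  proof -
    have zC: "z \<in> C" using z ballC by blast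
    have elim: "(t - 1) * (m * g - x) = 0" if "x + k = (m + k') * g" "t * x + k = (t * m + k') * g"
      for t m g x k k' :: complex
    proof -
      have "(t - 1) * (m * g - x) = (t * m + k') * g - (m + k') * g - (t * x + k) + (x + k)"
        by (simp add: algebra_simps)
      then show ?thesis using that by simp
    qed
    have "isCont (\<lambda>t. t *\<^sub>R z) 1" by simp
    then have "\<forall>\<^sub>F t in at 1. t *\<^sub>R z \<in> ball b e"
      unfolding isCont_def using z by (intro topological_tendstoD) auto
    moreover have "\<forall>\<^sub>F t in at (1::real). t > 0"
      by (rule order_tendstoD) (auto intro: tendsto_intros)
    moreover have "\<forall>\<^sub>F t in at (1::real). t \<noteq> 1" by (rule eventually_neq_at_within)
    ultimately have "\<forall>\<^sub>F t in at (1::real). t *\<^sub>R z \<in> ball b e \<and> t > 0 \<and> t \<noteq> 1"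
      by eventually_elim simp
    then obtain t where t: "t *\<^sub>R z \<in> ball b e" "t > 0" "t \<noteq> 1"
      by (metis (mono_tags, lifting) eventually_happens trivial_limit_at)
    have Ll: "L w = L w $ l *s G w" if "w \<in> C" for w
      using G_l[OF that] by (simp add: L_def)
    have E1: "M *v z + \<kappa> = ((M *v z) $ l + \<kappa> $ l) *s G z"
      using Ll[OF zC] L[OF z] by simp
    have E2: "t *s (M *v z) + \<kappa> = (t * (M *v z) $ l + \<kappa> $ l) *s G z"
    proof -
      have "M *v (t *\<^sub>R z) = t *s (M *v z)"
        by (simp add: scaleR_vec_eq vec.linear_scale[OF matrix_vector_mul_linear_gen])
      then show ?thesis
        using Ll[of "t *\<^sub>R z"] L[OF t(1)] G_scale[OF t(2) zC] cone_C[OF t(2) zC] by simp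
    qed
    have "(of_real t - 1) * ((M *v z) $ l * G z $ k - (M *v z) $ k) = 0" for k
    proof -
      have "(M *v z) $ k + \<kappa> $ k = ((M *v z) $ l + \<kappa> $ l) * G z $ k"
        using arg_cong[OF E1, of "\<lambda>v. v $ k"] by (simp only: vector_add_component vector_smult_component)
      moreover have "t * (M *v z) $ k + \<kappa> $ k = (t * (M *v z) $ l + \<kappa> $ l) * G z $ k"
        using arg_cong[OF E2, of "\<lambda>v. v $ k"] by (simp only: vector_add_component vector_smult_component)
      ultimately show ?thesis by (rule elim)
    qed
    moreover have "complex_of_real t - 1 \<noteq> 0" using t(3) by simp
    ultimately have "(M *v z) $ l * G z $ k = (M *v z) $ k" for k
      by (metis eq_iff_diff_eq_0 mult_eq_0_iff)
    then show ?thesis by (simp add: vec_eq_iff)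
  qed
  \<comment> \<open>Otherwise \<open>L\<close> would be the constant \<open>\<kappa>\<close> near
    \<open>b\<close>; the coordinate \<open>j\<close> of \<open>G\<close> would be constant there
    and, by the identity theorem, on all of \<open>C\<close>.\<close>
  have "\<exists>z\<in>C. (M *v z) $ l \<noteq> 0"
  proof (rule ccontr)
    assume "\<not> ?thesis"
    then have *: "(M *v z) $ l = 0" if "z \<in> C" for z using that by blast
    have Mz: "M *v z = 0" if "z \<in> ball b e" for z
    proof -
      have "z \<in> C" using that ballC by blast
      then show ?thesis using near[OF that] *[of z] by simp
    qed
    have "L b $ l \<noteq> 0"
    proof -
      have "scl a j b \<noteq> 0"
        using ab A_ne[of b] AB(3) by (simp add: scl_def)
      then show ?thesis using G_l[OF C(2)] by (simp add: L_def)
    qed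
    moreover have "L b = \<kappa>" using Mz[of b] e by (simp add: \<kappa>_def)
    ultimately have \<kappa>: "\<kappa> $ l \<noteq> 0" by simp
    have G\<kappa>: "G z $ j = \<kappa> $ j / \<kappa> $ l" if "z \<in> ball b e" for z
    proof -
      have zC: "z \<in> C" using that ballC by blast
      have "\<kappa> = scl a j z *s G z" using L[OF that] Mz[OF that] by (simp add: L_def)
      then have *: "\<kappa> $ k = scl a j z * G z $ k" for k by simp
      show ?thesis using *[of l] *[of j] G_l[OF zC] \<kappa> by simp
    qed
    have "ball b e \<inter> C \<noteq> {}" using e C(2) by (metis IntI centre_in_ball empty_iff)
    moreover have "holo_on (\<lambda>z. G z $ j + - (\<kappa> $ j / \<kappa> $ l)) C"
      by (intro holo_on_add holo_G holo_on_const)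
    moreover have "G z $ j + - (\<kappa> $ j / \<kappa> $ l) = 0" if "z \<in> ball b e \<inter> C" for z
      using G\<kappa>[of z] that by simp
    ultimately have "G z $ j + - (\<kappa> $ j / \<kappa> $ l) = 0" if "z \<in> C" for z
      using holo_on_identity[where g = "\<lambda>z. G z $ j + - (\<kappa> $ j / \<kappa> $ l)", OF _ open_C convex_C open_ball _ _ that]
      by blast
    from this[OF pq(1)] this[OF pq(2)] pq(3) show False by simp
  qed
  moreover have "(M *v z) $ l *s G z = M *v z" if z: "z \<in> C" for z
  proof -
    have "ball b e \<inter> C \<noteq> {}" using e C(2) by (metis IntI centre_in_ball empty_iff)
    moreover have "holo_on (\<lambda>z. (M *v z) $ l * G z $ k + (- 1) * (M *v z) $ k) C" for k
      by (intro holo_on_add holo_on_mult holo_on_const holo_G holo_on_nth_matrix)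
    moreover have "(M *v z) $ l * G z $ k + (- 1) * (M *v z) $ k = 0" if "z \<in> ball b e \<inter> C" for z k
    proof -
      have "((M *v z) $ l *s G z) $ k = (M *v z) $ k" using near[of z] that by simp
      then show ?thesis by simp
    qed
    ultimately have "(M *v z) $ l * G z $ k + (- 1) * (M *v z) $ k = 0" for k
      using holo_on_identity[where g = "\<lambda>z. (M *v z) $ l * G z $ k + (- 1) * (M *v z) $ k",
          OF _ open_C convex_C open_ball _ _ z]
      by blast
    then show ?thesis by (simp add: vec_eq_iff)
  qed
  ultimately show ?thesis by blast
qed

end

section \<open>Determinants and ranks\<close>

text \<open>A rank bound becomes one determinant of full size: the columns in \<open>I\<close> come
  from \<open>C\<close> and the others complete them to a basis. This makes rank accessible to the
  identity theorem.\<close>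

lemma dim_ge_imp_det:
  fixes C :: "(complex ^ 'b::finite) set"
  assumes "n \<le> vec.dim C"
  shows "\<exists>I g. card I = n \<and> (\<forall>j\<in>I. g j \<in> C) \<and> det ((\<chi> i j. g j $ i) :: complex ^ 'b ^ 'b) \<noteq> 0"
proof -
  obtain B0 where B0: "B0 \<subseteq> C" "vec.independent B0" "card B0 = vec.dim C"
    by (rule vec.basis_exists[of C])
  obtain B1 where B1: "B1 \<subseteq> B0" "card B1 = n" "finite B1"
    using obtain_subset_with_card_n[of n B0] assms B0(3) by auto
  have "vec.independent B1" using B0(2) B1(1) vec.independent_mono by blast
  then obtain B2 where B2: "B1 \<subseteq> B2" "vec.independent B2" "UNIV \<subseteq> vec.span B2"
    using vec.maximal_independent_subset_extend[of B1 UNIV] by auto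
  have fin: "finite B2" using B2(2) by (rule vec.finiteI_independent)
  have "card B2 = CARD('b)"
    using vec.basis_card_eq_dim[of B2 UNIV] B2 by (simp add: vec_dim_card del: vec.dim_UNIV)
  then obtain g where g: "bij_betw g (UNIV :: 'b set) B2"
    using finite_same_card_bij[of "UNIV :: 'b set" B2] fin by auto
  define A where "A = ((\<chi> i j. g j $ i) :: complex ^ 'b ^ 'b)"
  have col: "column j A = g j" for j by (simp add: A_def column_def vec_eq_iff)
  have "\<forall>i. c i = 0" if c: "(\<Sum>i\<in>UNIV. c i *s column i A) = 0" for c
  proof
    fix i
    define c' where "c' b = c (inv_into UNIV g b)" for b
    have inv: "inv_into UNIV g (g i) = i" for i
      using g by (simp add: bij_betw_def)
    have "(\<Sum>b\<in>B2. c' b *s b) = (\<Sum>i\<in>UNIV. c' (g i) *s g i)"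
      by (rule sum.reindex_bij_betw[OF g, symmetric])
    then have "(\<Sum>b\<in>B2. c' b *s b) = 0" using c by (simp add: c'_def inv col)
    then have "c' (g i) = 0"
      using vec.independentD[OF B2(2) fin subset_refl, of c' "g i"] g by (auto simp: bij_betw_def)
    then show "c i = 0" by (simp add: c'_def inv)
  qed
  then have "\<exists>B. B ** A = mat 1"
    unfolding matrix_left_invertible_independent_columns by blast
  then have "det A \<noteq> 0" by (simp add: invertible_left_inverse flip: invertible_det_nz)
  moreover have "card (g -` B1) = n"
  proof -
    have "bij_betw g (g -` B1) B1"
      using g B2(1) by (auto simp: bij_betw_def inj_on_def)
    then show ?thesis using B1(2) by (simp add: bij_betw_same_card)
  qed
  ultimately show ?thesis using B0(1) B1(1) by (intro exI[of _ "g -` B1"] exI[of _ g]) (auto simp: A_def)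
qed

lemma det_imp_dim_ge:
  fixes C :: "(complex ^ 'b::finite) set"
  assumes "det ((\<chi> i j. g j $ i) :: complex ^ 'b ^ 'b) \<noteq> 0" and "\<And>j. j \<in> I \<Longrightarrow> g j \<in> C"
  shows "card I \<le> vec.dim C"
proof -
  define A where "A = ((\<chi> i j. g j $ i) :: complex ^ 'b ^ 'b)"
  have "column j A = g j" for j by (simp add: A_def column_def vec_eq_iff)
  then have cols: "columns A = range g" by (auto simp: columns_def)
  have "invertible A" using assms(1) by (simp add: invertible_det_nz A_def)
  then have span: "vec.span (range g) = UNIV"
    using matrix_right_invertible_span_columns[of A] cols by (auto simp: invertible_right_inverse)
  have "CARD('b) \<le> card (range g)"
    using vec.dim_le_card[of UNIV "range g"] span by (simp add: vec_dim_card del: vec.dim_UNIV)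
  then have card: "card (range g) = CARD('b)" using card_image_le[of UNIV g] by simp
  then have inj: "inj g" by (simp add: eq_card_imp_inj_on)
  have "vec.independent (range g)"
    by (rule vec.card_le_dim_spanning[of _ UNIV])
      (use span card in \<open>simp_all add: vec_dim_card del: vec.dim_UNIV\<close>)
  then have "vec.independent (g ` I)" by (rule vec.independent_mono) auto
  then have "card (g ` I) \<le> vec.dim C"
    using assms(2) by (intro vec.independent_card_le_dim) auto
  moreover have "card (g ` I) = card I" using inj by (simp add: card_image inj_on_subset)
  ultimately show ?thesis by simp
qed

lemma holomorphic_on_det:
  fixes A :: "complex \<Rightarrow> complex ^ 'n::finite ^ 'n"
  assumes "\<And>i j. (\<lambda>t. A t $ i $ j) holomorphic_on S"
  shows "(\<lambda>t. det (A t)) holomorphic_on S"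
  unfolding det_def
  by (intro holomorphic_on_sum holomorphic_on_mult holomorphic_on_const holomorphic_on_prod assms)

lemma tendsto_det:
  fixes A :: "'x \<Rightarrow> complex ^ 'n::finite ^ 'n"
  assumes "\<And>i j. ((\<lambda>t. A t $ i $ j) \<longlongrightarrow> A0 $ i $ j) F"
  shows "((\<lambda>t. det (A t)) \<longlongrightarrow> det A0) F"
  unfolding det_def
  by (intro tendsto_sum tendsto_mult tendsto_const tendsto_prod assms)

text \<open>Cramer's rule, so that holomorphy and continuity in the matrix can be read off.\<close>

definition sol :: "complex ^ 'n::finite ^ 'n \<Rightarrow> complex ^ 'n \<Rightarrow> complex ^ 'n" where
  "sol A b = (\<chi> k. det (\<chi> i j. if j = k then b $ i else A $ i $ j) / det A)"

lemma sol_iff: "det A \<noteq> 0 \<Longrightarrow> A *v x = b \<longleftrightarrow> x = sol A b"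
  unfolding sol_def by (rule cramer)

lemma sol_solves: "det A \<noteq> 0 \<Longrightarrow> A *v sol A b = b"
  by (simp add: sol_iff)

lemma holomorphic_on_sol:
  assumes "\<And>i j. (\<lambda>t. A t $ i $ j) holomorphic_on S" "\<And>i. (\<lambda>t. b t $ i) holomorphic_on S"
    and "\<And>t. t \<in> S \<Longrightarrow> det (A t) \<noteq> 0"
  shows "(\<lambda>t. sol (A t) (b t) $ k) holomorphic_on S"
proof -
  have *: "(\<lambda>t. (if j = k then b t $ i else A t $ i $ j)) holomorphic_on S" for i j
    using assms by (cases "j = k") auto
  show ?thesis
    unfolding sol_def vec_lambda_beta
    by (intro holomorphic_on_divide holomorphic_on_det assms) (simp_all only: vec_lambda_beta *)
qed

lemma tendsto_sol:
  assumes "\<And>i j. ((\<lambda>t. A t $ i $ j) \<longlongrightarrow> A0 $ i $ j) F" "\<And>i. ((\<lambda>t. b t $ i) \<longlongrightarrow> b0 $ i) F"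
    and "det A0 \<noteq> 0"
  shows "((\<lambda>t. sol (A t) (b t) $ k) \<longlongrightarrow> sol A0 b0 $ k) F"
proof -
  have *: "((\<lambda>t. (if j = k then b t $ i else A t $ i $ j)) \<longlongrightarrow> (if j = k then b0 $ i else A0 $ i $ j)) F"
    for i j using assms by (cases "j = k") auto
  show ?thesis
    unfolding sol_def vec_lambda_beta
    by (intro tendsto_divide tendsto_det assms) (simp_all only: vec_lambda_beta *)
qed

section \<open>The Cayley transform near the identity\<close>

definition cayley :: "complex ^ 'n::finite ^ 'n \<Rightarrow> complex ^ 'n \<Rightarrow> complex ^ 'n" where
  "cayley X v = (mat 1 + X) *v sol (mat 1 - X) v"

lemma det_cayley_nonzero_near_0:
  "\<forall>\<^sub>F X in nhds 0. det (mat 1 - X :: complex ^ 'n::finite ^ 'n) \<noteq> 0 \<and> det (mat 1 + X) \<noteq> 0"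
proof -
  have ent: "((\<lambda>X :: complex ^ 'n ^ 'n. X $ i $ j) \<longlongrightarrow> 0 $ i $ j) (nhds 0)" for i j
    by (intro tendsto_vec_nth filterlim_ident)
  have pm: "((\<lambda>X :: complex ^ 'n ^ 'n. (mat 1 - X) $ i $ j) \<longlongrightarrow> (mat 1 - 0) $ i $ j) (nhds 0)"
    "((\<lambda>X :: complex ^ 'n ^ 'n. (mat 1 + X) $ i $ j) \<longlongrightarrow> (mat 1 + 0) $ i $ j) (nhds 0)" for i j
    unfolding vector_minus_component vector_add_component
    by (intro tendsto_diff tendsto_add tendsto_const ent)+
  have "((\<lambda>X :: complex ^ 'n ^ 'n. det (mat 1 - X)) \<longlongrightarrow> det (mat 1 - 0 :: complex ^ 'n ^ 'n)) (nhds 0)"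
    "((\<lambda>X :: complex ^ 'n ^ 'n. det (mat 1 + X)) \<longlongrightarrow> det (mat 1 + 0 :: complex ^ 'n ^ 'n)) (nhds 0)"
    by (intro tendsto_det pm)+
  then have "\<forall>\<^sub>F X in nhds 0. det (mat 1 - X :: complex ^ 'n ^ 'n) \<noteq> 0"
    "\<forall>\<^sub>F X in nhds 0. det (mat 1 + X :: complex ^ 'n ^ 'n) \<noteq> 0"
    by (auto elim!: tendsto_imp_eventually_ne)
  then show ?thesis by (rule eventually_conj)
qed

lemma cayley_near_0:
  fixes v :: "complex ^ 'n::finite"
  assumes "open S" "v \<in> S"
  shows "\<forall>\<^sub>F X in nhds 0. cayley X v \<in> S"
proof -
  have ent: "((\<lambda>X :: complex ^ 'n ^ 'n. X $ i $ j) \<longlongrightarrow> 0 $ i $ j) (nhds 0)" for i j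
    by (intro tendsto_vec_nth filterlim_ident)
  have ent': "((\<lambda>X :: complex ^ 'n ^ 'n. (mat 1 - X) $ i $ j) \<longlongrightarrow> (mat 1 - 0) $ i $ j) (nhds 0)" for i j
    unfolding vector_minus_component
    by (intro tendsto_diff tendsto_const ent)
  have "((\<lambda>X. sol (mat 1 - X) v $ k) \<longlongrightarrow> sol (mat 1 - 0) v $ k) (nhds 0)" for k
    by (intro tendsto_sol ent' tendsto_const) simp
  note sol = this
  have "((\<lambda>X. cayley X v $ k) \<longlongrightarrow> cayley 0 v $ k) (nhds 0)" for k
    unfolding cayley_def matrix_vector_mult_def vec_lambda_beta vector_add_component
    by (intro tendsto_sum tendsto_mult tendsto_add tendsto_const ent sol)
  then have "((\<lambda>X. cayley X v) \<longlongrightarrow> cayley 0 v) (nhds 0)"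
    by (rule vec_tendstoI)
  moreover have "cayley 0 v = v"
    using sol_iff[of "mat 1 :: complex ^ 'n ^ 'n" v v] by (simp add: cayley_def)
  ultimately show ?thesis using assms by (auto intro: topological_tendstoD)
qed

lemma norm_vec_le_sum: "norm x \<le> (\<Sum>i\<in>UNIV. norm (x $ i))"
  unfolding norm_vec_def by (rule L2_set_le_sum) simp

text \<open>A crude bound, uniform on a disc containing \<open>\<i>\<close> and a real interval
  around 0: for small \<open>X\<close> the whole disc of operators stays where the Cayley transform
  is under control.\<close>

lemma norm_skew_line_le:
  fixes X :: "complex ^ 'n::finite ^ 'n"
  assumes \<epsilon>: "\<And>k. \<epsilon> k = 1 \<or> \<epsilon> k = -1 \<or> \<epsilon> k = 0" and \<tau>: "cmod \<tau> \<le> 2"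
  shows "norm (skew_line \<epsilon> X \<tau>) \<le> real (CARD('n)) * (real (CARD('n)) * (3 * norm X))"
proof -
  have ent: "cmod (X $ i $ j) \<le> norm X" for i j
    using Finite_Cartesian_Product.norm_nth_le[of "X $ i" j] Finite_Cartesian_Product.norm_nth_le[of X i]
    by linarith
  have 1: "cmod (skew_line \<epsilon> X \<tau> $ i $ j) \<le> 3 * norm X" for i j
  proof -
    define x where "x = X $ i $ j"
    define y where "y = of_real (\<epsilon> i * \<epsilon> j) * cnj (X $ j $ i)"
    have x: "cmod x \<le> norm X" by (simp add: x_def ent)
    have "\<bar>\<epsilon> i * \<epsilon> j\<bar> \<le> 1" using \<epsilon>[of i] \<epsilon>[of j] by auto
    then have "\<bar>\<epsilon> i * \<epsilon> j\<bar> * cmod (X $ j $ i) \<le> 1 * norm X"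
      by (intro mult_mono ent) auto
    then have y: "cmod y \<le> norm X" by (simp add: y_def norm_mult abs_mult)
    have "cmod ((x - y) / 2) \<le> norm X"
      using norm_triangle_ineq4[of x y] x y by (simp add: norm_divide)
    moreover have "cmod (\<tau> * ((x + y) / (2 * \<i>))) \<le> 2 * norm X"
    proof -
      have "cmod ((x + y) / (2 * \<i>)) \<le> norm X"
        using norm_triangle_ineq[of x y] x y by (simp add: norm_divide norm_mult)
      then have "cmod \<tau> * cmod ((x + y) / (2 * \<i>)) \<le> 2 * norm X"
        using \<tau> by (intro mult_mono) auto
      then show ?thesis by (simp only: norm_mult)
    qed
    ultimately have "cmod ((x - y) / 2 + \<tau> * ((x + y) / (2 * \<i>))) \<le> norm X + 2 * norm X"
      by (intro order_trans[OF norm_triangle_ineq] add_mono)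
    then show ?thesis by (simp add: skew_line_def x_def y_def)
  qed
  have 2: "norm (skew_line \<epsilon> X \<tau> $ i) \<le> real (CARD('n)) * (3 * norm X)" for i
    using norm_vec_le_sum[of "skew_line \<epsilon> X \<tau> $ i"]
      sum_bounded_above[of UNIV "\<lambda>j. cmod (skew_line \<epsilon> X \<tau> $ i $ j)", OF 1] by simp
  show ?thesis
    using norm_vec_le_sum[of "skew_line \<epsilon> X \<tau>"]
      sum_bounded_above[of UNIV "\<lambda>i. norm (skew_line \<epsilon> X \<tau> $ i)", OF 2] by simp
qed

lemma cayley_eqI:
  assumes "det (mat 1 - X) \<noteq> 0" "u - X *v u = v"
  shows "cayley X v = u + X *v u"
proof -
  have "sol (mat 1 - X) v = u"
    using assms sol_iff[of "mat 1 - X" u v] by (simp add: matrix_vector_mult_diff_rdistrib)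
  then show ?thesis by (simp add: cayley_def matrix_vector_mult_add_rdistrib)
qed

lemma cayley_matrixE:
  assumes "det (mat 1 - X) \<noteq> 0" "det (mat 1 + X) \<noteq> 0"
  obtains T where "invertible T" "\<And>v. T *v v = cayley X v"
proof -
  obtain Q where Q: "(mat 1 - X) ** Q = mat 1" "Q ** (mat 1 - X) = mat 1"
    using assms(1) invertible_inverseE invertible_det_nz by metis
  have "invertible Q" using Q by (auto simp: invertible_def)
  then have "invertible ((mat 1 + X) ** Q)"
    using assms(2) by (simp add: invertible_det_nz det_mul)
  moreover have "((mat 1 + X) ** Q) *v v = cayley X v" for v
  proof -
    have "(mat 1 - X) *v (Q *v v) = v" by (simp add: matrix_vector_mul_assoc Q)
    then have "sol (mat 1 - X) v = Q *v v" using sol_iff[OF assms(1)] by metis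
    then show ?thesis by (simp add: cayley_def matrix_vector_mul_assoc)
  qed
  ultimately show thesis by (rule that)
qed

lemma hform_cayley:
  assumes "hskew \<epsilon> X" "det (mat 1 - X) \<noteq> 0"
  shows "hform \<epsilon> (cayley X v) (cayley X w) = hform \<epsilon> v w"
proof -
  let ?s = "sol (mat 1 - X)"
  have s: "?s v - X *v ?s v = v" for v
    using sol_solves[OF assms(2), of v] by (simp add: matrix_vector_mult_diff_rdistrib)
  have "hform \<epsilon> (?s v + X *v ?s v) (?s w + X *v ?s w) = hform \<epsilon> (?s v - X *v ?s v) (?s w - X *v ?s w)"
    using assms(1) by (rule hskew_cayley)
  then show ?thesis by (simp only: s cayley_eqI[OF assms(2) s])
qed

lemma holomorphic_on_cayley:
  assumes X: "\<And>i j. (\<lambda>t. X t $ i $ j) holomorphic_on S"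
    and "\<And>t. t \<in> S \<Longrightarrow> det (mat 1 - X t) \<noteq> 0"
  shows "(\<lambda>t. cayley (X t) v $ k) holomorphic_on S"
proof -
  have "(\<lambda>t. (mat 1 - X t) $ i $ j) holomorphic_on S" "(\<lambda>t. (mat 1 + X t) $ i $ j) holomorphic_on S" for i j
    unfolding vector_minus_component vector_add_component
    by (intro holomorphic_on_diff holomorphic_on_add holomorphic_on_const X)+
  then show ?thesis
    unfolding cayley_def matrix_vector_mult_def vec_lambda_beta
    by (intro holomorphic_on_sum holomorphic_on_mult holomorphic_on_sol holomorphic_on_const assms)
qed

section \<open>Orthogonal maps send lines to lines\<close>

lemma hform_isotropic_span:
  assumes V: "\<And>x y. x \<in> V \<Longrightarrow> y \<in> V \<Longrightarrow> hform \<epsilon> x y = 0"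
    and "x \<in> vec.span V" "y \<in> vec.span V"
  shows "hform \<epsilon> x y = 0"
proof -
  have 1: "hform \<epsilon> x y = 0" if x: "x \<in> V" for x
    using assms(3)
  proof (induction rule: vec.span_induct_alt)
    case base
    then show ?case by simp
  next
    case (step c a b)
    then show ?case using V[OF x] by (simp add: hform_simps)
  qed
  show ?thesis
    using assms(2)
  proof (induction rule: vec.span_induct_alt)
    case base
    then show ?case by simp
  next
    case (step c a b)
    then show ?case using 1 by (simp add: hform_simps)
  qed
qed

lemma mult_cline: "M *v cline z w t = cline (M *v z) (M *v w) t"
  by (simp add: cline_def matrix_vector_right_distrib matrix_vector_mult_diff_distrib
      vec.linear_scale[OF matrix_vector_mul_linear_gen])

lemma scaleR_mult_vec: "(t *\<^sub>R A) *v x = t *\<^sub>R (A *v x)"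
  for A :: "complex ^ 'a::finite ^ 'b::finite"
  by (simp add: vec_eq_iff matrix_vector_mult_def scaleR_sum_right)

lemma inj_pos: "inj (pos :: 'a::{finite,linorder} \<Rightarrow> nat)"
  using bij_betw_pos by (auto simp: bij_betw_def)

lemma pos_less: "pos (k :: 'a::{finite,linorder}) < CARD('a)"
  using bij_betw_pos by (auto simp: bij_betw_def)

lemma ex_pos: "j < CARD('a) \<Longrightarrow> \<exists>k :: 'a::{finite,linorder}. pos k = j"
proof -
  assume "j < CARD('a)"
  then have "j \<in> range (pos :: 'a \<Rightarrow> nat)" using bij_betw_pos[where 'a = 'a] by (simp add: bij_betw_def)
  then show ?thesis by auto
qed

text \<open>\<open>G\<close> stands for the map in a chart with the radical coordinates of the
  target replaced by 0, and \<open>p\<close> for \<open>r + 1\<close>. \<open>M0\<close> provides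
  one isotropic flag of dimension \<open>p\<close> whose first vector lies in \<open>B\<close>; by
  \<open>rank'\<close> the same number bounds isotropic subspaces of the target modulo the
  radical.\<close>

locale orthogonal_germ =
  fixes \<epsilon> :: "'a::{finite,linorder} \<Rightarrow> real" and \<epsilon>' :: "'b::finite \<Rightarrow> real" and p :: nat
    and B :: "((complex, 'a) vec) set" and G :: "(complex, 'a) vec \<Rightarrow> complex ^ 'b"
    and k0 :: 'a and M0 :: "((complex, 'a) vec, 'a) vec"
  assumes \<epsilon>: "\<And>k. \<epsilon> k = 1 \<or> \<epsilon> k = -1 \<or> \<epsilon> k = 0"
    and open_B: "open B" and convex_B: "convex B"
    and holo_G: "\<And>k. holo_on (\<lambda>z. G z $ k) B"
    and G_null: "\<And>z. z \<in> B \<Longrightarrow> hq \<epsilon> z = 0 \<Longrightarrow> hq \<epsilon>' (G z) = 0"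
    and G_pos: "\<exists>z\<in>B. hq \<epsilon>' (G z) > 0"
    and G_block: "\<And>z k. \<epsilon>' k = 0 \<Longrightarrow> G z $ k = 0"
    and G_nonzero: "\<And>z. z \<in> B \<Longrightarrow> G z \<noteq> 0"
    and rank': "card {k. \<epsilon>' k > 0} \<le> p" and p2: "2 \<le> p" and pn: "p < CARD('a)"
    and k0: "pos k0 = 0" and pos_radical: "\<And>k. \<epsilon> k = 0 \<Longrightarrow> p \<le> pos k"
    and M0_B: "M0 *v axis k0 1 \<in> B" and M0_inv: "invertible M0"
    and M0_iso: "\<And>c c'. (\<And>k. p \<le> pos k \<Longrightarrow> c $ k = 0 \<and> c' $ k = 0) \<Longrightarrow> hform \<epsilon> (M0 *v c) (M0 *v c') = 0"
    and M0_rad: "\<And>k. \<epsilon> k = 0 \<Longrightarrow> M0 *v axis k 1 = axis k 1"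
begin

section \<open>Flags and the spans of their images\<close>

definition K :: "nat \<Rightarrow> ((complex, 'a) vec) set" where
  "K j = {c. \<forall>k. j \<le> pos k \<longrightarrow> c $ k = 0}"

text \<open>A matrix \<open>M\<close> stands for the flag of the subspaces \<open>M (K j)\<close>. Only \<open>M (K 1) \<inter> B \<noteq> {}\<close> is
  required of a frame, so that lower dimensions are allowed.\<close>

definition V :: "nat \<Rightarrow> ((complex, 'a) vec, 'a) vec \<Rightarrow> (complex ^ 'b) set" where
  "V j M = G ` ((*v) M ` K j \<inter> B)"

definition frames :: "(((complex, 'a) vec, 'a) vec) set" where
  "frames = {M. M *v axis k0 1 \<in> B}"

text \<open>The radical axes are fixed so that the operators used to deform such a frame annihilate
  the radical.\<close>

definition iso_frames :: "(((complex, 'a) vec, 'a) vec) set" where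
  "iso_frames = {M \<in> frames. invertible M \<and> (\<forall>c\<in>K p. \<forall>c'\<in>K p. hform \<epsilon> (M *v c) (M *v c') = 0) \<and>
     (\<forall>k. \<epsilon> k = 0 \<longrightarrow> M *v axis k 1 = axis k 1)}"

lemma M0_iso_frames: "M0 \<in> iso_frames"
  using M0_B M0_inv M0_rad unfolding iso_frames_def frames_def K_def
  by (auto intro!: M0_iso)

lemma K_mono: "i \<le> j \<Longrightarrow> K i \<subseteq> K j"
  by (auto simp: K_def)

lemma V_mono: "i \<le> j \<Longrightarrow> V i M \<subseteq> V j M"
  using K_mono unfolding V_def by blast

lemma V_subset: "V j M \<subseteq> G ` B"
  by (auto simp: V_def)

lemma axis_K: "pos k < j \<Longrightarrow> axis k 1 \<in> K j"
  by (auto simp: K_def axis_def)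

lemma cline_K: "c \<in> K j \<Longrightarrow> c' \<in> K j \<Longrightarrow> cline c c' t \<in> K j"
  by (simp add: K_def cline_def)

text \<open>Two preimages are joined by a complex line, which is null because the flag is isotropic;
  convexity of \<open>B\<close> makes its parameters connected, and polarization along the line
  separates the two arguments.\<close>

lemma V_isotropic:
  assumes M: "M \<in> iso_frames" and "x \<in> V p M" "y \<in> V p M"
  shows "hform \<epsilon>' x y = 0"
proof -
  obtain c where c: "c \<in> K p" "M *v c \<in> B" "x = G (M *v c)" using assms(2) by (auto simp: V_def)
  obtain c' where c': "c' \<in> K p" "M *v c' \<in> B" "y = G (M *v c')" using assms(3) by (auto simp: V_def)
  let ?L = "cline (M *v c') (M *v c)"
  let ?D = "?L -` B"
  have D: "open ?D" "connected ?D" "0 \<in> ?D" "1 \<in> ?D"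
    using c(2) c'(2) by (simp_all add: open_cline_vimage[OF open_B]
        convex_connected[OF convex_cline_vimage[OF convex_B]])
  have hol: "(\<lambda>t. G (?L t) $ j) holomorphic_on ?D" for j
    by (rule holo_on_cline[OF holo_G open_B])
  have zero: "(\<Sum>j\<in>UNIV. of_real (\<epsilon>' j) * G (?L t) $ j * cnj (G (?L t) $ j)) = 0" if t: "t \<in> ?D" for t
  proof -
    have "hform \<epsilon> (M *v cline c' c t) (M *v cline c' c t) = 0"
      using M cline_K[OF c'(1) c(1)] by (simp add: iso_frames_def)
    then have "hq \<epsilon> (?L t) = 0" by (simp add: hform_self mult_cline)
    then have "hform \<epsilon>' (G (?L t)) (G (?L t)) = 0" using t G_null by (simp add: hform_self)
    then show ?thesis by (simp add: hform_def)
  qed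
  have "(\<Sum>j\<in>UNIV. of_real (\<epsilon>' j) * G (?L 1) $ j * cnj (G (?L 0) $ j)) = 0"
    by (rule polarization_segment[where a = "\<lambda>j t. G (?L t) $ j", OF hol D zero])
  then show ?thesis by (simp add: c(3) c'(3) hform_def)
qed

lemma dim_V_iso_le:
  assumes "M \<in> iso_frames"
  shows "vec.dim (V p M) \<le> p"
proof -
  have "vec.dim (vec.span (V p M)) \<le> card {k. \<epsilon>' k > 0}"
  proof (rule dim_nonneg_subspace_le)
    show "vec.subspace (vec.span (V p M))" by simp
    show "v $ k = 0" if "v \<in> vec.span (V p M)" "\<epsilon>' k = 0" for v k
      using that(1)
    proof (induction rule: vec.span_induct_alt)
      case base
      then show ?case by simp
    next
      case (step c a b)
      then show ?case using G_block[OF that(2)] by (auto simp: V_def)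
    qed
    show "hq \<epsilon>' v \<ge> 0" if "v \<in> vec.span (V p M)" for v
    proof -
      have "hform \<epsilon>' v v = 0"
        using hform_isotropic_span[OF V_isotropic[OF assms] that that] .
      then show ?thesis by (simp add: hform_self)
    qed
  qed
  then show ?thesis using rank' by simp
qed

text \<open>The determinant test for rank as a function of the points \<open>x j\<close>; the
  columns outside \<open>I\<close> are constants.\<close>

definition \<psi> :: "'b set \<Rightarrow> ('b \<Rightarrow> (complex, 'a) vec) \<Rightarrow> ('b \<Rightarrow> complex ^ 'b) \<Rightarrow> complex" where
  "\<psi> I x g = det (\<chi> i j. (if j \<in> I then G (x j) else g j) $ i)"

lemma holomorphic_on_\<psi>:
  assumes "open T" "\<And>j. (\<lambda>t. x t) ` T \<subseteq> {y. y j \<in> B}" "\<And>j k. (\<lambda>t. x t j $ k) holomorphic_on T"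
  shows "(\<lambda>t. \<psi> I (x t) g) holomorphic_on T"
  unfolding \<psi>_def
proof (rule holomorphic_on_det)
  fix i j
  have "(\<lambda>t. G (x t j) $ i) holomorphic_on T"
    by (rule holo_on_curve[OF holo_G open_B]) (use assms in auto)
  then show "(\<lambda>t. (\<chi> i j. (if j \<in> I then G (x t j) else g j) $ i) $ i $ j) holomorphic_on T"
    by (cases "j \<in> I") simp_all
qed

section \<open>From isotropic frames to all frames\<close>

lemma cayley_iso_frame:
  assumes M: "M \<in> iso_frames" and X: "hskew \<epsilon> X" "\<And>k. \<epsilon> k = 0 \<Longrightarrow> X *v axis k 1 = 0"
    and det: "det (mat 1 - X) \<noteq> 0" "det (mat 1 + X) \<noteq> 0" and B: "cayley X (M *v axis k0 1) \<in> B"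
  shows "\<exists>N\<in>iso_frames. \<forall>v. N *v v = cayley X (M *v v)"
proof -
  obtain T where T: "invertible T" "\<And>v. T *v v = cayley X v"
    using cayley_matrixE[OF det] by blast
  have N: "(T ** M) *v v = cayley X (M *v v)" for v
    using T(2) by (simp add: matrix_vector_mul_assoc[symmetric])
  have "(T ** M) *v axis k 1 = axis k 1" if k: "\<epsilon> k = 0" for k
    using M k X(2)[OF k] cayley_eqI[OF det(1), of "axis k 1" "axis k 1"]
    by (simp add: N iso_frames_def)
  moreover have "invertible (T ** M)"
    using M T(1) by (simp add: iso_frames_def invertible_mult)
  ultimately have "T ** M \<in> iso_frames"
    using M B unfolding iso_frames_def frames_def by (simp add: N hform_cayley[OF X(1) det(1)])
  then show ?thesis using N by blast
qed

text \<open>With \<open>A = M + (t/2) \<Delta>\<close> and \<open>X A = (t/2) \<Delta>\<close>, the Cayley transform of \<open>X\<close> carries \<open>M\<close> to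
  \<open>M + t \<Delta>\<close>. Joining \<open>X\<close> to skew-Hermitian operators by \<open>skew_line\<close>, whose Cayley transforms are
  isometries, reduces the vanishing at \<open>M + t \<Delta>\<close> to the one at isotropic frames.\<close>

lemma \<psi>_zero_near:
  assumes M: "M \<in> iso_frames" and c: "\<And>j. M *v c j \<in> B"
    and van: "\<And>N. N \<in> iso_frames \<Longrightarrow> (\<And>j. N *v c j \<in> B) \<Longrightarrow> \<psi> I (\<lambda>j. N *v c j) g = 0"
    and \<Delta>: "\<And>k. \<epsilon> k = 0 \<Longrightarrow> \<Delta> *v axis k 1 = 0"
  shows "\<forall>\<^sub>F t in at_right 0. \<psi> I (\<lambda>j. (M + t *\<^sub>R \<Delta>) *v c j) g = 0"
proof -
  let ?n = "real CARD('a)"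
  define A where "A t = M + (t / 2) *\<^sub>R \<Delta>" for t :: real
  define Q where "Q t = (\<chi> i j. sol (A t) (axis j 1) $ i)" for t
  define X where "X t = (t / 2) *\<^sub>R (\<Delta> ** Q t)" for t
  have detM: "det M \<noteq> 0" using M by (simp add: iso_frames_def invertible_det_nz)
  have lim: "((\<lambda>t. t) \<longlongrightarrow> 0) (at_right (0::real))" by (simp add: tendsto_ident_at)
  have limA: "((\<lambda>t. A t $ i $ j) \<longlongrightarrow> M $ i $ j) (at_right 0)" for i j
  proof -
    have "((\<lambda>t. M $ i $ j + (t / 2) *\<^sub>R (\<Delta> $ i $ j)) \<longlongrightarrow> M $ i $ j + (0 / 2) *\<^sub>R (\<Delta> $ i $ j)) (at_right 0)"
      by (intro tendsto_intros lim) simp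
    then show ?thesis by (simp add: A_def)
  qed
  have limX: "(X \<longlongrightarrow> 0) (at_right 0)"
  proof -
    have Xij: "X t $ i $ j = (t / 2) *\<^sub>R (\<Sum>k\<in>UNIV. \<Delta> $ i $ k * sol (A t) (axis j 1) $ k)" for t i j
      by (simp add: X_def Q_def matrix_matrix_mult_def)
    have "((\<lambda>t. X t $ i $ j) \<longlongrightarrow> (0 / 2) *\<^sub>R (\<Sum>k\<in>UNIV. \<Delta> $ i $ k * sol M (axis j 1) $ k)) (at_right 0)" for i j
      unfolding Xij by (intro tendsto_scaleR tendsto_divide tendsto_sum tendsto_mult tendsto_const
          tendsto_sol limA lim detM) simp
    then have "((\<lambda>t. X t $ i $ j) \<longlongrightarrow> 0 $ i $ j) (at_right 0)" for i j by simp
    then show ?thesis by (intro vec_tendstoI)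
  qed
  define P where "P Y \<longleftrightarrow> (det (mat 1 - Y) \<noteq> 0 \<and> det (mat 1 + Y) \<noteq> 0) \<and>
    (\<forall>j. cayley Y (M *v c j) \<in> B) \<and> cayley Y (M *v axis k0 1) \<in> B" for Y
  have "M *v axis k0 1 \<in> B" using M by (simp add: iso_frames_def frames_def)
  then have "\<forall>\<^sub>F Y in nhds 0. P Y"
    unfolding P_def by (intro eventually_conj eventually_all_finite det_cayley_nonzero_near_0
        cayley_near_0 open_B c)
  then obtain \<eta> where \<eta>: "\<eta> > 0" "\<And>Y. norm Y < \<eta> \<Longrightarrow> P Y"
    unfolding eventually_nhds_metric by auto
  have "((\<lambda>t. ?n * (?n * (3 * norm (X t)))) \<longlongrightarrow> ?n * (?n * (3 * norm (0 :: ((complex, 'a) vec, 'a) vec)))) (at_right 0)"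
    by (intro tendsto_mult tendsto_const tendsto_norm limX)
  then have "\<forall>\<^sub>F t in at_right 0. ?n * (?n * (3 * norm (X t))) < \<eta>"
    using \<eta>(1) by (intro order_tendstoD(2)) auto
  moreover have "\<forall>\<^sub>F t in at_right 0. det (A t) \<noteq> 0"
    using tendsto_imp_eventually_ne[OF tendsto_det[OF limA] detM] .
  ultimately show ?thesis
  proof eventually_elim
    case (elim t)
    have AQ: "A t ** Q t = mat 1"
    proof -
      have "Q t *v axis j 1 = sol (A t) (axis j 1)" for j
        by (simp add: vec_eq_iff matrix_vector_axis Q_def)
      then have "(A t ** Q t) *v axis j 1 = axis j 1" for j
        using sol_solves[OF elim(2)] by (simp add: matrix_vector_mul_assoc[symmetric])
      then have "(A t ** Q t) $ i $ j = axis j 1 $ i" for i j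
        using matrix_vector_axis[of "A t ** Q t" j i] by simp
      then show ?thesis by (simp add: vec_eq_iff mat_def axis_def)
    qed
    then have QA: "Q t ** A t = mat 1" by (simp add: matrix_left_right_inverse)
    have XA: "X t *v (A t *v v) = (t / 2) *\<^sub>R (\<Delta> *v v)" for v
    proof -
      have "X t *v (A t *v v) = (t / 2) *\<^sub>R ((\<Delta> ** Q t) *v (A t *v v))"
        by (simp only: X_def scaleR_mult_vec)
      also have "\<dots> = (t / 2) *\<^sub>R (\<Delta> *v ((Q t ** A t) *v v))"
        by (simp only: matrix_vector_mul_assoc matrix_mul_assoc)
      finally show ?thesis by (simp add: QA)
    qed
    have X0: "X t *v axis k 1 = 0" if k: "\<epsilon> k = 0" for k
    proof -
      have "A t *v axis k 1 = axis k 1"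
        using M k \<Delta>[OF k] by (simp add: A_def matrix_vector_mult_add_rdistrib scaleR_mult_vec iso_frames_def)
      then show ?thesis using XA[of "axis k 1"] \<Delta>[OF k] by simp
    qed
    define S where "S = skew_line \<epsilon> (X t)"
    have P: "P (S \<tau>)" if "cmod \<tau> < 2" for \<tau>
      using norm_skew_line_le[of \<epsilon> \<tau> "X t"] \<epsilon> that elim(1) \<eta>(2) by (simp add: S_def)
    define \<phi> where "\<phi> \<tau> = \<psi> I (\<lambda>j. cayley (S \<tau>) (M *v c j)) g" for \<tau>
    have "\<phi> holomorphic_on ball 0 2"
      unfolding \<phi>_def
    proof (rule holomorphic_on_\<psi>)
      show "(\<lambda>\<tau> j. cayley (S \<tau>) (M *v c j)) ` ball 0 2 \<subseteq> {y. y j \<in> B}" for j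
        using P by (auto simp: P_def)
      have "(\<lambda>\<tau>. S \<tau> $ i $ j) holomorphic_on ball 0 2" for i j
        unfolding S_def skew_line_def vec_lambda_beta by (intro holomorphic_intros) simp
      then show "(\<lambda>\<tau>. cayley (S \<tau>) (M *v c j) $ k) holomorphic_on ball 0 2" for j k
        using P by (intro holomorphic_on_cayley) (auto simp: P_def)
    qed simp
    moreover have "\<phi> (of_real x) = 0" if "of_real x \<in> ball (0::complex) 2" for x
    proof -
      have "P (S (of_real x))" using P that by simp
      moreover have "hskew \<epsilon> (S (of_real x))" unfolding S_def by (rule hskew_skew_line[OF \<epsilon> X0])
      moreover have "S (of_real x) *v axis k 1 = 0" if "\<epsilon> k = 0" for k
        unfolding S_def using that X0[OF that] by (rule skew_line_column)
      ultimately obtain N where "N \<in> iso_frames" "\<And>v. N *v v = cayley (S (of_real x)) (M *v v)"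
        using cayley_iso_frame[OF M, of "S (of_real x)"] unfolding P_def by blast
      then show ?thesis
        using van[of N] \<open>P (S (of_real x))\<close> by (simp add: \<phi>_def P_def)
    qed
    ultimately have "\<phi> \<i> = 0"
      by (intro zero_on_reals_imp_zero[of \<phi> "ball 0 2" \<i>]) auto
    moreover have "cayley (S \<i>) (M *v v) = (M + t *\<^sub>R \<Delta>) *v v" for v
    proof -
      have S: "S \<i> = X t" by (simp add: S_def skew_line_i)
      have det: "det (mat 1 - X t) \<noteq> 0" using P[of \<i>] by (simp add: S P_def)
      have A: "A t *v v = M *v v + (t / 2) *\<^sub>R (\<Delta> *v v)"
        by (simp add: A_def matrix_vector_mult_add_rdistrib scaleR_mult_vec)
      have "A t *v v - X t *v (A t *v v) = M *v v" unfolding XA by (simp add: A)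
      then have "cayley (X t) (M *v v) = A t *v v + X t *v (A t *v v)"
        by (rule cayley_eqI[OF det])
      also have "\<dots> = M *v v + t *\<^sub>R (\<Delta> *v v)"
        unfolding XA by (simp add: A add.assoc flip: scaleR_add_left)
      finally show ?thesis
        by (simp add: S matrix_vector_mult_add_rdistrib scaleR_mult_vec)
    qed
    ultimately show ?case by (simp add: \<phi>_def)
  qed
qed

text \<open>If \<open>N\<close> had larger rank, some \<open>\<psi>\<close> would be nonzero at
  \<open>N\<close> but, by maximality of \<open>M\<close>, zero at all isotropic frames. On the
  complex line of matrices from \<open>M\<close> to \<open>N\<close> it would then vanish near
  \<open>M\<close>, hence at \<open>N\<close>.\<close>

lemma dim_V_le_iso:
  assumes M: "M \<in> iso_frames" and max: "\<And>N. N \<in> iso_frames \<Longrightarrow> vec.dim (V p N) \<le> vec.dim (V p M)"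
    and N: "N \<in> frames"
  shows "vec.dim (V p N) \<le> vec.dim (V p M)"
proof (rule ccontr)
  assume "\<not> ?thesis"
  then have "Suc (vec.dim (V p M)) \<le> vec.dim (V p N)" by simp
  then obtain I g where I: "card I = Suc (vec.dim (V p M))" "\<forall>j\<in>I. g j \<in> V p N"
    and det: "det ((\<chi> i j. g j $ i) :: complex ^ 'b ^ 'b) \<noteq> 0"
    using dim_ge_imp_det by blast
  let ?e = "axis k0 1 :: (complex, 'a) vec"
  have e: "?e \<in> K p" using k0 p2 by (intro axis_K) simp
  have Ne: "N *v ?e \<in> B" and Me: "M *v ?e \<in> B" using N M by (auto simp: frames_def iso_frames_def)
  have "\<forall>j. \<exists>c. c \<in> K p \<and> N *v c \<in> B \<and> (j \<in> I \<longrightarrow> g j = G (N *v c))"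
  proof
    fix j
    show "\<exists>c. c \<in> K p \<and> N *v c \<in> B \<and> (j \<in> I \<longrightarrow> g j = G (N *v c))"
    proof (cases "j \<in> I")
      case True
      then have "g j \<in> V p N" using I(2) by blast
      then show ?thesis by (auto simp: V_def)
    next
      case False
      then show ?thesis using e Ne by blast
    qed
  qed
  from choice[OF this] obtain c where
    c: "\<And>j. c j \<in> K p" "\<And>j. N *v c j \<in> B" "\<And>j. j \<in> I \<Longrightarrow> g j = G (N *v c j)" by blast
  have det': "\<psi> I (\<lambda>j. N *v c j) g \<noteq> 0"
  proof -
    have "(\<chi> i j. (if j \<in> I then G (N *v c j) else g j) $ i) = ((\<chi> i j. g j $ i) :: complex ^ 'b ^ 'b)"
      using c(3) by (simp add: vec_eq_iff)
    then show ?thesis using det by (simp only: \<psi>_def not_False_eq_True)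
  qed
  have D: "open (\<Inter>j. cline (x j) (y j) -` B)" "connected (\<Inter>j. cline (x j) (y j) -` B)"
    "(\<lambda>t. \<psi> I (\<lambda>j. cline (x j) (y j) t) g) holomorphic_on (\<Inter>j. cline (x j) (y j) -` B)"
    for x y :: "'b \<Rightarrow> (complex, 'a) vec"
  proof -
    show o: "open (\<Inter>j. cline (x j) (y j) -` B)"
      by (intro open_INT) (auto intro: open_cline_vimage open_B)
    show "connected (\<Inter>j. cline (x j) (y j) -` B)"
      by (intro convex_connected convex_INT convex_cline_vimage convex_B)
    show "(\<lambda>t. \<psi> I (\<lambda>j. cline (x j) (y j) t) g) holomorphic_on (\<Inter>j. cline (x j) (y j) -` B)"
      by (rule holomorphic_on_\<psi>[OF o]) (auto intro: holomorphic_on_cline_nth)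
  qed
  \<comment> \<open>Of the points of \<open>M\<close> on \<open>K p\<close>, only that of the axis
    \<open>k0\<close> is known to lie in \<open>B\<close>. Contracting the \<open>c j\<close>
    towards this axis brings their images under both matrices into \<open>B\<close>, and the
    determinant at \<open>N\<close> cannot vanish for all small \<open>s\<close> without vanishing
    at 1.\<close>
  obtain s :: real where s: "\<And>j. M *v cline ?e (c j) (of_real s) \<in> B"
    "\<And>j. N *v cline ?e (c j) (of_real s) \<in> B"
    "\<psi> I (\<lambda>j. N *v cline ?e (c j) (of_real s)) g \<noteq> 0"
  proof -
    note s_intro = that
    let ?x = "\<lambda>j::'b. N *v ?e" and ?y = "\<lambda>j. N *v c j"
    have not_ev: "\<not> (\<forall>\<^sub>F t in at_right 0. \<psi> I (\<lambda>j. cline (?x j) (?y j) (of_real t)) g = 0)"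
    proof
      assume "\<forall>\<^sub>F t in at_right 0. \<psi> I (\<lambda>j. cline (?x j) (?y j) (of_real t)) g = 0"
      then have "\<psi> I (\<lambda>j. cline (?x j) (?y j) 1) g = 0"
        by (intro eventually_at_0_imp_zero[OF D(3)[of ?x ?y] D(1,2)[of ?x ?y]]) (use Ne c(2) in auto)
      then show False using det' by simp
    qed
    have in_B: "\<forall>\<^sub>F t in at_right (0::real). \<forall>j. H *v cline ?e (c j) (of_real t) \<in> B"
      if "H *v ?e \<in> B" for H :: "((complex, 'a) vec, 'a) vec"
    proof (rule eventually_all_finite)
      fix j
      have "open (cline (H *v ?e) (H *v c j) -` B)" by (rule open_cline_vimage[OF open_B])
      moreover have "complex_of_real 0 \<in> cline (H *v ?e) (H *v c j) -` B" using that by simp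
      moreover have "(complex_of_real \<longlongrightarrow> complex_of_real 0) (at_right 0)" by (intro tendsto_intros)
      ultimately have "\<forall>\<^sub>F t in at_right 0. complex_of_real t \<in> cline (H *v ?e) (H *v c j) -` B"
        by (intro topological_tendstoD)
      then show "\<forall>\<^sub>F t in at_right 0. H *v cline ?e (c j) (complex_of_real t) \<in> B"
        by (rule eventually_mono) (simp add: mult_cline)
    qed
    note in_B = eventually_conj[OF in_B[OF Me] in_B[OF Ne]]
    show ?thesis
    proof (rule ccontr)
      assume no: "\<not> thesis"
      have zero: "\<psi> I (\<lambda>j. cline (?x j) (?y j) (of_real t)) g = 0"
        if t: "(\<forall>j. M *v cline ?e (c j) (of_real t) \<in> B) \<and> (\<forall>j. N *v cline ?e (c j) (of_real t) \<in> B)"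
        for t :: real
      proof (rule ccontr)
        assume "\<psi> I (\<lambda>j. cline (?x j) (?y j) (of_real t)) g \<noteq> 0"
        then have "\<psi> I (\<lambda>j. N *v cline ?e (c j) (of_real t)) g \<noteq> 0" by (simp only: mult_cline not_False_eq_True)
        then have thesis using s_intro[of t] t by blast
        then show False using no by blast
      qed
      have "\<forall>\<^sub>F t in at_right 0. \<psi> I (\<lambda>j. cline (?x j) (?y j) (of_real t)) g = 0"
        using in_B by (rule eventually_mono) (rule zero)
      with not_ev show False by contradiction
    qed
  qed
  define c' where "c' j = cline ?e (c j) (of_real s)" for j
  have c': "c' j \<in> K p" for j unfolding c'_def by (rule cline_K[OF e c(1)])
  \<comment> \<open>Zeros in the columns from position \<open>p\<close> on do not affect the action
    on \<open>K p\<close>, and they make \<open>\<Delta>\<close> annihilate the radical.\<close>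
  define \<Delta> where "\<Delta> = (\<chi> i k. if pos k < p then N $ i $ k - M $ i $ k else 0)"
  have \<Delta>0: "\<Delta> *v axis k 1 = 0" if "\<epsilon> k = 0" for k
    using pos_radical[OF that] by (simp add: vec_eq_iff matrix_vector_axis \<Delta>_def)
  have M\<Delta>: "(M + t *\<^sub>R \<Delta>) *v c' j = cline (M *v c' j) (N *v c' j) (of_real t)" for t j
  proof -
    have "\<Delta> *v c' j = N *v c' j - M *v c' j"
    proof -
      have "\<Delta> $ i $ k * c' j $ k = N $ i $ k * c' j $ k - M $ i $ k * c' j $ k" for i k
        using c'[of j] by (cases "pos k < p") (simp_all add: \<Delta>_def K_def algebra_simps)
      then show ?thesis by (simp add: vec_eq_iff matrix_vector_mult_def sum_subtractf)
    qed
    then show ?thesis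
      by (simp add: matrix_vector_mult_add_rdistrib scaleR_mult_vec cline_def scaleR_vec_eq)
  qed
  have "\<forall>\<^sub>F t in at_right 0. \<psi> I (\<lambda>j. (M + t *\<^sub>R \<Delta>) *v c' j) g = 0"
  proof (rule \<psi>_zero_near[OF M])
    show "M *v c' j \<in> B" for j using s(1) by (simp add: c'_def)
    show "\<Delta> *v axis k 1 = 0" if "\<epsilon> k = 0" for k using \<Delta>0[OF that] .
    show "\<psi> I (\<lambda>j. H *v c' j) g = 0" if H: "H \<in> iso_frames" "\<And>j. H *v c' j \<in> B" for H
    proof (rule ccontr)
      assume "\<psi> I (\<lambda>j. H *v c' j) g \<noteq> 0"
      then have "card I \<le> vec.dim (V p H)"
        unfolding \<psi>_def by (rule det_imp_dim_ge) (use H(2) c' in \<open>auto simp: V_def\<close>)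
      then show False using max[OF H(1)] I(1) by simp
    qed
  qed
  then have ev: "\<forall>\<^sub>F t in at_right 0. \<psi> I (\<lambda>j. cline (M *v c' j) (N *v c' j) (of_real t)) g = 0"
    by (simp only: M\<Delta>)
  have "\<psi> I (\<lambda>j. cline (M *v c' j) (N *v c' j) 1) g = 0"
    by (rule eventually_at_0_imp_zero[OF D(3,1,2) _ _ ev]) (use s(1,2) in \<open>auto simp: c'_def\<close>)
  then show False using s(3) by (simp add: c'_def)
qed

section \<open>Growth of rank along flags\<close>

lemma ex_max_iso_frame:
  "\<exists>M\<in>iso_frames. \<forall>N\<in>frames. vec.dim (V p N) \<le> vec.dim (V p M)"
proof -
  have "\<exists>M. M \<in> iso_frames \<and> (\<forall>N. N \<in> iso_frames \<longrightarrow> vec.dim (V p N) \<le> vec.dim (V p M))"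
    by (rule ex_has_greatest_nat[where P = "\<lambda>M. M \<in> iso_frames" and f = "\<lambda>M. vec.dim (V p M)",
          OF M0_iso_frames, of "Suc p"])
      (simp add: dim_V_iso_le less_Suc_eq_le)
  then obtain M where M: "M \<in> iso_frames"
    "\<And>N. N \<in> iso_frames \<Longrightarrow> vec.dim (V p N) \<le> vec.dim (V p M)" by (elim exE conjE) simp
  show ?thesis
  proof (rule bexI[OF ballI M(1)])
    fix N assume "N \<in> frames"
    with M show "vec.dim (V p N) \<le> vec.dim (V p M)" by (rule dim_V_le_iso)
  qed
qed

lemma extend_frame:
  assumes M: "M \<in> frames" and j: "1 \<le> j" "j \<le> p"
  shows "\<exists>N\<in>frames. Suc (vec.dim (V j M)) \<le> vec.dim (V (Suc j) N)"
proof -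
  have "\<exists>v\<in>B. G v \<notin> vec.span (V j M)"
  proof (rule ccontr)
    assume "\<not> ?thesis"
    then have "G ` B \<subseteq> vec.span (V j M)" by blast
    then have "vec.dim (G ` B) \<le> vec.dim (V j M)" by (rule vec.dim_mono)
    also have "\<dots> \<le> vec.dim (V p M)" by (rule vec.dim_subset[OF V_mono[OF j(2)]])
    finally have le: "vec.dim (G ` B) \<le> vec.dim (V p M)" .
    obtain X where X: "X \<in> iso_frames" "\<And>N. N \<in> frames \<Longrightarrow> vec.dim (V p N) \<le> vec.dim (V p X)"
      using ex_max_iso_frame by blast
    \<comment> \<open>The dimensions agree because \<open>X\<close> has maximal rank among all
      frames; so the isotropic span already contains every value of \<open>G\<close>.\<close>
    have "vec.span (V p X) = vec.span (G ` B)"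
      using V_subset le X(2)[OF M] by (intro vec.dim_eq_span) auto
    moreover obtain z where z: "z \<in> B" "hq \<epsilon>' (G z) > 0" using G_pos by blast
    ultimately have "G z \<in> vec.span (V p X)" by (simp add: vec.span_base)
    then have "hform \<epsilon>' (G z) (G z) = 0"
      using hform_isotropic_span[OF V_isotropic[OF X(1)]] by blast
    then show False using z(2) by (simp add: hform_self)
  qed
  then obtain v where v: "v \<in> B" "G v \<notin> vec.span (V j M)" by blast
  obtain k where k: "pos (k::'a) = j" using ex_pos[where 'a = 'a, of j] j(2) pn by auto
  \<comment> \<open>Only the column at position \<open>j\<close> is replaced, so the flag is
    unchanged up to \<open>K j\<close> and gains \<open>v\<close> in the next step.\<close>
  define N where "N = (\<chi> i l. if l = k then v $ i else M $ i $ l)"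
  have NK: "N *v c = M *v c" if "c \<in> K j" for c
  proof -
    have "N $ i $ l * c $ l = M $ i $ l * c $ l" for i l
      using that k by (cases "l = k") (auto simp: N_def K_def)
    then have "(N *v c) $ i = (M *v c) $ i" for i by (simp only: matrix_vector_mult_def vec_lambda_beta)
    then show ?thesis by (simp add: vec_eq_iff)
  qed
  have Nk: "N *v axis k 1 = v" by (simp add: vec_eq_iff matrix_vector_axis N_def)
  have "N \<in> frames"
    using M NK[OF axis_K[of k0]] j(1) k0 by (simp add: frames_def)
  moreover have "insert (G v) (V j M) \<subseteq> V (Suc j) N"
  proof -
    have "G v \<in> V (Suc j) N"
      using v(1) Nk axis_K[of k "Suc j"] k unfolding V_def by (metis IntI image_eqI lessI)
    moreover have "V j M \<subseteq> V (Suc j) N"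
      using NK K_mono[of j "Suc j"] unfolding V_def by (auto intro!: imageI) (metis imageI subsetD)
    ultimately show ?thesis by blast
  qed
  then have "vec.dim (insert (G v) (V j M)) \<le> vec.dim (V (Suc j) N)" by (rule vec.dim_subset)
  then have "Suc (vec.dim (V j M)) \<le> vec.dim (V (Suc j) N)"
    using v(2) by (simp add: vec.dim_insert)
  ultimately show ?thesis by blast
qed

lemma extend_frame_iterated:
  assumes "M \<in> frames" "1 \<le> j" "j + i \<le> Suc p"
  shows "\<exists>N\<in>frames. vec.dim (V j M) + i \<le> vec.dim (V (j + i) N)"
  using assms(3)
proof (induction i)
  case 0
  then show ?case using assms(1) by auto
next
  case (Suc i)
  then obtain N where N: "N \<in> frames" "vec.dim (V j M) + i \<le> vec.dim (V (j + i) N)" by auto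
  obtain N' where "N' \<in> frames" "Suc (vec.dim (V (j + i) N)) \<le> vec.dim (V (Suc (j + i)) N')"
    using extend_frame[OF N(1), of "j + i"] assms(2) Suc.prems by auto
  then show ?case using N(2) by (intro bexI[of _ N']) auto
qed

text \<open>A rank above 2 at the two-dimensional step would exceed the bound \<open>p\<close> after
  \<open>p - 2\<close> extensions, each raising it by at least one. Frames may be singular, so the
  remaining columns of \<open>M\<close> can be 0.\<close>

theorem lines_to_lines:
  assumes "z \<in> B" "w \<in> B" "a *s z + b *s w \<in> B"
  shows "vec.dim {G z, G w, G (a *s z + b *s w)} \<le> 2"
proof -
  obtain k1 where k1: "pos (k1::'a) = 1" using ex_pos[where 'a = 'a, of 1] p2 pn by auto
  have ne: "k0 \<noteq> k1" using k0 k1 by auto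
  define M where "M = (\<chi> i k. if k = k0 then z $ i else if k = k1 then w $ i else 0)"
  have M0: "M *v axis k0 1 = z" and M1: "M *v axis k1 1 = w"
    using ne by (auto simp: vec_eq_iff matrix_vector_axis M_def)
  have M: "M \<in> frames" using assms(1) by (simp add: frames_def M0)
  have K: "axis k0 1 \<in> K 2" "axis k1 1 \<in> K 2" using k0 k1 by (auto intro: axis_K)
  have ab: "M *v (a *s axis k0 1 + b *s axis k1 1) = a *s z + b *s w"
    by (simp add: matrix_vector_right_distrib vec.linear_scale[OF matrix_vector_mul_linear_gen] M0 M1)
  have "a *s axis k0 1 + b *s axis k1 1 \<in> K 2" using K by (simp add: K_def)
  then have sub: "{G z, G w, G (a *s z + b *s w)} \<subseteq> V 2 M"
    unfolding V_def using assms K M0 M1 ab by (auto intro!: imageI) (metis imageI)+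
  have "\<exists>N\<in>frames. vec.dim (V 2 M) + (p - 2) \<le> vec.dim (V (2 + (p - 2)) N)"
    by (rule extend_frame_iterated[OF M]) (use p2 in simp_all)
  moreover have "2 + (p - 2) = p" using p2 by simp
  ultimately obtain N where N: "N \<in> frames" "vec.dim (V 2 M) + (p - 2) \<le> vec.dim (V p N)"
    by auto
  obtain X where X: "X \<in> iso_frames" "vec.dim (V p N) \<le> vec.dim (V p X)"
    using ex_max_iso_frame N(1) by blast
  have "vec.dim (V 2 M) \<le> 2"
    using N(2) X(2) dim_V_iso_le[OF X(1)] p2 by simp
  then show ?thesis using vec.dim_subset[OF sub] by linarith
qed

text \<open>Two extensions starting from one nonzero value. As \<open>extend_frame\<close> reaches
  dimension \<open>Suc p\<close>, this covers \<open>p = 2\<close>.\<close>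

theorem dim_image_ge: "3 \<le> vec.dim (G ` B)"
proof -
  have M0: "M0 \<in> frames" using M0_iso_frames by (simp add: iso_frames_def)
  have "G (M0 *v axis k0 1) \<in> V 1 M0"
    unfolding V_def using M0_B axis_K[of k0 1] k0 by simp
  then have "vec.dim {G (M0 *v axis k0 1)} \<le> vec.dim (V 1 M0)"
    by (intro vec.dim_subset) simp
  then have "1 \<le> vec.dim (V 1 M0)" using G_nonzero[OF M0_B] by simp
  moreover obtain N where "vec.dim (V 1 M0) + 2 \<le> vec.dim (V (1 + 2) N)"
    using extend_frame_iterated[OF M0, of 1 2] p2 by auto
  moreover have "vec.dim (V (1 + 2) N) \<le> vec.dim (G ` B)"
    by (rule vec.dim_subset[OF V_subset])
  ultimately show ?thesis by linarith
qed

end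

section \<open>Projective space\<close>

definition idx :: "nat \<Rightarrow> 'a::{finite,linorder}" where
  "idx = inv pos"

lemma idx_pos [simp]: "idx (pos k) = k"
  unfolding idx_def by (rule inv_f_f[OF inj_pos])

lemma pos_idx: "j < CARD('a) \<Longrightarrow> pos (idx j :: 'a::{finite,linorder}) = j"
  using ex_pos[where 'a = 'a, of j] by (metis idx_pos)

lemma pos_eq_iff: "pos k = pos l \<longleftrightarrow> k = l"
  using inj_pos by (auto dest: injD)

lemma card_pos: "A \<subseteq> {..<CARD('a)} \<Longrightarrow> card {k :: 'a::{finite,linorder}. pos k \<in> A} = card A"
proof -
  assume A: "A \<subseteq> {..<CARD('a)}"
  have "pos ` {k :: 'a. pos k \<in> A} = A"
  proof
    show "A \<subseteq> pos ` {k :: 'a. pos k \<in> A}"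
    proof
      fix j assume "j \<in> A"
      then have "pos (idx j :: 'a) = j" using A by (intro pos_idx) auto
      with \<open>j \<in> A\<close> show "j \<in> pos ` {k :: 'a. pos k \<in> A}" by (intro image_eqI[of _ _ "idx j"]) auto
    qed
  qed auto
  moreover have "inj_on pos {k :: 'a. pos k \<in> A}" using inj_pos by (rule inj_on_subset) simp
  ultimately show ?thesis by (metis card_image)
qed

section \<open>The Hermitian form of a generalized ball\<close>

definition sg :: "nat \<Rightarrow> nat \<Rightarrow> 'a::{finite,linorder} \<Rightarrow> real" where
  "sg r s k = (if pos k \<le> r then 1 else if pos k \<le> r + s then -1 else 0)"

lemma sg_cases: "sg r s k = 1 \<or> sg r s k = -1 \<or> sg r s k = 0"
  by (simp add: sg_def)

lemma line_scale: "c \<noteq> 0 \<Longrightarrow> v \<noteq> 0 \<Longrightarrow> line (c *s v) = line v"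
  by (metis line_eq_iff vector_mul_eq_0)

lemma hq_sg_hpt:
  fixes z :: "nat \<Rightarrow> complex"
  assumes "r + s < CARD('a::{finite,linorder})"
  shows "hq (sg r s) ((\<chi> k. z (pos k)) :: (complex, 'a) vec) =
    (\<Sum>i=0..r. (cmod (z i))\<^sup>2) - (\<Sum>j=r+1..r+s. (cmod (z j))\<^sup>2)"
proof -
  let ?g = "\<lambda>i. (if i \<le> r then 1 else if i \<le> r + s then -1 else 0) * (cmod (z i))\<^sup>2 :: real"
  have "hq (sg r s) ((\<chi> k. z (pos k)) :: (complex, 'a) vec) = (\<Sum>k\<in>(UNIV :: 'a set). ?g (pos k))"
    by (simp add: hq_def sg_def)
  also have "\<dots> = (\<Sum>i<CARD('a). ?g i)"
    by (rule sum.reindex_bij_betw[OF bij_betw_pos])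
  also have "\<dots> = (\<Sum>i\<in>{0..r} \<union> {r+1..r+s}. ?g i)"
    using assms by (intro sum.mono_neutral_right) auto
  also have "\<dots> = (\<Sum>i=0..r. ?g i) + (\<Sum>i=r+1..r+s. ?g i)"
    by (intro sum.union_disjoint) auto
  also have "(\<Sum>i=0..r. ?g i) = (\<Sum>i=0..r. (cmod (z i))\<^sup>2)"
    by (intro sum.cong) auto
  also have "(\<Sum>i=r+1..r+s. ?g i) = (\<Sum>i=r+1..r+s. - (cmod (z i))\<^sup>2)"
    by (intro sum.cong) auto
  finally show ?thesis by (simp add: sum_negf)
qed

lemma line_in_gen_ball:
  fixes v :: "(complex, 'a::{finite,linorder}) vec"
  assumes n: "r + s < CARD('a)" and v: "v \<noteq> 0"
  shows "line v \<in> gen_ball r s \<longleftrightarrow> hq (sg r s) v > 0"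
proof
  assume "line v \<in> gen_ball r s"
  then obtain z where z: "line v = hpt z" "(\<Sum>i=0..r. (cmod (z i))\<^sup>2) > (\<Sum>j=r+1..r+s. (cmod (z j))\<^sup>2)"
    by (auto simp: gen_ball_def)
  define w where "w = ((\<chi> k. z (pos k)) :: (complex, 'a) vec)"
  have pos: "hq (sg r s) w > 0" using z(2) by (simp add: w_def hq_sg_hpt[OF n])
  then have "w \<noteq> 0" by (auto simp: hq_def)
  moreover have "line v = line w" using z(1) by (simp add: hpt_def w_def)
  ultimately obtain c where "c \<noteq> 0" "w = c *s v" using line_eq_iff[OF v] by auto
  with pos show "hq (sg r s) v > 0" by (simp add: hq_scale zero_less_mult_iff)
next
  assume pos: "hq (sg r s) v > 0"
  define z where "z i = v $ idx i" for i
  have w: "(\<chi> k. z (pos k)) = v" by (simp add: z_def vec_eq_iff)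
  have "line v = hpt z" by (simp add: hpt_def w)
  moreover have "(\<Sum>i=0..r. (cmod (z i))\<^sup>2) > (\<Sum>j=r+1..r+s. (cmod (z j))\<^sup>2)"
    using pos hq_sg_hpt[OF n, of z] by (simp add: w)
  ultimately show "line v \<in> gen_ball r s" by (auto simp: gen_ball_def)
qed

lemma open_hq_pos: "open {v :: (complex, 'a::{finite,linorder}) vec. 0 < \<sigma> * hq \<epsilon> v}"
  by (intro open_Collect_less continuous_intros continuous_on_hq)

lemma frontier_gen_ballD:
  fixes v :: "(complex, 'a::{finite,linorder}) vec"
  assumes n: "r + s < CARD('a)" and v: "v \<noteq> 0" and "line v \<in> frontier (gen_ball r s)"
  shows "hq (sg r s) v = 0"
proof (rule ccontr)
  assume ne: "hq (sg r s) v \<noteq> 0"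
  \<comment> \<open>The values 1 and -1 of \<open>\<sigma>\<close> treat the positive and the
    negative cone together; both are open, so the boundary must be null.\<close>
  have *: "{v. v \<noteq> 0 \<and> line v \<in> {line w |w. w \<noteq> 0 \<and> \<sigma> * hq (sg r s) w > 0}} =
      {w :: (complex, 'a) vec. 0 < \<sigma> * hq (sg r s) w}" for \<sigma>
  proof (intro equalityI subsetI)
    fix w :: "(complex, 'a) vec"
    assume "w \<in> {v. v \<noteq> 0 \<and> line v \<in> {line w |w. w \<noteq> 0 \<and> \<sigma> * hq (sg r s) w > 0}}"
    then obtain u where u: "w \<noteq> 0" "line w = line u" "u \<noteq> 0" "\<sigma> * hq (sg r s) u > 0" by blast
    then obtain c where c: "c \<noteq> 0" "u = c *s w" using line_eq_iff by blast
    have "\<sigma> * hq (sg r s) u = (cmod c)\<^sup>2 * (\<sigma> * hq (sg r s) w)" by (simp add: c(2) hq_scale)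
    then have "0 < \<sigma> * hq (sg r s) w"
      using u(4) c(1) by (metis zero_less_mult_pos zero_less_norm_iff zero_less_power)
    then show "w \<in> {w. 0 < \<sigma> * hq (sg r s) w}" by simp
  next
    fix w :: "(complex, 'a) vec"
    assume w: "w \<in> {w. 0 < \<sigma> * hq (sg r s) w}"
    then have "w \<noteq> 0" by (auto simp: hq_def)
    with w show "w \<in> {v. v \<noteq> 0 \<and> line v \<in> {line w |w. w \<noteq> 0 \<and> \<sigma> * hq (sg r s) w > 0}}" by blast
  qed
  have op: "open {line w |w :: (complex, 'a) vec. w \<noteq> 0 \<and> \<sigma> * hq (sg r s) w > 0}" for \<sigma>
    unfolding open_cproj_def * by (rule open_hq_pos)
  have gb: "gen_ball r s = {line w |w :: (complex, 'a) vec. w \<noteq> 0 \<and> 1 * hq (sg r s) w > 0}"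
  proof (intro equalityI subsetI)
    fix p :: "'a cproj"
    assume p: "p \<in> gen_ball r s"
    obtain w where "w \<noteq> 0" "p = line w" using ex_line by blast
    with p show "p \<in> {line w |w. w \<noteq> 0 \<and> 1 * hq (sg r s) w > 0}"
      using line_in_gen_ball[OF n] by auto
  qed (auto simp: line_in_gen_ball[OF n])
  then have "open (gen_ball r s :: 'a cproj set)" using op[of 1] by simp
  then have fr: "frontier (gen_ball r s) = closure (gen_ball r s) - (gen_ball r s :: 'a cproj set)"
    by (simp add: frontier_def interior_open)
  then have "\<not> hq (sg r s) v > 0" using assms(3) line_in_gen_ball[OF n v] by auto
  with ne have neg: "(-1) * hq (sg r s) v > 0" by simp
  let ?N = "{line w |w :: (complex, 'a) vec. w \<noteq> 0 \<and> (-1) * hq (sg r s) w > 0}"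
  have "line v \<in> ?N" using neg v by blast
  moreover have "line v \<in> closure (gen_ball r s)" using assms(3) unfolding fr by (rule DiffD1)
  ultimately have "gen_ball r s \<inter> ?N \<noteq> {}"
    using op[of "-1"] open_Int_closure_eq_empty[of ?N "gen_ball r s"] by (auto simp: Int_commute)
  then obtain p where p: "p \<in> gen_ball r s" "p \<in> ?N" by (meson disjoint_iff)
  from p(2) obtain w :: "(complex, 'a) vec" where w: "p = line w" "w \<noteq> 0" "(-1) * hq (sg r s) w > 0"
    by (elim CollectE exE conjE)
  from p(1) w show False using line_in_gen_ball[OF n w(2)] by simp
qed

section \<open>The positive block of coordinates\<close>

definition ppart :: "nat \<Rightarrow> (complex, 'a::{finite,linorder}) vec \<Rightarrow> (complex, 'a) vec" where
  "ppart r v = (\<chi> k. if pos k \<le> r then v $ k else 0)"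

lemma hq_ppart: "hq (sg r s) (ppart r v) = (\<Sum>k | pos k \<le> r. (cmod (v $ k))\<^sup>2)"
proof -
  have "hq (sg r s) (ppart r v) = (\<Sum>k\<in>UNIV. if pos k \<le> r then (cmod (v $ k))\<^sup>2 else 0)"
    unfolding hq_def by (intro sum.cong) (auto simp: ppart_def sg_def)
  then show ?thesis by (simp add: sum.If_cases)
qed

lemma hq_ppart_pos: "pos k \<le> r \<Longrightarrow> v $ k \<noteq> 0 \<Longrightarrow> hq (sg r s) (ppart r v) > 0"
  unfolding hq_ppart by (rule sum_pos2[of _ k]) auto

lemma hform_ppart_npart: "hform \<epsilon> (ppart r v) (w - ppart r w) = 0"
  unfolding hform_def by (intro sum.neutral) (auto simp: ppart_def)

lemma hform_npart_ppart: "hform \<epsilon> (w - ppart r w) (ppart r v) = 0"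
  unfolding hform_def by (intro sum.neutral) (auto simp: ppart_def)

text \<open>A null vector stays null if \<open>\<tau>\<close> has modulus 1, and moves into the ball
  if the modulus exceeds 1 and its positive block is nonzero; the dependence on
  \<open>\<tau>\<close> is holomorphic.\<close>

definition stretch :: "nat \<Rightarrow> complex \<Rightarrow> (complex, 'a::{finite,linorder}) vec \<Rightarrow> (complex, 'a) vec" where
  "stretch r \<tau> v = \<tau> *s ppart r v + (v - ppart r v)"

lemma stretch_1 [simp]: "stretch r 1 v = v"
  by (simp add: stretch_def)

lemma hq_stretch: "hq (sg r s) (stretch r \<tau> v) =
    (cmod \<tau>)\<^sup>2 * hq (sg r s) (ppart r v) + hq (sg r s) (v - ppart r v)"
proof -
  have "hform (sg r s) (stretch r \<tau> v) (stretch r \<tau> v) =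
      of_real ((cmod \<tau>)\<^sup>2 * hq (sg r s) (ppart r v) + hq (sg r s) (v - ppart r v))"
    unfolding stretch_def hform_add_left hform_add_right hform_scale_left hform_scale_right
      hform_ppart_npart hform_npart_ppart
    by (simp add: hform_self complex_norm_square del: of_real_power)
  then show ?thesis by (simp only: hform_self of_real_eq_iff)
qed

lemma hq_ppart_npart: "hq (sg r s) v = hq (sg r s) (ppart r v) + hq (sg r s) (v - ppart r v)"
  using hq_stretch[of r s 1 v] by simp

lemma stretch_nth: "stretch r \<tau> v $ k = (if pos k \<le> r then \<tau> * v $ k else v $ k)"
  by (simp add: stretch_def ppart_def)

lemma continuous_on_stretch: "continuous_on T (\<lambda>\<tau>. stretch r \<tau> v)"
proof -
  have "stretch r \<tau> v = (\<chi> k. if pos k \<le> r then \<tau> * v $ k else v $ k)" for \<tau>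
    by (simp add: vec_eq_iff stretch_nth)
  moreover have "continuous_on T (\<lambda>\<tau>. (\<chi> k. if pos k \<le> r then \<tau> * v $ k else v $ k))"
  proof (rule continuous_on_vec_lambda)
    fix k show "continuous_on T (\<lambda>\<tau>. if pos k \<le> r then \<tau> * v $ k else v $ k)"
      by (cases "pos k \<le> r") (auto intro!: continuous_intros)
  qed
  ultimately show ?thesis by simp
qed

lemma exists_hq_pos_near:
  fixes v :: "(complex, 'a::{finite,linorder}) vec"
  assumes T: "open T" "v \<in> T" and v: "hq (sg r s) v = 0" and k: "pos k \<le> r" "v $ k \<noteq> 0"
  shows "\<exists>w\<in>T. hq (sg r s) w > 0"
proof -
  have "((\<lambda>t. stretch r (of_real t) v) \<longlongrightarrow> stretch r (of_real 1) v) (at_right 1)"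
    by (intro continuous_on_tendsto_compose[OF continuous_on_stretch[of UNIV]] tendsto_intros) auto
  then have "((\<lambda>t. stretch r (of_real t) v) \<longlongrightarrow> v) (at_right 1)" by simp
  then have "\<forall>\<^sub>F t in at_right 1. stretch r (of_real t) v \<in> T"
    using T by (rule topological_tendstoD)
  moreover have "\<forall>\<^sub>F t in at_right (1::real). t > 1" by (rule eventually_at_right_less)
  ultimately have "\<forall>\<^sub>F t in at_right (1::real). stretch r (of_real t) v \<in> T \<and> t > 1"
    by (rule eventually_conj)
  then obtain t :: real where t: "stretch r (of_real t) v \<in> T" "t > 1"
    using eventually_happens[of _ "at_right (1::real)"] by (auto simp: trivial_limit_at_right_real)
  have "hq (sg r s) (stretch r (of_real t) v) = (t\<^sup>2 - 1) * hq (sg r s) (ppart r v)"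
    using hq_ppart_npart[of r s v] v by (simp add: hq_stretch algebra_simps)
  moreover have "t\<^sup>2 > 1" using t(2) by (simp add: one_less_power)
  ultimately have "hq (sg r s) (stretch r (of_real t) v) > 0"
    using hq_ppart_pos[where s = s, OF k] by simp
  with t(1) show ?thesis by blast
qed

lemma frontier_gen_ballI:
  fixes v :: "(complex, 'a::{finite,linorder}) vec"
  assumes n: "r + s < CARD('a)" and null: "hq (sg r s) v = 0" and k: "pos k \<le> r" "v $ k \<noteq> 0"
  shows "line v \<in> frontier (gen_ball r s)"
proof -
  have v: "v \<noteq> 0" using k(2) by auto
  have "line v \<in> closure (gen_ball r s)"
    unfolding closure_iff_nhds_not_empty
  proof (intro allI impI)
    fix A T :: "'a cproj set"
    assume T: "T \<subseteq> A" "line v \<in> T" "open T"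
    let ?T = "{w :: (complex, 'a) vec. w \<noteq> 0 \<and> line w \<in> T}"
    have "open ?T" using T(3) by (simp add: open_cproj_def)
    moreover have "v \<in> ?T" using v T(2) by simp
    ultimately obtain w where w: "w \<in> ?T" "hq (sg r s) w > 0"
      using exists_hq_pos_near[OF _ _ null k] by blast
    then have "line w \<in> gen_ball r s" using line_in_gen_ball[OF n] by simp
    then show "gen_ball r s \<inter> A \<noteq> {}" using w(1) T(1) by blast
  qed
  moreover have "line v \<notin> gen_ball r s" using line_in_gen_ball[OF n v] null by simp
  ultimately show ?thesis unfolding frontier_def using interior_subset by blast
qed

section \<open>Charts and lifts to homogeneous coordinates\<close>

lemma line_in_chart_dom: "v \<noteq> 0 \<Longrightarrow> line v \<in> chart_dom k \<longleftrightarrow> v $ k \<noteq> 0"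
proof
  assume v: "v \<noteq> 0" and "line v \<in> chart_dom k"
  then obtain w where w: "line v = line w" "w $ k \<noteq> 0" by (auto simp: chart_dom_def)
  then have "w \<noteq> 0" by auto
  then obtain c where "w = c *s v" using line_eq_iff[OF v, of w] w(1) by blast
  with w(2) show "v $ k \<noteq> 0" by auto
qed (auto simp: chart_dom_def)

lemma open_chart_dom: "open (chart_dom k)"
proof -
  have "v \<noteq> 0 \<and> line v \<in> chart_dom k \<longleftrightarrow> v $ k \<noteq> 0" for v :: "(complex, 'a) vec" and k :: "'a::finite"
    using line_in_chart_dom[of v k] by (cases "v = 0") simp_all
  then have "{v :: (complex, 'a) vec. v \<noteq> 0 \<and> line v \<in> chart_dom k} = {v. v $ k \<noteq> 0}" for k :: "'a::finite"
    by simp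
  then show ?thesis
    unfolding open_cproj_def by (simp only:) (intro open_Collect_neq continuous_intros)
qed

lemma chart_props:
  assumes "p \<in> chart_dom k"
  shows "chart k p $ k = 1" "line (chart k p) = p"
proof -
  obtain v where v: "v \<noteq> 0" "p = line v" using ex_line by blast
  have vk: "v $ k \<noteq> 0" using assms v line_in_chart_dom by metis
  then show "chart k p $ k = 1" "line (chart k p) = p"
    using v by (simp_all add: chart_line line_scale)
qed

text \<open>Charts live on hyperplanes, while the analytic arguments use open sets of vectors. Near
  \<open>v\<close>, division by a nonzero coordinate \<open>v $ k\<close> composes the chart
  expression with a holomorphic map onto the hyperplane.\<close>

lemma cproj_holo_fun_lift:
  assumes g: "cproj_holo_fun_on g V" and V: "open V"
  shows "holo_on (\<lambda>v. g (line v)) {v. v \<noteq> 0 \<and> line v \<in> V}"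
  unfolding holo_on_def
proof
  let ?S = "{v :: (complex, 'a) vec. v \<noteq> 0 \<and> line v \<in> V}"
  fix v assume v: "v \<in> ?S"
  then obtain k where k: "v $ k \<noteq> 0" by (auto simp: vec_eq_iff)
  let ?T = "?S \<inter> {v. v $ k \<noteq> 0}"
  have "open ?T" using V
    by (intro open_Int open_Collect_neq continuous_intros) (simp add: open_cproj_def)
  have "holo_on (\<lambda>v. g (line (inverse (v $ k) *s v))) ?T"
  proof (rule holo_on_compose)
    show "holo_on (\<lambda>z. g (line z)) {z. z $ k = 1 \<and> line z \<in> V}"
      using g by (simp add: cproj_holo_fun_on_def)
    show "holo_on (\<lambda>v. (inverse (v $ k) *s v) $ j) ?T" for j
      unfolding vector_smult_component by (intro holo_on_mult holo_on_inverse holo_on_nth) simp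
    show "(\<lambda>v. inverse (v $ k) *s v) ` ?T \<subseteq> {z. z $ k = 1 \<and> line z \<in> V}"
      by (auto simp: line_scale)
  qed
  then have "holo_on (\<lambda>v. g (line v)) ?T"
    by (rule holo_on_cong) (auto simp: line_scale)
  then obtain D where D: "Vector_Spaces.linear (*s) (*) D" "((\<lambda>v. g (line v)) has_derivative D) (at v)"
    using \<open>open ?T\<close> by (rule holo_on_openE) (use v k in auto)
  then show "\<exists>D. Vector_Spaces.linear (*s) (*) D \<and> ((\<lambda>v. g (line v)) has_derivative D) (at v within ?S)"
    using has_derivative_at_withinI by blast
qed

lemma cproj_holo_map_lift:
  assumes f: "cproj_holo_map_on f U" and U: "open U"
  shows "open {v. v \<noteq> 0 \<and> line v \<in> U \<and> f (line v) \<in> chart_dom l}" (is "open ?S")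
    and "holo_on (\<lambda>v. chart l (f (line v)) $ j) {v. v \<noteq> 0 \<and> line v \<in> U \<and> f (line v) \<in> chart_dom l}"
proof -
  let ?V = "{p \<in> U. f p \<in> chart_dom l}"
  have "?V = U \<inter> f -` chart_dom l" by auto
  moreover have "open (U \<inter> f -` chart_dom l)"
    using f U open_chart_dom by (intro continuous_open_preimage) (auto simp: cproj_holo_map_on_def)
  ultimately have V: "open ?V" by simp
  have eq: "?S = {v. v \<noteq> 0 \<and> line v \<in> ?V}" by auto
  show "open ?S" unfolding eq using V by (simp only: open_cproj_def)
  have "cproj_holo_fun_on (\<lambda>p. chart l (f p) $ j) ?V"
    using f by (simp add: cproj_holo_map_on_def)
  then show "holo_on (\<lambda>v. chart l (f (line v)) $ j) ?S"
    unfolding eq using V by (rule cproj_holo_fun_lift)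
qed

definition pmap :: "complex ^ 'a ^ 'a \<Rightarrow> 'a::finite cproj \<Rightarrow> 'a cproj" where
  "pmap A p = line (A *v (SOME v. v \<noteq> 0 \<and> line v = p))"

lemma invertible_mult_nonzero:
  fixes A :: "complex ^ 'a::finite ^ 'a"
  shows "invertible A \<Longrightarrow> v \<noteq> 0 \<Longrightarrow> A *v v \<noteq> 0"
  by (metis invertible_inverseE matrix_vector_mul_assoc matrix_vector_mul_lid matrix_vector_mult_0_right)

lemma pmap_line:
  fixes A :: "complex ^ 'a::finite ^ 'a"
  assumes A: "invertible A" and v: "v \<noteq> 0"
  shows "pmap A (line v) = line (A *v v)"
proof -
  define w where "w = (SOME w. w \<noteq> 0 \<and> line w = line v)"
  have w: "w \<noteq> 0 \<and> line w = line v"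
    unfolding w_def by (rule someI[of _ v]) (simp add: v)
  then obtain c where c: "c \<noteq> 0" "w = c *s v" using line_eq_iff[OF v, of w] by auto
  then have "line (A *v w) = line (A *v v)"
    using invertible_mult_nonzero[OF A v] by (simp add: vec.linear_scale[OF matrix_vector_mul_linear_gen] line_scale)
  then show ?thesis by (simp add: pmap_def w_def)
qed

lemma pmap_isometry_Aut:
  fixes A :: "((complex, 'a::{finite,linorder}) vec, 'a) vec"
  assumes n: "r + s < CARD('a)" and A: "isometry (sg r s) A"
  shows "pmap A \<in> proj_Aut (gen_ball r s)"
proof -
  have inv: "invertible A" using A by (simp add: isometry_def)
  have sub: "pmap H ` gen_ball r s \<subseteq> gen_ball r s" if H: "isometry (sg r s) H" for H :: "((complex, 'a) vec, 'a) vec"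
  proof
    fix q assume "q \<in> pmap H ` gen_ball r s"
    then obtain p where p: "p \<in> gen_ball r s" "q = pmap H p" by blast
    obtain v where v: "v \<noteq> 0" "p = line v" using ex_line by blast
    have iH: "invertible H" using H by (simp add: isometry_def)
    show "q \<in> gen_ball r s"
      using p v line_in_gen_ball[OF n] invertible_mult_nonzero[OF iH v(1)]
      by (simp add: pmap_line[OF iH] isometry_hq[OF H])
  qed
  obtain H where H: "isometry (sg r s) H" "A ** H = mat 1" "H ** A = mat 1"
    using A by (rule isometry_inverseE)
  have iH: "invertible H" using H by (simp add: isometry_def)
  have "gen_ball r s \<subseteq> pmap A ` gen_ball r s"
  proof
    fix p :: "'a cproj" assume p: "p \<in> gen_ball r s"
    obtain v where v: "v \<noteq> 0" "p = line v" using ex_line by blast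
    have "pmap A (pmap H p) = p"
      using v invertible_mult_nonzero[OF iH v(1)]
      by (simp add: pmap_line[OF iH] pmap_line[OF inv] matrix_vector_mul_assoc H(2))
    moreover have "pmap H p \<in> gen_ball r s" using sub[OF H(1)] p by blast
    ultimately show "p \<in> pmap A ` gen_ball r s" by (metis image_eqI)
  qed
  then show ?thesis
    unfolding proj_Aut_def proj_linear_def using sub[OF A] inv pmap_line[OF inv] by blast
qed

section \<open>Hermitian forms vanishing on part of the null cone\<close>

definition hermitian :: "(complex ^ 'a::finite \<Rightarrow> complex ^ 'a \<Rightarrow> complex) \<Rightarrow> bool" where
  "hermitian b \<longleftrightarrow> (\<forall>x y z. b (x + y) z = b x z + b y z) \<and> (\<forall>c x z. b (c *s x) z = c * b x z) \<and>
     (\<forall>x y. b y x = cnj (b x y))"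

lemma hermitianD:
  assumes "hermitian b"
  shows "b (x + y) z = b x z + b y z" "b z (x + y) = b z x + b z y"
    "b (c *s x) z = c * b x z" "b z (c *s x) = cnj c * b z x" "b y x = cnj (b x y)"
proof -
  show 1: "b (x + y) z = b x z + b y z" and 2: "b (c *s x) z = c * b x z"
    using assms unfolding hermitian_def by blast+
  have c: "b y x = cnj (b x y)" for x y using assms unfolding hermitian_def by blast
  then show "b y x = cnj (b x y)" .
  have "b z (x + y) = cnj (b (x + y) z)" by (rule c)
  also have "\<dots> = cnj (b x z) + cnj (b y z)" by (simp only: 1 complex_cnj_add)
  finally show "b z (x + y) = b z x + b z y" by (simp only: c[of z x, symmetric] c[of z y, symmetric])
  have "b z (c *s x) = cnj (b (c *s x) z)" by (rule c)
  also have "\<dots> = cnj c * cnj (b x z)" by (simp only: 2 complex_cnj_mult)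
  finally show "b z (c *s x) = cnj c * b z x" by (simp only: c[of z x, symmetric])
qed

text \<open>Adding the values at \<open>a + t v\<close> and \<open>a - t v\<close> cancels the mixed
  terms and leaves \<open>b v v = 0\<close> for every \<open>v\<close>; the usual polarization with
  1 and \<open>\<i>\<close> gives the rest.\<close>

lemma hermitian_zeroI:
  assumes b: "hermitian b" and S: "open S" "a \<in> S" and zero: "\<And>z. z \<in> S \<Longrightarrow> b z z = 0"
  shows "b x y = 0"
proof -
  note h = hermitianD[OF b]
  have diag: "b v v = 0" for v
  proof -
    have "((\<lambda>t::real. a + of_real t *s v) \<longlongrightarrow> a + of_real 0 *s v) (at_right 0)"
      unfolding scaleR_vec_eq[symmetric] by (intro tendsto_intros)
    then have 1: "\<forall>\<^sub>F t::real in at_right 0. a + of_real t *s v \<in> S"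
      using S by (intro topological_tendstoD) auto
    have "((\<lambda>t::real. a + of_real (- t) *s v) \<longlongrightarrow> a + of_real (- 0) *s v) (at_right 0)"
      unfolding scaleR_vec_eq[symmetric] by (intro tendsto_intros)
    then have 2: "\<forall>\<^sub>F t::real in at_right 0. a + of_real (- t) *s v \<in> S"
      using S by (intro topological_tendstoD) auto
    have 3: "\<forall>\<^sub>F t::real in at_right 0. t > 0" by (rule eventually_at_right_less)
    obtain t :: real where t: "a + of_real t *s v \<in> S" "a + of_real (- t) *s v \<in> S" "t > 0"
      using eventually_happens[OF eventually_conj[OF 1 eventually_conj[OF 2 3]]]
      by (auto simp: trivial_limit_at_right_real)
    have 1: "b a a + of_real t * b v a + of_real t * b a v + of_real t * of_real t * b v v = 0"
      using zero[OF t(1)] unfolding h(1) h(2) h(3) h(4) by (simp add: algebra_simps)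
    have 2: "b a a - of_real t * b v a - of_real t * b a v + of_real t * of_real t * b v v = 0"
      using zero[OF t(2)] unfolding h(1) h(2) h(3) h(4) by (simp add: algebra_simps)
    have "of_real (2 * t * t) * b v v =
        (b a a + of_real t * b v a + of_real t * b a v + of_real t * of_real t * b v v) +
        (b a a - of_real t * b v a - of_real t * b a v + of_real t * of_real t * b v v) - 2 * b a a"
      by (simp add: algebra_simps)
    also have "\<dots> = 0" using 1 2 zero[OF S(2)] by simp
    finally show ?thesis using t(3) by simp
  qed
  have "b x y + b y x = 0"
    using diag[of "x + y"] unfolding h(1) h(2) by (simp add: diag add.commute)
  moreover have "\<i> * b x y - \<i> * b y x = 0"
    using diag[of "\<i> *s x + y"] unfolding h(1) h(2) h(3) h(4) by (simp add: diag)
  then have "b x y - b y x = 0" by (simp flip: right_diff_distrib)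
  ultimately show ?thesis by simp
qed

lemma ppart_add: "ppart r (x + y) = ppart r x + ppart r y"
  and ppart_scale: "ppart r (c *s x) = c *s ppart r x"
  by (simp_all add: ppart_def vec_eq_iff)

lemma ppart_diff: "ppart r (x - y) = ppart r x - ppart r y"
  by (simp add: ppart_def vec_eq_iff)

lemma ppart_ppart [simp]: "ppart r (ppart r x) = ppart r x"
  by (simp add: ppart_def vec_eq_iff)

lemma continuous_on_ppart: "continuous_on T (ppart r)"
  unfolding ppart_def
proof (rule continuous_on_vec_lambda)
  fix k show "continuous_on T (\<lambda>v. if pos k \<le> r then v $ k else 0)"
    by (cases "pos k \<le> r") (auto intro!: continuous_intros)
qed

lemma isCont_ppart: "isCont (ppart r) z" for z :: "(complex, 'a::{finite,linorder}) vec"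
  using continuous_on_ppart[of "UNIV :: (complex, 'a) vec set" r] by (simp add: continuous_on_eq_continuous_at)

lemma isCont_hq: "isCont (hq \<epsilon>) z"
  using continuous_on_hq[of UNIV \<epsilon>] by (simp add: continuous_on_eq_continuous_at)

text \<open>Rotating the positive block by \<open>cis \<theta>\<close> stays in the null cone and
  changes \<open>b z z\<close> only through the mixed term, so
  \<open>A + 2 * Re (cis \<theta> * \<beta>)\<close> vanishes at \<open>\<theta>\<close>,
  \<open>- \<theta>\<close> and 0. One small angle between 0 and \<open>pi\<close> then forces
  \<open>\<beta>\<close> and \<open>A\<close> to vanish.\<close>

lemma hermitian_null_cone_split:
  fixes b :: "(complex, 'a::{finite,linorder}) vec \<Rightarrow> (complex, 'a) vec \<Rightarrow> complex"
  assumes b: "hermitian b" and S: "open S" and z: "z \<in> S" "hq (sg r s) z = 0"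
    and zero: "\<And>z. z \<in> S \<Longrightarrow> hq (sg r s) z = 0 \<Longrightarrow> b z z = 0"
  shows "b (ppart r z) (z - ppart r z) = 0"
    and "b (ppart r z) (ppart r z) + b (z - ppart r z) (z - ppart r z) = 0"
proof -
  note h = hermitianD[OF b]
  let ?P = "ppart r z" and ?Q = "z - ppart r z"
  define \<beta> where "\<beta> = b ?P ?Q"
  define A where "A = b ?P ?P + b ?Q ?Q"
  have null: "hq (sg r s) (stretch r (cis \<theta>) z) = 0" for \<theta>
    using z(2) hq_ppart_npart[of r s z] by (simp add: hq_stretch)
  have E: "A + cis \<theta> * \<beta> + cnj (cis \<theta> * \<beta>) = 0" if "stretch r (cis \<theta>) z \<in> S" for \<theta>
  proof -
    have "b (stretch r (cis \<theta>) z) (stretch r (cis \<theta>) z) =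
        (cis \<theta> * cnj (cis \<theta>)) * b ?P ?P + cis \<theta> * b ?P ?Q + cnj (cis \<theta>) * b ?Q ?P + b ?Q ?Q"
      unfolding stretch_def h(1,2) h(3) h(4) by (simp add: algebra_simps)
    moreover have "cis \<theta> * cnj (cis \<theta>) = 1" by (simp add: cis_cnj cis_mult)
    moreover have "b ?Q ?P = cnj \<beta>" unfolding \<beta>_def by (rule h(5))
    ultimately show ?thesis using zero[OF that null] by (simp add: A_def \<beta>_def algebra_simps)
  qed
  have "((\<lambda>t. stretch r (cis t) z) \<longlongrightarrow> stretch r (cis 0) z) (at_right 0)"
    by (intro continuous_on_tendsto_compose[OF continuous_on_stretch[of UNIV]] tendsto_cis tendsto_intros) auto
  then have 1: "\<forall>\<^sub>F t in at_right 0. stretch r (cis t) z \<in> S"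
    using S z by (intro topological_tendstoD) auto
  have "((\<lambda>t. stretch r (cis (- t)) z) \<longlongrightarrow> stretch r (cis (- 0)) z) (at_right 0)"
    by (intro continuous_on_tendsto_compose[OF continuous_on_stretch[of UNIV]] tendsto_cis tendsto_intros) auto
  then have 2: "\<forall>\<^sub>F t in at_right 0. stretch r (cis (- t)) z \<in> S"
    using S z by (intro topological_tendstoD) auto
  have 3: "\<forall>\<^sub>F t in at_right 0. (0::real) < t" by (rule eventually_at_right_less)
  have 4: "\<forall>\<^sub>F t in at_right 0. t < (pi::real)"
    by (rule order_tendstoD(2)[OF tendsto_ident_at]) simp
  obtain \<theta> where \<theta>: "stretch r (cis \<theta>) z \<in> S" "stretch r (cis (- \<theta>)) z \<in> S" "0 < \<theta>" "\<theta> < pi"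
    using eventually_happens[OF eventually_conj[OF 1 eventually_conj[OF 2 eventually_conj[OF 3 4]]]]
    by (auto simp: trivial_limit_at_right_real)
  have sin: "sin \<theta> > 0" using \<theta>(3,4) by (rule sin_gt_zero)
  have e0: "Re A + 2 * Re \<beta> = 0" "Im A = 0" using E[of 0] z(1) by (simp_all add: complex_eq_iff)
  have e1: "Re A + 2 * (cos \<theta> * Re \<beta> - sin \<theta> * Im \<beta>) = 0"
    using E[OF \<theta>(1)] by (simp add: complex_eq_iff algebra_simps)
  have e2: "Re A + 2 * (cos \<theta> * Re \<beta> + sin \<theta> * Im \<beta>) = 0"
    using E[OF \<theta>(2)] by (simp add: complex_eq_iff algebra_simps)
  have "4 * (sin \<theta> * Im \<beta>) = (Re A + 2 * (cos \<theta> * Re \<beta> + sin \<theta> * Im \<beta>)) -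
      (Re A + 2 * (cos \<theta> * Re \<beta> - sin \<theta> * Im \<beta>))"
    by (simp add: algebra_simps)
  then have "sin \<theta> * Im \<beta> = 0" unfolding e1 e2 by simp
  then have im: "Im \<beta> = 0" using sin by simp
  have "cos \<theta> \<noteq> 1"
  proof
    assume "cos \<theta> = 1"
    then have "(sin \<theta>)\<^sup>2 = 0" using sin_cos_squared_add[of \<theta>] by simp
    then show False using sin by simp
  qed
  moreover have "(cos \<theta> - 1) * Re \<beta> = 0"
  proof -
    have "2 * ((cos \<theta> - 1) * Re \<beta>) =
        (Re A + 2 * (cos \<theta> * Re \<beta> - sin \<theta> * Im \<beta>)) - (Re A + 2 * Re \<beta>)"
      by (simp add: im algebra_simps)
    then show ?thesis unfolding e0(1) e1 by simp
  qed
  ultimately have re: "Re \<beta> = 0" by simp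
  show "b ?P ?Q = 0" using im re by (simp add: complex_eq_iff flip: \<beta>_def)
  show "b ?P ?P + b ?Q ?Q = 0" using e0 re by (simp add: complex_eq_iff flip: A_def)
qed

text \<open>The relations on null vectors are extended to an open set: the stretching factor in
  \<open>\<Psi>\<close> makes any nearby vector null. This kills the mixed terms. Combining the
  positive part of a vector with the rest of \<open>z0\<close>, and conversely, separates the two
  diagonal terms, and their common constant \<open>c\<close> is read off at
  \<open>z0\<close>.\<close>

lemma hermitian_null_cone:
  fixes b :: "(complex, 'a::{finite,linorder}) vec \<Rightarrow> (complex, 'a) vec \<Rightarrow> complex"
  assumes b: "hermitian b" and S: "open S" and z0: "z0 \<in> S" "hq (sg r s) z0 = 0"
    and k: "pos k \<le> r" "z0 $ k \<noteq> 0"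
    and zero: "\<And>z. z \<in> S \<Longrightarrow> hq (sg r s) z = 0 \<Longrightarrow> b z z = 0"
  shows "\<exists>c::real. \<forall>z w. b z w = of_real c * hform (sg r s) z w"
proof -
  note h = hermitianD[OF b]
  let ?P = "ppart r" and ?Q = "\<lambda>z. z - ppart r z"
  define x where "x z = hq (sg r s) (?P z)" for z :: "(complex, 'a) vec"
  define y where "y z = - hq (sg r s) (?Q z)" for z :: "(complex, 'a) vec"
  have x0: "x z0 > 0" unfolding x_def by (rule hq_ppart_pos[OF k])
  have y0: "y z0 = x z0" using z0(2) hq_ppart_npart[of r s z0] by (simp add: x_def y_def)
  have contx: "isCont x z" for z unfolding x_def by (intro isCont_o2[OF isCont_ppart isCont_hq])
  have conty: "isCont y z" for z unfolding y_def
    by (intro continuous_minus isCont_o2[OF _ isCont_hq] continuous_diff isCont_ppart continuous_ident)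
  define \<Psi> where "\<Psi> z = stretch r (of_real (sqrt (y z) / sqrt (x z))) z" for z
  have "isCont \<Psi> z0"
    unfolding \<Psi>_def stretch_def scaleR_vec_eq[symmetric]
    using x0 by (intro continuous_add continuous_scaleR continuous_diff continuous_divide
        continuous_real_sqrt contx conty isCont_ppart continuous_ident) auto
  then have lim: "(\<Psi> \<longlongrightarrow> \<Psi> z0) (nhds z0)" by (simp add: isCont_def tendsto_at_iff_tendsto_nhds)
  have "\<Psi> z0 = z0" using x0 y0 by (simp add: \<Psi>_def)
  with lim have 1: "\<forall>\<^sub>F z in nhds z0. \<Psi> z \<in> S"
    using S z0 by (intro topological_tendstoD) auto
  have 2: "\<forall>\<^sub>F z in nhds z0. x z > 0"
    by (rule order_tendstoD(1)[OF contx[of z0, unfolded isCont_def tendsto_at_iff_tendsto_nhds] x0])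
  have 3: "\<forall>\<^sub>F z in nhds z0. y z > 0"
    by (rule order_tendstoD(1)[OF conty[of z0, unfolded isCont_def tendsto_at_iff_tendsto_nhds]])
      (simp add: x0 y0)
  obtain N where N: "open N" "z0 \<in> N" "\<And>z. z \<in> N \<Longrightarrow> \<Psi> z \<in> S \<and> x z > 0 \<and> y z > 0"
    using eventually_conj[OF 1 eventually_conj[OF 2 3]] unfolding eventually_nhds by auto
  have split: "b (?P z) (?Q z) = 0" "of_real (y z) * b (?P z) (?P z) + of_real (x z) * b (?Q z) (?Q z) = 0"
    if z: "z \<in> N" for z
  proof -
    define \<tau> where "\<tau> = sqrt (y z) / sqrt (x z)"
    have pos: "x z > 0" "y z > 0" using N(3)[OF z] by auto
    have \<tau>: "\<tau> > 0" "\<tau> * \<tau> = y z / x z" using pos by (simp_all add: \<tau>_def)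
    have \<Psi>z: "\<Psi> z = stretch r (of_real \<tau>) z" by (simp add: \<Psi>_def \<tau>_def)
    have "hq (sg r s) (\<Psi> z) = (\<tau> * \<tau>) * x z - y z"
      by (simp add: \<Psi>z hq_stretch x_def y_def power2_eq_square)
    then have null: "hq (sg r s) (\<Psi> z) = 0" using pos by (simp add: \<tau>(2))
    have P: "?P (\<Psi> z) = of_real \<tau> *s ?P z"
      by (simp add: \<Psi>z stretch_def ppart_add ppart_diff ppart_scale)
    have Q: "\<Psi> z - of_real \<tau> *s ?P z = ?Q z" by (simp add: \<Psi>z stretch_def)
    have \<Psi>S: "\<Psi> z \<in> S" using N(3)[OF z] by blast
    have "b (?P (\<Psi> z)) (\<Psi> z - ?P (\<Psi> z)) = 0"
      by (rule hermitian_null_cone_split(1)[OF b S \<Psi>S null zero])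
    then have "of_real \<tau> * b (?P z) (?Q z) = 0" unfolding P Q h(3) .
    then show "b (?P z) (?Q z) = 0" using \<tau>(1) by simp
    have "b (?P (\<Psi> z)) (?P (\<Psi> z)) + b (\<Psi> z - ?P (\<Psi> z)) (\<Psi> z - ?P (\<Psi> z)) = 0"
      by (rule hermitian_null_cone_split(2)[OF b S \<Psi>S null zero])
    then have "cnj (of_real \<tau>) * (of_real \<tau> * b (?P z) (?P z)) + b (?Q z) (?Q z) = 0"
      unfolding P Q h(3) h(4) .
    then have "of_real (\<tau> * \<tau>) * b (?P z) (?P z) + b (?Q z) (?Q z) = 0" by (simp add: mult.assoc)
    then have "of_real (y z) / of_real (x z) * b (?P z) (?P z) + b (?Q z) (?Q z) = 0"
      unfolding \<tau>(2) by simp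
    then show "of_real (y z) * b (?P z) (?P z) + of_real (x z) * b (?Q z) (?Q z) = 0"
      using pos by (simp add: field_simps)
  qed
  \<comment> \<open>The mixed part of \<open>b\<close> is Hermitian itself and vanishes on the open
    set \<open>N\<close>.\<close>
  define b' where "b' z w = b (?P z) (?Q w) + b (?Q z) (?P w)" for z w
  have herm': "hermitian b'"
    unfolding hermitian_def
  proof (intro conjI allI)
    have Qadd: "?Q (u + v) = ?Q u + ?Q v" and Qs: "?Q (c *s u) = c *s ?Q u" for u v c
      by (simp_all add: ppart_add ppart_scale algebra_simps)
    show "b' (u + v) w = b' u w + b' v w" for u v w
      unfolding b'_def Qadd unfolding ppart_add h(1) by simp
    show "b' (c *s u) w = c * b' u w" for c u w
      unfolding b'_def Qs unfolding ppart_scale h(3) by (simp add: algebra_simps)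
    show "b' v u = cnj (b' u v)" for u v
      unfolding b'_def using h(5)[of "?P v" "?Q u"] h(5)[of "?Q v" "?P u"] by simp
  qed
  have zero': "b' z z = 0" if "z \<in> N" for z
    using split(1)[OF that] h(5)[of "?Q z" "?P z"] by (simp add: b'_def)
  have b'0: "b' u v = 0" for u v by (rule hermitian_zeroI[OF herm' N(1,2) zero'])
  have cross: "b (?P u) (?Q v) = 0" for u v
    using b'0[of "?P u" "?Q v"] hermitianD(3)[OF b, of 0 0] by (simp add: b'_def ppart_diff)
  have cross': "b (?Q v) (?P u) = 0" for u v
    using cross[of u v] h(5)[of "?Q v" "?P u"] by simp
  define c where "c = Re (b (?P z0) (?P z0)) / x z0"
  have "b (?P z0) (?P z0) = of_real (Re (b (?P z0) (?P z0)))"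
    using h(5)[of "?P z0" "?P z0"] by (metis Reals_cnj_iff of_real_Re)
  then have bP0: "b (?P z0) (?P z0) = of_real c * of_real (x z0)"
    using x0 by (simp add: c_def)
  have bQ0: "b (?Q z0) (?Q z0) = - of_real c * of_real (x z0)"
  proof -
    have "of_real (x z0) * (of_real c * of_real (x z0) + b (?Q z0) (?Q z0)) = 0"
      using split(2)[OF N(2)] by (simp add: y0 bP0 algebra_simps)
    then show ?thesis using x0 by (simp add: add_eq_0_iff)
  qed
  define b'' where "b'' z w = b z w + of_real (- c) * hform (sg r s) z w" for z w
  have herm'': "hermitian b''"
    unfolding hermitian_def
  proof (intro conjI allI)
    show "b'' (u + v) w = b'' u w + b'' v w" for u v w
      unfolding b''_def h(1) hform_add_left by (simp add: algebra_simps)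
    show "b'' (a *s u) w = a * b'' u w" for a u w
      unfolding b''_def h(3) hform_scale_left by (simp add: algebra_simps)
    show "b'' v u = cnj (b'' u v)" for u v
    proof -
      have "b v u = cnj (b u v)" by (rule h(5))
      then show ?thesis by (simp add: b''_def hform_cnj)
    qed
  qed
  have "((\<lambda>z. ?P z + ?Q z0) \<longlongrightarrow> ?P z0 + ?Q z0) (nhds z0)" "((\<lambda>z. ?P z0 + ?Q z) \<longlongrightarrow> ?P z0 + ?Q z0) (nhds z0)"
    using isCont_ppart[of z0 r]
    by (intro tendsto_add tendsto_diff tendsto_const filterlim_ident;
        simp add: isCont_def tendsto_at_iff_tendsto_nhds)+
  then have "\<forall>\<^sub>F z in nhds z0. ?P z + ?Q z0 \<in> N" "\<forall>\<^sub>F z in nhds z0. ?P z0 + ?Q z \<in> N"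
    using N(1,2) by (auto intro: topological_tendstoD)
  note ev = eventually_conj[OF this]
  obtain N' where N': "open N'" "z0 \<in> N'" "\<And>z. z \<in> N' \<Longrightarrow> ?P z + ?Q z0 \<in> N \<and> ?P z0 + ?Q z \<in> N"
    using ev unfolding eventually_nhds by (elim exE conjE) simp
  have zero'': "b'' z z = 0" if z: "z \<in> N'" for z
  proof -
    have mix: "?P (?P u + ?Q v) = ?P u" "?P u + ?Q v - ?P u = ?Q v" for u v
      by (simp_all add: ppart_add ppart_diff)
    have "of_real (y z) * b (?P z0) (?P z0) + of_real (x z0) * b (?Q z) (?Q z) = 0"
      using split(2)[of "?P z0 + ?Q z"] N'(3)[OF z] unfolding x_def y_def mix by blast
    then have "of_real (x z0) * (of_real c * of_real (y z) + b (?Q z) (?Q z)) = 0"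
      by (simp add: bP0 algebra_simps)
    then have Q: "b (?Q z) (?Q z) = - of_real c * of_real (y z)" using x0 by (simp add: add_eq_0_iff)
    have "of_real (y z0) * b (?P z) (?P z) + of_real (x z) * b (?Q z0) (?Q z0) = 0"
      using split(2)[of "?P z + ?Q z0"] N'(3)[OF z] unfolding x_def y_def mix by blast
    then have "of_real (x z0) * (b (?P z) (?P z) - of_real c * of_real (x z)) = 0"
      by (simp add: y0 bQ0 algebra_simps)
    then have P: "b (?P z) (?P z) = of_real c * of_real (x z)" using x0 by simp
    have "b z z = b (?P z + ?Q z) (?P z + ?Q z)" by simp
    also have "\<dots> = of_real c * of_real (x z) - of_real c * of_real (y z)"
      unfolding h(1) h(2) by (simp add: cross cross' P Q)
    also have "\<dots> = of_real c * hform (sg r s) z z"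
      using hq_ppart_npart[of r s z] by (simp add: x_def y_def hform_self algebra_simps)
    finally show ?thesis by (simp add: b''_def)
  qed
  have "b'' u v = 0" for u v by (rule hermitian_zeroI[OF herm'' N'(1,2) zero''])
  then have "b u v = of_real c * hform (sg r s) u v" for u v
    by (simp add: b''_def)
  then show ?thesis by blast
qed

section \<open>Isotropic frames\<close>

text \<open>An explicit isotropic graph pairs each positive axis with a negative one, which is
  possible because \<open>r < s\<close>. An isometry first moves the positive and the negative part
  of \<open>z0\<close> onto multiples of the axes 0 and \<open>Suc r\<close>, so that the graph
  contains the image of \<open>z0\<close>; the radical part \<open>R\<close> is carried by the
  column of axis 0.\<close>

lemma exists_iso_frame:
  fixes z0 :: "(complex, 'a::{finite,linorder}) vec"
  assumes n: "r + s < CARD('a)" and rs: "r < s" and z0: "hq (sg r s) z0 = 0"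
    and k: "pos k \<le> r" "z0 $ k \<noteq> 0"
  shows "\<exists>M :: ((complex, 'a) vec, 'a) vec. M *v axis (idx 0) 1 = z0 \<and> invertible M \<and>
    (\<forall>c c'. (\<forall>k. Suc r \<le> pos k \<longrightarrow> c $ k = 0 \<and> c' $ k = 0) \<longrightarrow> hform (sg r s) (M *v c) (M *v c') = 0) \<and>
    (\<forall>k. sg r s k = 0 \<longrightarrow> M *v axis k 1 = axis k 1)"
proof -
  let ?\<epsilon> = "sg r s :: 'a \<Rightarrow> real"
  define X where "X = ppart r z0"
  define Y where "Y = (\<chi> k. if r < pos k \<and> pos k \<le> r + s then z0 $ k else 0)"
  define R where "R = (\<chi> k. if r + s < pos k then z0 $ k else 0)"
  have z0_eq: "z0 = X + Y + R" by (auto simp: X_def Y_def R_def ppart_def vec_eq_iff)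
  define \<rho> where "\<rho> = sqrt (hq ?\<epsilon> X)"
  have \<rho>: "\<rho> > 0" "\<rho> * \<rho> = hq ?\<epsilon> X" using hq_ppart_pos[where s = s, OF k] by (simp_all add: \<rho>_def X_def)
  have hX: "hform ?\<epsilon> X X = of_real (\<rho> * \<rho>)" by (simp add: hform_self \<rho>(2))
  have hY: "hform ?\<epsilon> Y Y = - of_real (\<rho> * \<rho>)"
  proof -
    have "hq ?\<epsilon> Y = hq ?\<epsilon> (z0 - ppart r z0)"
      by (rule hq_cong) (auto simp: Y_def ppart_def sg_def)
    then show ?thesis using hq_ppart_npart[of r s z0] z0 \<rho>(2) by (simp add: hform_self X_def)
  qed
  have hXY: "hform ?\<epsilon> X Y = 0" "hform ?\<epsilon> Y X = 0"
    unfolding hform_def by (auto intro!: sum.neutral simp: X_def Y_def ppart_def)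
  let ?k = "idx 0 :: 'a" and ?m = "idx (Suc r) :: 'a"
  have pk: "pos ?k = 0" "pos ?m = Suc r" using n rs by (simp_all add: pos_idx)
  define w where "w i = (if i = 0 then X else Y)" for i :: nat
  define e :: "nat \<Rightarrow> (complex, 'a) vec" where
    "e i = of_real \<rho> *s axis (if i = 0 then ?k else ?m) 1" for i
  have km: "?k \<noteq> ?m" using pk by auto
  have sgk: "?\<epsilon> ?k = 1" "?\<epsilon> ?m = -1" using pk rs by (simp_all add: sg_def)
  have "\<exists>\<Phi>. isometry ?\<epsilon> \<Phi> \<and> (\<forall>i<2. \<Phi> *v w i = e i) \<and>
    (\<forall>v. (\<forall>i<2. hform ?\<epsilon> v (w i) = 0 \<and> hform ?\<epsilon> v (e i) = 0) \<longrightarrow> \<Phi> *v v = v) \<and>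
    (\<forall>k v. (\<forall>i<2. w i $ k = 0 \<and> e i $ k = 0) \<longrightarrow> (\<Phi> *v v) $ k = v $ k)"
    by (rule witt_extension)
      (use \<rho>(1) km in \<open>auto simp: w_def e_def hX hY hXY hform_simps hform_axis_axis sgk less_2_cases_iff\<close>)
  then obtain \<Phi> where \<Phi>: "isometry ?\<epsilon> \<Phi>" "\<And>i. i < 2 \<Longrightarrow> \<Phi> *v w i = e i"
    "\<And>v. (\<And>i. i < 2 \<Longrightarrow> hform ?\<epsilon> v (w i) = 0 \<and> hform ?\<epsilon> v (e i) = 0) \<Longrightarrow> \<Phi> *v v = v"
    by blast
  have \<Phi>X: "\<Phi> *v X = of_real \<rho> *s axis ?k 1" using \<Phi>(2)[of 0] by (simp add: w_def e_def)
  have \<Phi>Y: "\<Phi> *v Y = of_real \<rho> *s axis ?m 1" using \<Phi>(2)[of 1] by (simp add: w_def e_def)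
  have \<Phi>rad: "\<Phi> *v v = v" if v: "\<And>k. ?\<epsilon> k \<noteq> 0 \<Longrightarrow> v $ k = 0" for v
  proof (rule \<Phi>(3))
    have "hform ?\<epsilon> v u = 0" for u
      unfolding hform_def by (intro sum.neutral) (use v in force)
    then show "hform ?\<epsilon> v (w i) = 0 \<and> hform ?\<epsilon> v (e i) = 0" for i by blast
  qed
  obtain \<Psi> where \<Psi>: "isometry ?\<epsilon> \<Psi>" "\<Phi> ** \<Psi> = mat 1" "\<Psi> ** \<Phi> = mat 1"
    using \<Phi>(1) by (rule isometry_inverseE)
  have \<Psi>\<Phi>: "\<Psi> *v (\<Phi> *v v) = v" for v by (simp add: matrix_vector_mul_assoc \<Psi>)
  \<comment> \<open>On vectors supported in the positions up to \<open>r\<close>, position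
    \<open>Suc r + j\<close> repeats position \<open>j\<close>; the last such position is
    \<open>Suc (2 * r)\<close>. The summand \<open>c $ i\<close> makes the map invertible.\<close>
  define f where "f c = (\<chi> i. (if pos i \<le> r then of_real \<rho> * c $ i
     else c $ i + (if pos i \<le> Suc (2 * r) then of_real \<rho> * c $ idx (pos i - Suc r) else 0)) + c $ ?k * R $ i)"
    for c :: "(complex, 'a) vec"
  have "Vector_Spaces.linear (*s) (*s) f"
    by (simp add: Vector_Spaces.linear_iff vec.vector_space_axioms f_def vec_eq_iff algebra_simps)
  then have N: "matrix f *v c = f c" for c by (rule matrix_works)
  let ?N = "matrix f"
  have f0: "c = 0" if "f c = 0" for c
  proof -
    have fi: "f c $ i = 0" for i using that by simp
    have 1: "c $ i = 0" if "pos i \<le> r" for i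
      using fi[of i] that \<rho>(1) by (simp add: f_def R_def)
    have "c $ i = 0" if i: "\<not> pos i \<le> r" for i
    proof (cases "pos i \<le> Suc (2 * r)")
      case True
      have "pos i - Suc r < CARD('a)" using pos_less[of i] by simp
      then have "pos (idx (pos i - Suc r) :: 'a) \<le> r" using True i by (simp add: pos_idx)
      then show ?thesis using fi[of i] i True 1[of "idx (pos i - Suc r)"] 1[of ?k] pk by (simp add: f_def)
    next
      case False
      then show ?thesis using fi[of i] i 1[of ?k] pk by (simp add: f_def)
    qed
    with 1 show ?thesis by (auto simp: vec_eq_iff)
  qed
  have invN: "invertible ?N" by (rule invertibleI_injective) (simp add: N f0)
  have Nk: "?N *v axis ?k 1 = of_real \<rho> *s axis ?k 1 + of_real \<rho> *s axis ?m 1 + R"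
  proof -
    have "f (axis ?k 1) $ i = (of_real \<rho> *s axis ?k 1 + of_real \<rho> *s axis ?m 1 + R) $ i" for i
    proof -
      have "i = ?k \<longleftrightarrow> pos i = 0" "i = ?m \<longleftrightarrow> pos i = Suc r" using pk pos_eq_iff by metis+
      moreover have "idx (pos i - Suc r) = ?k \<longleftrightarrow> pos i \<le> Suc r"
      proof -
        have "pos i - Suc r < CARD('a)" using pos_less[of i] by simp
        then show ?thesis using pk pos_eq_iff[of "idx (pos i - Suc r)" ?k] by (simp add: pos_idx)
      qed
      ultimately show ?thesis by (auto simp: f_def axis_def)
    qed
    then show ?thesis by (simp add: N vec_eq_iff)
  qed
  have Nrad: "?N *v axis k 1 = axis k 1" if "?\<epsilon> k = 0" for k
  proof -
    have pk': "pos k > r + s" using that by (auto simp: sg_def split: if_splits)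
    have "f (axis k 1) $ i = axis k 1 $ i" for i
    proof -
      have "idx (pos i - Suc r) \<noteq> k" if "pos i \<le> Suc (2 * r)"
      proof
        assume eq: "idx (pos i - Suc r) = k"
        have "pos i - Suc r < CARD('a)" using pos_less[of i] by simp
        then have "pos k = pos i - Suc r" using eq pos_idx by metis
        then show False using pk' that rs by simp
      qed
      moreover have "?k \<noteq> k" using pk pk' by auto
      moreover have "pos i \<le> r \<Longrightarrow> i \<noteq> k" using pk' by auto
      ultimately show ?thesis by (auto simp: f_def axis_def)
    qed
    then show ?thesis by (simp add: N vec_eq_iff)
  qed
  have Niso: "hform ?\<epsilon> (f c) (f c') = 0"
    if c: "\<forall>k. Suc r \<le> pos k \<longrightarrow> c $ k = 0 \<and> c' $ k = 0" for c c'
  proof -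
    let ?t = "\<lambda>i. of_real (?\<epsilon> i) * f c $ i * cnj (f c' $ i)"
    let ?A = "{i::'a. pos i \<le> r}" and ?B = "{i::'a. r < pos i \<and> pos i \<le> Suc (2 * r)}"
    have "hform ?\<epsilon> (f c) (f c') = (\<Sum>i\<in>?A \<union> ?B. ?t i)"
      unfolding hform_def
    proof (rule sum.mono_neutral_right)
      show "\<forall>i\<in>UNIV - (?A \<union> ?B). ?t i = 0"
      proof
        fix i assume i: "i \<in> UNIV - (?A \<union> ?B)"
        show "?t i = 0"
        proof (cases "pos i \<le> r + s")
          case True
          then have "f c $ i = 0" using i c by (auto simp: f_def R_def)
          then show ?thesis by simp
        next
          case False
          then show ?thesis by (simp add: sg_def)
        qed
      qed
    qed auto
    also have "\<dots> = (\<Sum>i\<in>?A. ?t i) + (\<Sum>i\<in>?B. ?t i)"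
      by (rule sum.union_disjoint) auto
    also have "(\<Sum>i\<in>?A. ?t i) = (\<Sum>i\<in>?A. of_real (\<rho> * \<rho>) * c $ i * cnj (c' $ i))"
      by (intro sum.cong refl) (auto simp: f_def R_def sg_def)
    also have "(\<Sum>i\<in>?B. ?t i) = (\<Sum>i\<in>?A. - (of_real (\<rho> * \<rho>) * c $ i * cnj (c' $ i)))"
    proof (rule sum.reindex_bij_witness[of _ "\<lambda>i. idx (pos i + Suc r)" "\<lambda>i. idx (pos i - Suc r)"])
      fix i assume i: "i \<in> ?B"
      have p: "pos (idx (pos i - Suc r) :: 'a) = pos i - Suc r"
        using pos_less[of i] by (intro pos_idx) simp
      show "idx (pos (idx (pos i - Suc r) :: 'a) + Suc r) = i" using i by (simp add: p)
      show "idx (pos i - Suc r) \<in> ?A" using i by (auto simp: p)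
      show "- (of_real (\<rho> * \<rho>) * c $ idx (pos i - Suc r) * cnj (c' $ idx (pos i - Suc r))) = ?t i"
        using i c rs by (auto simp: f_def R_def sg_def)
    next
      fix i assume i: "i \<in> ?A"
      have p: "pos (idx (pos i + Suc r) :: 'a) = pos i + Suc r"
        using i n rs by (intro pos_idx) simp
      show "idx (pos (idx (pos i + Suc r) :: 'a) - Suc r) = i" unfolding p by simp
      show "idx (pos i + Suc r) \<in> ?B" unfolding mem_Collect_eq p using i by auto
    qed
    finally show ?thesis by (simp add: sum_negf)
  qed
  have M: "(\<Psi> ** ?N) *v c = \<Psi> *v f c" for c by (simp add: matrix_vector_mul_assoc[symmetric] N)
  show ?thesis
  proof (intro exI[of _ "\<Psi> ** ?N"] conjI allI impI)
    have "\<Phi> *v R = R" by (rule \<Phi>rad) (auto simp: R_def sg_def split: if_splits)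
    then have "\<Phi> *v z0 = ?N *v axis ?k 1"
      unfolding z0_eq matrix_vector_right_distrib \<Phi>X \<Phi>Y Nk by simp
    then show "(\<Psi> ** ?N) *v axis ?k 1 = z0" using \<Psi>\<Phi>[of z0] by (simp add: M N)
    show "invertible (\<Psi> ** ?N)" using \<Psi>(1) invN by (simp add: isometry_def invertible_mult)
    show "hform ?\<epsilon> ((\<Psi> ** ?N) *v c) ((\<Psi> ** ?N) *v c') = 0"
      if "\<forall>k. Suc r \<le> pos k \<longrightarrow> c $ k = 0 \<and> c' $ k = 0" for c c'
      using Niso[OF that] by (simp add: M isometry_hform[OF \<Psi>(1)])
    show "(\<Psi> ** ?N) *v axis k 1 = axis k 1" if k: "?\<epsilon> k = 0" for k
    proof -
      have "\<Phi> *v axis k 1 = axis k 1" by (rule \<Phi>rad) (use k in \<open>auto simp: axis_def\<close>)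
      then show ?thesis using Nrad[OF k] \<Psi>\<Phi>[of "axis k 1"] by (simp add: M N)
    qed
  qed
qed

section \<open>Linearity of orthogonal maps\<close>

theorem (in orthogonal_germ) orthogonal_linear:
  assumes scale: "\<And>t z. t > 0 \<Longrightarrow> z \<in> B \<Longrightarrow> G (t *\<^sub>R z) = G z" and G_l: "\<And>z. z \<in> B \<Longrightarrow> G z $ l = 1"
  shows "\<exists>D. (\<exists>z\<in>B. (D *v z) $ l \<noteq> 0) \<and> (\<forall>z\<in>B. (D *v z) $ l *s G z = D *v z)"
proof -
  \<comment> \<open>\<open>B\<close> is convex but not a cone, as \<open>collineation\<close>
    requires; scale invariance extends all properties to its positive multiples.\<close>
  define C where "C = {z. \<exists>t>0. t *\<^sub>R z \<in> B}"
  have BC: "B \<subseteq> C" by (auto simp: C_def intro!: exI[of _ "1::real"])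
  have GC: "G z = G (t *\<^sub>R z)" if "t > 0" "t *\<^sub>R z \<in> B" for t z
    using scale[of "1 / t" "t *\<^sub>R z"] that by simp
  have open_scaled: "open {z. t *\<^sub>R z \<in> B}" for t
    using continuous_open_preimage[of UNIV "\<lambda>z. t *\<^sub>R z" B] open_B
    by (simp add: vimage_def continuous_intros)
  interpret collineation C G l
  proof
    have "C = (\<Union>t\<in>{0<..}. {z. t *\<^sub>R z \<in> B})" by (auto simp: C_def)
    then show "open C" using open_scaled by auto
    show "convex C"
    proof (rule convexI)
      fix z w and u v :: real
      assume "z \<in> C" "w \<in> C" and uv: "0 \<le> u" "0 \<le> v" "u + v = 1"
      then obtain a b where a: "a > 0" "a *\<^sub>R z \<in> B" and b: "b > 0" "b *\<^sub>R w \<in> B" by (auto simp: C_def)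
      \<comment> \<open>The convex weights are divided by the scalars that bring \<open>z\<close>
        and \<open>w\<close> into \<open>B\<close>; \<open>q\<close> renormalises them to sum
        1.\<close>
      define q where "q = u / a + v / b"
      have q: "q > 0"
      proof (cases "u = 0")
        case True
        then show ?thesis using uv b by (simp add: q_def)
      next
        case False
        then have "u / a > 0" using uv a by simp
        moreover have "v / b \<ge> 0" using uv b by simp
        ultimately show ?thesis by (simp add: q_def)
      qed
      have "(u / a / q) *\<^sub>R (a *\<^sub>R z) + (v / b / q) *\<^sub>R (b *\<^sub>R w) \<in> B"
      proof (rule convexD[OF convex_B a(2) b(2)])
        show "0 \<le> u / a / q" "0 \<le> v / b / q" using uv a b q by simp_all
        have "u / a / q + v / b / q = q / q" unfolding add_divide_distrib[symmetric] q_def ..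
        then show "u / a / q + v / b / q = 1" using q by simp
      qed
      moreover have "(u / a / q) *\<^sub>R (a *\<^sub>R z) + (v / b / q) *\<^sub>R (b *\<^sub>R w) = (1 / q) *\<^sub>R (u *\<^sub>R z + v *\<^sub>R w)"
        using a b by (simp add: scaleR_add_right)
      ultimately show "u *\<^sub>R z + v *\<^sub>R w \<in> C" using q by (auto simp: C_def intro!: exI[of _ "1 / q"])
    qed
    show "t *\<^sub>R z \<in> C" if "t > 0" "z \<in> C" for t z
    proof -
      obtain a where "a > 0" "a *\<^sub>R z \<in> B" using \<open>z \<in> C\<close> by (auto simp: C_def)
      then show ?thesis using \<open>t > 0\<close> by (auto simp: C_def intro!: exI[of _ "a / t"])
    qed
    show "holo_on (\<lambda>z. G z $ k) C" for k
      unfolding holo_on_def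
    proof
      fix z assume "z \<in> C"
      then obtain t where t: "t > 0" "t *\<^sub>R z \<in> B" by (auto simp: C_def)
      have "holo_on (\<lambda>z. G (t *\<^sub>R z) $ k) {z. t *\<^sub>R z \<in> B}"
        using holo_G
      proof (rule holo_on_compose)
        show "holo_on (\<lambda>z. (t *\<^sub>R z) $ j) {z. t *\<^sub>R z \<in> B}" for j
          unfolding scaleR_vec_eq vector_smult_component by (intro holo_on_mult holo_on_const holo_on_nth)
      qed auto
      then have "holo_on (\<lambda>z. G z $ k) {z. t *\<^sub>R z \<in> B}"
        by (rule holo_on_cong) (use GC t(1) in simp)
      then obtain D where "Vector_Spaces.linear (*s) (*) D" "((\<lambda>z. G z $ k) has_derivative D) (at z)"
        using open_scaled by (rule holo_on_openE) (use t(2) in simp)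
      then show "\<exists>D. Vector_Spaces.linear (*s) (*) D \<and> ((\<lambda>z. G z $ k) has_derivative D) (at z within C)"
        using has_derivative_at_withinI by blast
    qed
    show "G z $ l = 1" if "z \<in> C" for z
      using that GC G_l by (auto simp: C_def)
    show "G (t *\<^sub>R z) = G z" if "t > 0" "z \<in> C" for t z
    proof -
      obtain a where a: "a > 0" "a *\<^sub>R z \<in> B" using \<open>z \<in> C\<close> by (auto simp: C_def)
      then show ?thesis using GC[OF a] GC[of "a / t" "t *\<^sub>R z"] \<open>t > 0\<close> by simp
    qed
    show "3 \<le> vec.dim (G ` C)"
      using dim_image_ge vec.dim_subset[OF image_mono[OF BC]] by (rule order_trans)
    have add: "z + w \<in> C" if z: "z \<in> C" and w: "w \<in> C" for z w
    proof -
      have "(1/2) *\<^sub>R z + (1/2) *\<^sub>R w \<in> C" using \<open>convex C\<close> that by (intro convexD) auto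
      then obtain t where "t > 0" "t *\<^sub>R ((1/2) *\<^sub>R z + (1/2) *\<^sub>R w) \<in> B" by (auto simp: C_def)
      then show ?thesis by (auto simp: C_def scaleR_add_right intro!: exI[of _ "t / 2"])
    qed
    show "vec.dim {G z, G w, G (z + w)} \<le> 2" if z: "z \<in> C" and w: "w \<in> C" for z w
    proof -
      obtain a where a: "a > 0" "a *\<^sub>R z \<in> B" using z by (auto simp: C_def)
      obtain b where b: "b > 0" "b *\<^sub>R w \<in> B" using w by (auto simp: C_def)
      obtain t where t: "t > 0" "t *\<^sub>R (z + w) \<in> B" using add[OF z w] by (auto simp: C_def)
      have eq: "of_real (t / a) *s (a *\<^sub>R z) + of_real (t / b) *s (b *\<^sub>R w) = t *\<^sub>R (z + w)"
        unfolding scaleR_vec_eq[symmetric] using a(1) b(1) by (simp add: scaleR_add_right)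
      show ?thesis
        using lines_to_lines[OF a(2) b(2), of "of_real (t / a)" "of_real (t / b)"] t(2)
        unfolding eq GC[OF a, symmetric] GC[OF b, symmetric] GC[OF t, symmetric] by blast
    qed
  qed
  obtain D where D: "\<exists>z\<in>C. (D *v z) $ l \<noteq> 0" "\<forall>z\<in>C. (D *v z) $ l *s G z = D *v z"
    using collineation_linear by blast
  then obtain z where z: "z \<in> C" "(D *v z) $ l \<noteq> 0" by blast
  then obtain t where t: "t > 0" "t *\<^sub>R z \<in> B" by (auto simp: C_def)
  have "(D *v (t *\<^sub>R z)) $ l \<noteq> 0"
    using z(2) t(1) by (simp add: scaleR_vec_eq vec.linear_scale[OF matrix_vector_mul_linear_gen])
  then show ?thesis using D(2) BC t(2) by blast
qed

section \<open>The local normal form\<close>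

lemma card_sg_pos:
  assumes "r + s < CARD('a::{finite,linorder})"
  shows "card {k :: 'a. sg r s k > 0} = Suc r"
proof -
  have "{k :: 'a. sg r s k > 0} = {k. pos k \<in> {..r}}" by (auto simp: sg_def)
  moreover have "{..r} \<subseteq> {..<CARD('a)}" using assms by auto
  ultimately show ?thesis by (simp only: card_pos card_atMost)
qed

lemma card_sg_neg:
  assumes "r + s < CARD('a::{finite,linorder})"
  shows "card {k :: 'a. - sg r s k > 0} = s"
proof -
  have "{k :: 'a. - sg r s k > 0} = {k. pos k \<in> {r<..r+s}}" by (auto simp: sg_def)
  moreover have "{r<..r+s} \<subseteq> {..<CARD('a)}" using assms by auto
  ultimately show ?thesis by (simp only: card_pos card_greaterThanAtMost add_diff_cancel_left')
qed

text \<open>A boundary point may be represented by a vector of the radical. Adding a small multiple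
  of the sum of a positive and a negative axis keeps it null, stays over \<open>U\<close> and gives
  a nonzero positive coordinate.\<close>

lemma exists_smooth_null_point:
  fixes U :: "'a::{finite,linorder} cproj set"
  assumes n: "r + s < CARD('a)" and s: "0 < s" and U: "open U" "U \<inter> frontier (gen_ball r s) \<noteq> {}"
  shows "\<exists>v k. line v \<in> U \<and> hq (sg r s) v = 0 \<and> pos k \<le> r \<and> v $ k \<noteq> 0"
proof -
  obtain p where p: "p \<in> U" "p \<in> frontier (gen_ball r s)" using U(2) by blast
  obtain v where v: "v \<noteq> 0" "p = line v" using ex_line by blast
  have null: "hq (sg r s) v = 0" using frontier_gen_ballD[OF n v(1)] p(2) v(2) by blast
  show ?thesis
  proof (cases "\<exists>k. pos k \<le> r \<and> v $ k \<noteq> 0")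
    case True
    then show ?thesis using p(1) v(2) null by blast
  next
    case False
    let ?k = "idx 0 :: 'a" and ?m = "idx (Suc r) :: 'a"
    have pk: "pos ?k = 0" "pos ?m = Suc r" using n s by (simp_all add: pos_idx)
    have term0: "sg r s k * (cmod (v $ k))\<^sup>2 = 0" for k
    proof -
      have nonneg: "- (sg r s k * (cmod (v $ k))\<^sup>2) \<ge> 0" for k using False by (auto simp: sg_def)
      have "(\<Sum>k\<in>UNIV. - (sg r s k * (cmod (v $ k))\<^sup>2)) = 0"
        using null by (simp add: hq_def sum_negf)
      then have "\<forall>k\<in>UNIV. - (sg r s k * (cmod (v $ k))\<^sup>2) = 0"
        by (subst (asm) sum_nonneg_eq_0_iff) (use nonneg in auto)
      then show ?thesis by simp
    qed
    have v0: "v $ ?k = 0" "v $ ?m = 0" using term0[of ?k] term0[of ?m] pk s by (simp_all add: sg_def)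
    define w where "w t = v + of_real t *s (axis ?k 1 + axis ?m 1)" for t :: real
    let ?T = "{w :: (complex, 'a) vec. w \<noteq> 0 \<and> line w \<in> U}"
    have "(w \<longlongrightarrow> v + of_real 0 *s (axis ?k 1 + axis ?m 1)) (at_right 0)"
      unfolding w_def scaleR_vec_eq[symmetric] by (intro tendsto_intros)
    moreover have "open ?T" using U(1) by (simp add: open_cproj_def)
    moreover have "v + of_real 0 *s (axis ?k 1 + axis ?m 1) \<in> ?T" using v p(1) by simp
    ultimately have 1: "\<forall>\<^sub>F t in at_right 0. w t \<in> ?T" by (rule topological_tendstoD)
    have 2: "\<forall>\<^sub>F t in at_right (0::real). t > 0" by (rule eventually_at_right_less)
    obtain t :: real where t: "w t \<in> ?T" "t > 0"
      using eventually_happens[OF eventually_conj[OF 1 2]] by (auto simp: trivial_limit_at_right_real)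
    have km: "?k \<noteq> ?m" using pk by auto
    have "w t $ ?k = of_real t" using km by (simp add: w_def v0 axis_def)
    then have "w t $ ?k \<noteq> 0" using t(2) by simp
    moreover have "hq (sg r s) (w t) = 0"
    proof -
      have sgk: "sg r s ?k = 1" "sg r s ?m = -1" using pk s by (simp_all add: sg_def)
      have ax: "axis ?k 1 $ ?m = (0::complex)" "axis ?m 1 $ ?k = (0::complex)" "axis ?k 1 $ ?k = (1::complex)"
        "axis ?m 1 $ ?m = (1::complex)"
        using km by (simp_all add: axis_def)
      have "hform (sg r s) (w t) (w t) = hform (sg r s) v v"
        unfolding w_def hform_add_left hform_add_right hform_scale_left hform_scale_right
          hform_axis_left hform_axis_right by (simp add: sgk v0 ax)
      then show ?thesis using null by (simp add: hform_self)
    qed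
    ultimately show ?thesis using t(1) pk(1) by (intro exI[of _ "w t"] exI[of _ ?k]) simp
  qed
qed

lemma hq_pos_imp_coordinate:
  assumes "hq (sg r s) v > 0" shows "\<exists>k. pos k \<le> r \<and> v $ k \<noteq> 0"
proof (rule ccontr)
  assume "\<not> ?thesis"
  then have "hq (sg r s) v \<le> 0"
    unfolding hq_def by (intro sum_nonpos) (auto simp: sg_def)
  with assms show False by simp
qed

text \<open>A null vector may be sent into the radical of the target. Stretching by
  \<open>exp u\<close> enters the ball for real \<open>u > 0\<close>, where the image has a nonzero
  positive coordinate \<open>l\<close>, and stays null for imaginary \<open>u\<close>. If that
  coordinate vanished for all small imaginary \<open>u\<close>, it would vanish for real ones
  too.\<close>

lemma exists_null_point_in_chart:
  fixes U :: "'a::{finite,linorder} cproj set" and f :: "'a cproj \<Rightarrow> 'b::{finite,linorder} cproj"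
  assumes n: "r + s < CARD('a)" and m: "r' + s' < CARD('b)" and s: "0 < s"
    and U: "open U" "U \<inter> frontier (gen_ball r s) \<noteq> {}" and f: "cproj_holo_map_on f U"
    and ball: "f ` (U \<inter> gen_ball r s) \<subseteq> gen_ball r' s'"
  shows "\<exists>v k l. v \<noteq> 0 \<and> line v \<in> U \<and> hq (sg r s) v = 0 \<and> pos k \<le> r \<and> v $ k \<noteq> 0 \<and>
    f (line v) \<in> chart_dom l \<and> pos l \<le> r'"
proof -
  obtain v0 k where v0: "line v0 \<in> U" "hq (sg r s) v0 = 0" "pos k \<le> r" "v0 $ k \<noteq> 0"
    using exists_smooth_null_point[OF n s U] by blast
  obtain w where w: "w \<noteq> 0" "f (line v0) = line w" using ex_line by blast
  then obtain l' where "w $ l' \<noteq> 0" by (auto simp: vec_eq_iff)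
  then have l': "f (line v0) \<in> chart_dom l'" using line_in_chart_dom w by metis
  define S where "S = {v. v \<noteq> 0 \<and> line v \<in> U \<and> f (line v) \<in> chart_dom l'}"
  define F where "F v = chart l' (f (line v))" for v
  have S: "open S" unfolding S_def by (rule cproj_holo_map_lift(1)[OF f U(1)])
  have F: "holo_on (\<lambda>v. F v $ j) S" for j
    unfolding S_def F_def by (rule cproj_holo_map_lift(2)[OF f U(1)])
  have F_line: "line (F v) = f (line v)" "F v \<noteq> 0" if "v \<in> S" for v
    using chart_props[of "f (line v)" l'] that by (auto simp: S_def F_def)
  have "v0 \<noteq> 0" using v0(4) by auto
  then have v0S: "v0 \<in> S" using v0(1) l' by (simp add: S_def)
  define st where "st u = stretch r (exp u) v0" for u
  have cont: "continuous_on UNIV st"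
    unfolding st_def by (rule continuous_on_compose2[OF continuous_on_stretch[of UNIV]]) (auto intro: continuous_intros)
  have "open (st -` S)" using cont S by (simp add: continuous_on_open_vimage)
  moreover have "0 \<in> st -` S" using v0S by (simp add: st_def)
  ultimately obtain \<delta> where \<delta>: "\<delta> > 0" "ball 0 \<delta> \<subseteq> st -` S" by (meson open_contains_ball)
  define z1 where "z1 = st (of_real (\<delta> / 2))"
  have z1S: "z1 \<in> S" using \<delta> unfolding z1_def by (auto simp: subset_iff)
  have "hq (sg r s) z1 = ((exp (\<delta> / 2))\<^sup>2 - 1) * hq (sg r s) (ppart r v0)"
    using hq_ppart_npart[of r s v0] v0(2) by (simp add: z1_def st_def hq_stretch algebra_simps)
  moreover have "(exp (\<delta> / 2))\<^sup>2 > 1" using \<delta>(1) by (simp add: one_less_power)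
  ultimately have "hq (sg r s) z1 > 0" using hq_ppart_pos[where s = s, OF v0(3,4)] by simp
  then have "line z1 \<in> U \<inter> gen_ball r s" using z1S line_in_gen_ball[OF n] by (auto simp: S_def)
  then have "line (F z1) \<in> gen_ball r' s'" using ball F_line(1)[OF z1S] by auto
  then have "hq (sg r' s') (F z1) > 0" using line_in_gen_ball[OF m F_line(2)[OF z1S]] by simp
  then obtain l where l: "pos l \<le> r'" "F z1 $ l \<noteq> 0" using hq_pos_imp_coordinate by blast
  have "\<exists>\<theta>::real. \<bar>\<theta>\<bar> < \<delta> \<and> F (st (\<i> * of_real \<theta>)) $ l \<noteq> 0"
  proof (rule ccontr)
    assume no: "\<not> ?thesis"
    define g where "g \<tau> = F (st (\<i> * \<tau>)) $ l" for \<tau>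
    have "g holomorphic_on ball 0 \<delta>"
      unfolding g_def
    proof (rule holo_on_curve[OF F S])
      show "(\<lambda>\<tau>. st (\<i> * \<tau>) $ j) holomorphic_on ball 0 \<delta>" for j
        unfolding st_def stretch_nth by (cases "pos j \<le> r") (auto intro!: holomorphic_intros)
      show "(\<lambda>\<tau>. st (\<i> * \<tau>)) ` ball 0 \<delta> \<subseteq> S"
        using \<delta>(2) by (auto simp: subset_iff norm_mult)
    qed simp
    moreover have "g (of_real x) = 0" if "of_real x \<in> ball (0::complex) \<delta>" for x
      using no that by (auto simp: g_def)
    ultimately have "g (- \<i> * of_real (\<delta> / 2)) = 0"
      using \<delta>(1) by (intro zero_on_reals_imp_zero[of g "ball 0 \<delta>" "- \<i> * of_real (\<delta> / 2)"])
        (auto simp: norm_mult norm_divide)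
    moreover have "\<i> * (- \<i> * of_real (\<delta> / 2)) = of_real (\<delta> / 2)" by simp
    ultimately show False using l(2) unfolding g_def z1_def by (simp only:)
  qed
  then obtain \<theta> :: real where \<theta>: "\<bar>\<theta>\<bar> < \<delta>" "F (st (\<i> * of_real \<theta>)) $ l \<noteq> 0" by blast
  define v where "v = st (\<i> * of_real \<theta>)"
  have vS: "v \<in> S" using \<delta>(2) \<theta>(1) by (auto simp: v_def subset_iff norm_mult)
  have "hq (sg r s) v = 0"
    using hq_ppart_npart[of r s v0] v0(2) by (simp add: v_def st_def hq_stretch)
  moreover have "v $ k \<noteq> 0" using v0(3,4) by (simp add: v_def st_def stretch_nth)
  moreover have "f (line v) \<in> chart_dom l"
    using line_in_chart_dom[OF F_line(2)[OF vS], of l] F_line(1)[OF vS] \<theta>(2) by (simp add: v_def)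
  ultimately show ?thesis using vS v0(3) l(1) unfolding S_def by blast
qed

lemma local_normal_form:
  fixes U :: "'a::{finite,linorder} cproj set" and f :: "'a cproj \<Rightarrow> 'b::{finite,linorder} cproj"
  assumes n: "r + s < CARD('a)" and m: "r' + s' < CARD('b)" and r: "1 \<le> r'" "r' \<le> r" "r < s"
    and U: "open U" "U \<inter> frontier (gen_ball r s) \<noteq> {}" and f: "cproj_holo_map_on f U"
    and ball: "f ` (U \<inter> gen_ball r s) \<subseteq> gen_ball r' s'"
    and front: "f ` (U \<inter> frontier (gen_ball r s)) \<subseteq> frontier (gen_ball r' s')"
  shows "\<exists>l D c B. open B \<and> (\<forall>z\<in>B. z \<noteq> 0 \<and> line z \<in> U \<and> f (line z) \<in> chart_dom l) \<and>
    (\<forall>z\<in>B. \<forall>k. pos k \<le> r' + s' \<longrightarrow> (D *v z) $ l * chart l (f (line z)) $ k = (D *v z) $ k) \<and>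
    (\<forall>z k. \<not> pos k \<le> r' + s' \<longrightarrow> (D *v z) $ k = 0) \<and> c > 0 \<and>
    (\<forall>z w. hform (sg r' s') (D *v z) (D *v w) = of_real c * hform (sg r s) z w) \<and>
    (\<exists>z\<in>B. hq (sg r s) z > 0 \<and> (D *v z) $ l \<noteq> 0)"
proof -
  let ?\<epsilon> = "sg r s :: 'a \<Rightarrow> real" and ?\<epsilon>' = "sg r' s' :: 'b \<Rightarrow> real"
  obtain v0 k l where v0: "v0 \<noteq> 0" "line v0 \<in> U" "hq ?\<epsilon> v0 = 0" and k: "pos k \<le> r" "v0 $ k \<noteq> 0"
    and l: "f (line v0) \<in> chart_dom l" "pos l \<le> r'"
    using exists_null_point_in_chart[OF n m _ U f ball] r by auto
  define S where "S = {v. v \<noteq> 0 \<and> line v \<in> U \<and> f (line v) \<in> chart_dom l}"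
  define F where "F v = chart l (f (line v))" for v
  have S: "open S" unfolding S_def by (rule cproj_holo_map_lift(1)[OF f U(1)])
  have F: "holo_on (\<lambda>v. F v $ j) S" for j
    unfolding S_def F_def by (rule cproj_holo_map_lift(2)[OF f U(1)])
  have F_line: "line (F v) = f (line v)" "F v \<noteq> 0" "F v $ l = 1" if "v \<in> S" for v
    using chart_props[of "f (line v)" l] that by (auto simp: S_def F_def)
  have "open (S \<inter> {v. v $ k \<noteq> 0})"
    by (intro open_Int S open_Collect_neq continuous_intros)
  moreover have "v0 \<in> S \<inter> {v. v $ k \<noteq> 0}" using v0 k l by (simp add: S_def)
  ultimately obtain e where e: "e > 0" "ball v0 e \<subseteq> S \<inter> {v. v $ k \<noteq> 0}" by (meson open_contains_ball)
  \<comment> \<open>The positive coordinate \<open>k\<close> does not vanish on this ball, so every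
    null vector in it represents a boundary point.\<close>
  define B where "B = ball v0 e"
  have B: "open B" "convex B" "v0 \<in> B" "B \<subseteq> S" "\<And>z. z \<in> B \<Longrightarrow> z $ k \<noteq> 0"
    using e by (auto simp: B_def)
  \<comment> \<open>The radical coordinates of the target are not constrained by the form; they are
    set aside here and return as the functions \<open>\<psi>\<close> of the theorem.\<close>
  define G where "G v = (\<chi> j. if ?\<epsilon>' j \<noteq> 0 then F v $ j else 0)" for v
  have hq_G: "hq ?\<epsilon>' (G v) = hq ?\<epsilon>' (F v)" for v by (rule hq_cong) (simp add: G_def)
  have null_G: "hq ?\<epsilon>' (G z) = 0" if "z \<in> B" "hq ?\<epsilon> z = 0" for z
  proof -
    have zS: "z \<in> S" using that B by blast
    have "line z \<in> U \<inter> frontier (gen_ball r s)"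
      using frontier_gen_ballI[OF n that(2) k(1) B(5)[OF that(1)]] zS by (simp add: S_def)
    then have "line (F z) \<in> frontier (gen_ball r' s')" using front F_line(1)[OF zS] by auto
    then show ?thesis using frontier_gen_ballD[OF m F_line(2)[OF zS]] by (simp add: hq_G)
  qed
  have pos_G: "hq ?\<epsilon>' (G z) > 0" if "z \<in> B" "hq ?\<epsilon> z > 0" for z
  proof -
    have zS: "z \<in> S" using that B by blast
    then have "line z \<in> U \<inter> gen_ball r s" using line_in_gen_ball[OF n] that(2) by (simp add: S_def)
    then have "line (F z) \<in> gen_ball r' s'" using ball F_line(1)[OF zS] by auto
    then show ?thesis using line_in_gen_ball[OF m F_line(2)[OF zS]] by (simp add: hq_G)
  qed
  have l_block: "?\<epsilon>' l \<noteq> 0" using l(2) by (simp add: sg_def)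
  have G_l: "G z $ l = 1" if "z \<in> B" for z
    using F_line(3) that B(4) l_block by (auto simp: G_def)
  obtain M0 :: "((complex, 'a) vec, 'a) vec" where M0: "M0 *v axis (idx 0) 1 = v0" "invertible M0"
    "\<And>c c'. (\<forall>k. Suc r \<le> pos k \<longrightarrow> c $ k = 0 \<and> c' $ k = 0) \<Longrightarrow> hform ?\<epsilon> (M0 *v c) (M0 *v c') = 0"
    "\<And>k. ?\<epsilon> k = 0 \<Longrightarrow> M0 *v axis k 1 = axis k 1"
    using exists_iso_frame[OF n r(3) v0(3) k] by blast
  obtain zp where zp: "zp \<in> B" "hq ?\<epsilon> zp > 0" using exists_hq_pos_near[OF B(1,3) v0(3) k] by blast
  interpret orthogonal_germ ?\<epsilon> ?\<epsilon>' "Suc r" B G "idx 0" M0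
  proof
    show "?\<epsilon> j = 1 \<or> ?\<epsilon> j = -1 \<or> ?\<epsilon> j = 0" for j by (rule sg_cases)
    show "open B" "convex B" using B by blast+
    show "holo_on (\<lambda>z. G z $ j) B" for j
    proof (cases "?\<epsilon>' j = 0")
      case True
      then show ?thesis by (simp add: G_def holo_on_const)
    next
      case False
      then show ?thesis using holo_on_subset[OF F B(4)] by (simp add: G_def)
    qed
    show "hq ?\<epsilon>' (G z) = 0" if "z \<in> B" "hq ?\<epsilon> z = 0" for z using that by (rule null_G)
    show "\<exists>z\<in>B. hq ?\<epsilon>' (G z) > 0" using zp pos_G by blast
    show "G z $ j = 0" if "?\<epsilon>' j = 0" for z j using that by (simp add: G_def)
    show "G z \<noteq> 0" if "z \<in> B" for z using G_l[OF that] by auto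
    show "card {j. ?\<epsilon>' j > 0} \<le> Suc r" using r(2) by (simp only: card_sg_pos[OF m] Suc_le_mono)
    show "2 \<le> Suc r" "Suc r < CARD('a)" using r n by simp_all
    show "pos (idx 0 :: 'a) = 0" by (simp add: pos_idx)
    show "Suc r \<le> pos j" if "?\<epsilon> j = 0" for j using that by (simp add: sg_def split: if_splits)
    show "M0 *v axis (idx 0) 1 \<in> B" using M0(1) B(3) by simp
    show "invertible M0" by (rule M0(2))
    show "hform ?\<epsilon> (M0 *v c) (M0 *v c') = 0"
      if "\<And>k. Suc r \<le> pos k \<Longrightarrow> c $ k = 0 \<and> c' $ k = 0" for c c' using M0(3) that by blast
    show "M0 *v axis j 1 = axis j 1" if "?\<epsilon> j = 0" for j using M0(4) that by blast
  qed
  have "\<exists>D. (\<exists>z\<in>B. (D *v z) $ l \<noteq> 0) \<and> (\<forall>z\<in>B. (D *v z) $ l *s G z = D *v z)"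
  proof (rule orthogonal_linear)
    fix t :: real and z assume t: "t > 0" and z: "z \<in> B"
    have "z \<noteq> 0" using z B(4) by (auto simp: S_def)
    then have "F (t *\<^sub>R z) = F z" using t by (simp add: F_def scaleR_vec_eq line_scale)
    then show "G (t *\<^sub>R z) = G z" by (simp only: G_def)
  qed (rule G_l)
  then obtain D0 where D0: "\<exists>z\<in>B. (D0 *v z) $ l \<noteq> 0" "\<And>z. z \<in> B \<Longrightarrow> (D0 *v z) $ l *s G z = D0 *v z"
    by blast
  define D where "D = (\<chi> i j. if ?\<epsilon>' i \<noteq> 0 then D0 $ i $ j else 0)"
  have Dk: "(D *v z) $ j = (if ?\<epsilon>' j \<noteq> 0 then (D0 *v z) $ j else 0)" for z j
    by (simp add: D_def matrix_vector_mult_def)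
  have Dl: "(D *v z) $ l = (D0 *v z) $ l" for z using l_block by (simp add: Dk)
  have D: "D *v z = (D *v z) $ l *s G z" if "z \<in> B" for z
  proof -
    have *: "(D *v z) $ j = ((D *v z) $ l *s G z) $ j" for j
    proof -
      have "((D0 *v z) $ l *s G z) $ j = (D0 *v z) $ j" by (simp only: D0(2)[OF that])
      then show ?thesis by (cases "?\<epsilon>' j = 0") (simp_all add: Dk[of z j] Dl G_block)
    qed
    show ?thesis unfolding vec_eq_iff by (intro allI *)
  qed
  have DG: "hform ?\<epsilon>' (D *v z) (D *v z) = of_real ((cmod ((D *v z) $ l))\<^sup>2 * hq ?\<epsilon>' (G z))"
    if "z \<in> B" for z
    by (subst (1 2) D[OF that]) (simp only: hform_self hq_scale)
  have "\<exists>c::real. \<forall>z w. hform ?\<epsilon>' (D *v z) (D *v w) = of_real c * hform ?\<epsilon> z w"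
  proof (rule hermitian_null_cone[OF _ B(1) B(3) v0(3) k])
    show "hermitian (\<lambda>z w. hform ?\<epsilon>' (D *v z) (D *v w))"
      unfolding hermitian_def
      by (simp add: matrix_vector_right_distrib vec.linear_scale[OF matrix_vector_mul_linear_gen]
          hform_add_left hform_scale_left hform_cnj)
    show "hform ?\<epsilon>' (D *v z) (D *v z) = 0" if "z \<in> B" "hq ?\<epsilon> z = 0" for z
      using DG[OF that(1)] null_G[OF that] by simp
  qed
  then obtain c where c: "\<And>z w. hform ?\<epsilon>' (D *v z) (D *v w) = of_real c * hform ?\<epsilon> z w" by blast
  have "\<exists>z\<in>B. hq ?\<epsilon> z > 0 \<and> (D *v z) $ l \<noteq> 0"
  proof (rule ccontr)
    assume no: "\<not> ?thesis"
    let ?T = "{z. 0 < 1 * hq ?\<epsilon> z}"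
    have "(D *v z) $ l = 0" if z: "z \<in> B" for z
    proof (rule holo_on_identity[OF holo_on_nth_matrix B(1,2) open_hq_pos _ _ z])
      show "?T \<inter> B \<noteq> {}" using zp by auto
      show "(D *v z) $ l = 0" if "z \<in> ?T \<inter> B" for z using no that by auto
    qed
    then show False using D0(1) Dl by auto
  qed
  then obtain z1 where z1: "z1 \<in> B" "hq ?\<epsilon> z1 > 0" "(D *v z1) $ l \<noteq> 0" by blast
  \<comment> \<open>A positive vector with positive image determines the sign of
    \<open>c\<close>.\<close>
  have "complex_of_real ((cmod ((D *v z1) $ l))\<^sup>2 * hq ?\<epsilon>' (G z1)) = of_real (c * hq ?\<epsilon> z1)"
    using DG[OF z1(1)] c[of z1 z1] by (simp add: hform_self)
  then have "(cmod ((D *v z1) $ l))\<^sup>2 * hq ?\<epsilon>' (G z1) = c * hq ?\<epsilon> z1" by (simp only: of_real_eq_iff)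
  moreover have "(cmod ((D *v z1) $ l))\<^sup>2 * hq ?\<epsilon>' (G z1) > 0" using pos_G[OF z1(1,2)] z1(3) by simp
  ultimately have "c > 0" using z1(2) by (simp add: zero_less_mult_iff)
  show ?thesis
  proof (intro exI[of _ l] exI[of _ D] exI[of _ c] exI[of _ B] conjI ballI allI impI)
    show "z \<noteq> 0" "line z \<in> U" "f (line z) \<in> chart_dom l" if "z \<in> B" for z
      using that B(4) by (auto simp: S_def)
    show "(D *v z) $ l * chart l (f (line z)) $ j = (D *v z) $ j" if "z \<in> B" "pos j \<le> r' + s'" for z j
    proof -
      have "?\<epsilon>' j \<noteq> 0" using that(2) by (simp add: sg_def)
      then show ?thesis using arg_cong[OF D[OF that(1)], of "\<lambda>v. v $ j"] by (simp add: G_def F_def)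
    qed
    show "(D *v z) $ j = 0" if "\<not> pos j \<le> r' + s'" for z j
      using that by (simp add: Dk sg_def)
  qed (use \<open>open B\<close> \<open>c > 0\<close> c z1 in blast)+
qed

text \<open>As \<open>c > 0\<close>, \<open>D\<close> is injective on the span of the positive axes
  and carries it to a subspace on which the target form is nonnegative.\<close>

lemma card_pos_le:
  fixes D :: "complex ^ 'a::finite ^ 'b::finite"
  assumes D: "\<And>z w. hform \<epsilon>' (D *v z) (D *v w) = of_real c * hform \<epsilon> z w" and c: "c > 0"
    and block: "\<And>z k. \<epsilon>' k = 0 \<Longrightarrow> (D *v z) $ k = 0"
  shows "card {k. \<epsilon> k > 0} \<le> card {k. \<epsilon>' k > 0}"
proof -
  let ?S = "{v :: complex ^ 'a. \<forall>i. i \<notin> {k. \<epsilon> k > 0} \<longrightarrow> v $ i = 0}"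
  have sub: "vec.subspace ?S" by (auto simp: vec.subspace_def)
  have hq: "hq \<epsilon>' (D *v z) = c * hq \<epsilon> z" for z
  proof -
    have "complex_of_real (hq \<epsilon>' (D *v z)) = of_real (c * hq \<epsilon> z)"
      using D[of z z] by (simp add: hform_self)
    then show ?thesis by (simp only: of_real_eq_iff)
  qed
  have nonneg: "\<epsilon> k * (cmod (v $ k))\<^sup>2 \<ge> 0" if "v \<in> ?S" for v k
    using that by (cases "\<epsilon> k > 0") auto
  have "v = 0" if v: "v \<in> ?S" "D *v v = 0" for v
  proof -
    have "hq \<epsilon> v = 0" using hq[of v] v(2) c by (simp add: hq_def[of \<epsilon>'])
    then have "\<epsilon> k * (cmod (v $ k))\<^sup>2 = 0" for k
      using sum_nonneg_eq_0_iff[of UNIV "\<lambda>k. \<epsilon> k * (cmod (v $ k))\<^sup>2"] nonneg[OF v(1)]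
      by (simp add: hq_def)
    then have or: "\<epsilon> k = 0 \<or> v $ k = 0" for k by simp
    have "v $ k = 0" for k
    proof (cases "\<epsilon> k > 0")
      case True
      then show ?thesis using or[of k] by simp
    next
      case False
      then show ?thesis using v(1) by blast
    qed
    then show ?thesis by (simp add: vec_eq_iff)
  qed
  then have "inj_on ((*v) D) ?S"
    using vec.linear_inj_on_iff_eq_0[OF matrix_vector_mul_linear_gen sub] by blast
  moreover have "vec.span ?S = ?S" using sub by (simp only: vec.span_eq_iff)
  ultimately have "inj_on ((*v) D) (vec.span ?S)" by (simp only:)
  then have "vec.dim ((*v) D ` ?S) = vec.dim ?S"
    by (rule vec.dim_image_eq[OF matrix_vector_mul_linear_gen])
  also have "\<dots> = card {k. \<epsilon> k > 0}" by (rule dim_substandard_cart)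
  finally have "card {k. \<epsilon> k > 0} = vec.dim ((*v) D ` ?S)" by simp
  also have "\<dots> \<le> card {k. \<epsilon>' k > 0}"
  proof (rule dim_nonneg_subspace_le)
    show "vec.subspace ((*v) D ` ?S)"
      using sub by (rule vec.linear_subspace_image[OF matrix_vector_mul_linear_gen])
    show "v $ k = 0" if "v \<in> (*v) D ` ?S" "\<epsilon>' k = 0" for v k using block that by auto
    show "0 \<le> hq \<epsilon>' v" if v: "v \<in> (*v) D ` ?S" for v
    proof -
      obtain u where u: "u \<in> ?S" "v = D *v u" using v by blast
      have "hq \<epsilon> u \<ge> 0" unfolding hq_def using nonneg[OF u(1)] by (intro sum_nonneg)
      then show ?thesis using c by (simp add: u(2) hq)
    qed
  qed
  finally show ?thesis .
qed

lemma signature_le: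
  fixes D :: "((complex, 'a::{finite,linorder}) vec, 'b::{finite,linorder}) vec"
  assumes n: "r + s < CARD('a)" and m: "r' + s' < CARD('b)"
    and D: "\<And>z w. hform (sg r' s') (D *v z) (D *v w) = of_real c * hform (sg r s) z w" and c: "c > 0"
    and block: "\<And>z k. \<not> pos k \<le> r' + s' \<Longrightarrow> (D *v z) $ k = 0"
  shows "r \<le> r'" "s \<le> s'"
proof -
  have bl: "(D *v z) $ k = 0" if "sg r' s' k = 0" for z k
    using block[of k z] that by (simp add: sg_def split: if_splits)
  have "card {k :: 'a. sg r s k > 0} \<le> card {k :: 'b. sg r' s' k > 0}"
    by (rule card_pos_le[OF D c bl])
  then show "r \<le> r'" by (simp only: card_sg_pos[OF n] card_sg_pos[OF m] Suc_le_mono)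
  have neg: "hform (\<lambda>k. - \<epsilon> k) z w = - hform \<epsilon> z w" for \<epsilon> :: "'c::finite \<Rightarrow> real" and z w
    by (simp add: hform_def sum_negf)
  \<comment> \<open>The same count for the negated forms.\<close>
  have "card {k :: 'a. - sg r s k > 0} \<le> card {k :: 'b. - sg r' s' k > 0}"
    by (rule card_pos_le[where D = D, OF _ c]) (simp_all add: neg D bl)
  then show "s \<le> s'" by (simp only: card_sg_neg[OF n] card_sg_neg[OF m])
qed

text \<open>The images of the axes, divided by \<open>sqrt c\<close>, have the Gram matrix of the
  first \<open>r + s + 1\<close> target axes, because the positive blocks have equal size and so the
  negative ones start at the same position. Witt's theorem moves them there, and pairing with these
  axes yields the coordinates.\<close>

lemma exists_standard_form:
  fixes D :: "((complex, 'a::{finite,linorder}) vec, 'b::{finite,linorder}) vec"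
  assumes n: "r + s < CARD('a)" and m: "r + s' < CARD('b)" and ss: "s \<le> s'"
    and D: "\<And>z w. hform (sg r s') (D *v z) (D *v w) = of_real c * hform (sg r s) z w" and c: "c > 0"
    and block: "\<And>z k. \<not> pos k \<le> r + s' \<Longrightarrow> (D *v z) $ k = 0"
  shows "\<exists>\<Phi>. isometry (sg r s') \<Phi> \<and> (\<forall>k v. \<not> pos k \<le> r + s' \<longrightarrow> (\<Phi> *v v) $ k = v $ k) \<and>
    (\<forall>v. (\<forall>k. pos k \<le> r + s' \<longrightarrow> v $ k = 0) \<longrightarrow> \<Phi> *v v = v) \<and>
    (\<forall>z k. (\<Phi> *v (D *v z)) $ k = (if pos k \<le> r + s then of_real (sqrt c) * z $ idx (pos k) else 0))"
proof -
  let ?\<epsilon> = "sg r s :: 'a \<Rightarrow> real" and ?\<epsilon>' = "sg r s' :: 'b \<Rightarrow> real"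
  define \<rho> where "\<rho> = complex_of_real (sqrt c)"
  have \<rho>: "\<rho> \<noteq> 0" "\<rho> * cnj \<rho> = of_real c" "cnj \<rho> = \<rho>"
    using c by (simp_all add: \<rho>_def flip: of_real_mult)
  define w where "w i = inverse \<rho> *s (D *v axis (idx i) 1)" for i
  define e where "e i = (axis (idx i) 1 :: (complex, 'b) vec)" for i
  have pa: "pos (idx i :: 'a) = i" and pb: "pos (idx i :: 'b) = i" if "i < Suc (r + s)" for i
    using that n m ss by (simp_all add: pos_idx)
  have sgi: "?\<epsilon>' (idx i) = ?\<epsilon> (idx i)" if "i < Suc (r + s)" for i
    using that ss by (simp add: sg_def pa pb)
  have sg_nz: "?\<epsilon>' (idx i) \<noteq> 0" if "i < Suc (r + s)" for i
    using that ss by (simp add: sg_def pb)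
  have idx_eq: "(idx i :: 'a) = idx j \<longleftrightarrow> i = j" "(idx i :: 'b) = idx j \<longleftrightarrow> i = j"
    if "i < Suc (r + s)" "j < Suc (r + s)" for i j
    using pa[OF that(1)] pa[OF that(2)] pb[OF that(1)] pb[OF that(2)] by metis+
  have Dw: "hform ?\<epsilon>' (D *v z) (w i) = \<rho> * hform ?\<epsilon> z (axis (idx i) 1)" for z i
  proof -
    have "inverse \<rho> * (\<rho> * cnj \<rho>) = cnj \<rho>" using \<rho>(1) by simp
    then show ?thesis by (simp add: w_def hform_scale_right D \<rho>(3) flip: \<rho>(2) mult.assoc)
  qed
  have ww: "hform ?\<epsilon>' (w i) (w j) = hform ?\<epsilon>' (e i) (e j)"
    if "i < Suc (r + s)" "j < Suc (r + s)" for i j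
  proof -
    have "hform ?\<epsilon>' (w i) (w j) = inverse \<rho> * (\<rho> * hform ?\<epsilon> (axis (idx i) 1) (axis (idx j) 1))"
      by (simp only: Dw[symmetric] w_def[of i] hform_scale_left)
    also have "\<dots> = hform ?\<epsilon> (axis (idx i) 1) (axis (idx j) 1)" using \<rho>(1) by simp
    also have "\<dots> = hform ?\<epsilon>' (e i) (e j)"
      unfolding e_def hform_axis_axis idx_eq[OF that] sgi[OF that(1)] ..
    finally show ?thesis .
  qed
  have w_block: "w i $ k = 0" if "\<not> pos k \<le> r + s'" for i k
    using block[OF that] by (simp add: w_def)
  have e_block: "e i $ k = 0" if "\<not> pos k \<le> r + s'" "i < Suc (r + s)" for i k
    using that pb[OF that(2)] ss by (auto simp: e_def axis_def)
  have "\<exists>\<Phi>. isometry ?\<epsilon>' \<Phi> \<and> (\<forall>i<Suc (r + s). \<Phi> *v w i = e i) \<and>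
    (\<forall>v. (\<forall>i<Suc (r + s). hform ?\<epsilon>' v (w i) = 0 \<and> hform ?\<epsilon>' v (e i) = 0) \<longrightarrow> \<Phi> *v v = v) \<and>
    (\<forall>k v. (\<forall>i<Suc (r + s). w i $ k = 0 \<and> e i $ k = 0) \<longrightarrow> (\<Phi> *v v) $ k = v $ k)"
  proof (rule witt_extension)
    show "hform ?\<epsilon>' (w i) (w j) = hform ?\<epsilon>' (e i) (e j)" if "i < Suc (r + s)" "j < Suc (r + s)" for i j
      by (rule ww[OF that])
    show "hform ?\<epsilon>' (e i) (e j) = 0" if "i < Suc (r + s)" "j < Suc (r + s)" "i \<noteq> j" for i j
      unfolding e_def hform_axis_axis idx_eq[OF that(1,2)] using that(3) by simp
    show "hform ?\<epsilon>' (e i) (e i) \<noteq> 0" if "i < Suc (r + s)" for i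
      unfolding e_def hform_axis_axis using sg_nz[OF that] by simp
  qed
  then obtain \<Phi> where iso: "isometry ?\<epsilon>' \<Phi>" and we: "\<And>i. i < Suc (r + s) \<Longrightarrow> \<Phi> *v w i = e i"
    and fix1: "\<And>v. (\<forall>i<Suc (r + s). hform ?\<epsilon>' v (w i) = 0 \<and> hform ?\<epsilon>' v (e i) = 0) \<Longrightarrow> \<Phi> *v v = v"
    and fix2: "\<And>k v. (\<forall>i<Suc (r + s). w i $ k = 0 \<and> e i $ k = 0) \<Longrightarrow> (\<Phi> *v v) $ k = v $ k"
    by blast
  have rad: "(\<Phi> *v v) $ k = v $ k" if "\<not> pos k \<le> r + s'" for k v
    by (rule fix2) (use w_block[OF that] e_block[OF that] in blast)
  have fix_rad: "\<Phi> *v v = v" if v: "\<And>k. pos k \<le> r + s' \<Longrightarrow> v $ k = 0" for v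
  proof (rule fix1)
    have "hform ?\<epsilon>' v u = 0" for u
      unfolding hform_def
    proof (rule sum.neutral, rule ballI)
      fix k
      show "of_real (?\<epsilon>' k) * v $ k * cnj (u $ k) = 0"
        using v[of k] by (cases "pos k \<le> r + s'") (simp_all add: sg_def)
    qed
    then show "\<forall>i<Suc (r + s). hform ?\<epsilon>' v (w i) = 0 \<and> hform ?\<epsilon>' v (e i) = 0" by blast
  qed
  have coord: "(\<Phi> *v (D *v z)) $ idx i = \<rho> * z $ idx i" if i: "i < Suc (r + s)" for z i
  proof -
    have "hform ?\<epsilon>' (\<Phi> *v (D *v z)) (e i) = \<rho> * hform ?\<epsilon> z (axis (idx i) 1)"
      unfolding we[OF i, symmetric] isometry_hform[OF iso] by (rule Dw)
    then have "of_real (?\<epsilon>' (idx i)) * (\<Phi> *v (D *v z)) $ idx i = \<rho> * (of_real (?\<epsilon>' (idx i)) * z $ idx i)"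
      unfolding e_def hform_axis_right sgi[OF i] .
    then show ?thesis using sg_nz[OF i] by simp
  qed
  have coord': "(\<Phi> *v (D *v z)) $ k = \<rho> * z $ idx (pos k)" if "pos k \<le> r + s" for z k
    using coord[of "pos k" z] that by simp
  \<comment> \<open>The coordinates up to \<open>r + s\<close> already account for the whole value
    of the form, and the remaining nondegenerate ones all carry a negative sign, so they are
    0.\<close>
  have zero: "(\<Phi> *v (D *v z)) $ k = 0" if k: "\<not> pos k \<le> r + s" for z k
  proof (cases "pos k \<le> r + s'")
    case False
    then show ?thesis using rad block by simp
  next
    case True
    let ?v = "\<Phi> *v (D *v z)"
    let ?t = "\<lambda>k. ?\<epsilon>' k * (cmod (?v $ k))\<^sup>2"
    let ?L = "{k :: 'b. pos k \<le> r + s}"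
    have "complex_of_real (hq ?\<epsilon>' ?v) = of_real (c * hq ?\<epsilon> z)"
      using D[of z z] by (simp add: isometry_hq[OF iso] hform_self)
    then have "hq ?\<epsilon>' ?v = c * hq ?\<epsilon> z" by (simp only: of_real_eq_iff)
    also have "\<dots> = (\<Sum>k\<in>?L. ?t k)"
    proof -
      have c\<rho>: "(cmod \<rho>)\<^sup>2 = c" using c by (simp add: \<rho>_def)
      have "(\<Sum>k\<in>?L. ?t k) = (\<Sum>k\<in>{k :: 'a. pos k \<le> r + s}. c * (?\<epsilon> k * (cmod (z $ k))\<^sup>2))"
      proof (rule sum.reindex_bij_witness[of _ "\<lambda>k. idx (pos k)" "\<lambda>k. idx (pos k)"])
        fix k :: 'b assume k: "k \<in> ?L"
        then have p: "pos (idx (pos k) :: 'a) = pos k" using pa by simp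
        show "idx (pos (idx (pos k) :: 'a)) = k" "idx (pos k) \<in> {k :: 'a. pos k \<le> r + s}"
          using k by (simp_all add: p)
        have "?\<epsilon>' k = ?\<epsilon> (idx (pos k))" using sgi[of "pos k"] k by simp
        then show "c * (?\<epsilon> (idx (pos k)) * (cmod (z $ idx (pos k)))\<^sup>2) = ?t k"
          using coord'[of k z] k by (simp add: norm_mult power_mult_distrib c\<rho>)
      next
        fix k :: 'a assume k: "k \<in> {k. pos k \<le> r + s}"
        then have p: "pos (idx (pos k) :: 'b) = pos k" using pb by simp
        show "idx (pos (idx (pos k) :: 'b)) = k" "idx (pos k) \<in> ?L" using k by (simp_all add: p)
      qed
      also have "\<dots> = (\<Sum>k\<in>UNIV. c * (?\<epsilon> k * (cmod (z $ k))\<^sup>2))"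
        by (rule sum.mono_neutral_left) (auto simp: sg_def)
      finally show ?thesis by (simp add: hq_def sum_distrib_left)
    qed
    finally have "hq ?\<epsilon>' ?v = (\<Sum>k\<in>?L. ?t k)" .
    moreover have "hq ?\<epsilon>' ?v = (\<Sum>k\<in>?L. ?t k) + (\<Sum>k\<in>- ?L. ?t k)"
      unfolding hq_def by (subst sum.union_disjoint[symmetric]) (auto intro!: sum.cong)
    ultimately have "(\<Sum>k\<in>- ?L. - ?t k) = 0" by (simp add: sum_negf)
    moreover have nonneg: "- ?t k \<ge> 0" if "k \<in> - ?L" for k using that by (auto simp: sg_def)
    ultimately have "\<forall>k\<in>- ?L. - ?t k = 0" by (subst (asm) sum_nonneg_eq_0_iff) auto
    then have "?t k = 0" using k by auto
    moreover have "?\<epsilon>' k \<noteq> 0" using True by (simp add: sg_def)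
    ultimately show ?thesis by simp
  qed
  show ?thesis
    using iso rad fix_rad coord' zero unfolding \<rho>_def by (intro exI[of _ \<Phi>]) auto
qed

section \<open>Assembly in homogeneous coordinates\<close>

lemma chart_dom_hpt:
  fixes p :: "'a::{finite,linorder} cproj"
  assumes "p \<in> chart_dom (idx 0)"
  shows "p \<in> {hpt z |z. z 0 \<noteq> 0}"
proof -
  obtain v where v: "p = line v" "v $ idx 0 \<noteq> 0" using assms by (auto simp: chart_dom_def)
  have "(\<chi> k. v $ idx (pos k)) = v" by (simp add: vec_eq_iff)
  then have "p = hpt (\<lambda>i. v $ idx i)" by (simp add: hpt_def v(1))
  then show ?thesis using v(2) by blast
qed

theorem theorem1p2:
  fixes n m r s r' s' :: nat
    and U :: "'a::{finite,linorder} cproj set"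
    and f :: "'a cproj \<Rightarrow> 'b::{finite,linorder} cproj"
  assumes dim_source: "CARD('a) = n + 1"
    and dim_target: "CARD('b) = m + 1"
    and "r + s \<le> n" and "r' + s' \<le> m"
    and "1 \<le> r'" and "r' \<le> r" and "r < s"
    and "open U" and "connected U"
    and "U \<inter> frontier (gen_ball r s) \<noteq> {}"
    and "cproj_holo_map_on f U"
    and "f ` (U \<inter> gen_ball r s) \<subseteq> gen_ball r' s'"
    and "f ` (U \<inter> frontier (gen_ball r s)) \<subseteq> frontier (gen_ball r' s')"
  shows "r = r' \<and> s \<le> s' \<and>
    (\<exists>\<Xi> \<in> proj_Aut (gen_ball r s :: 'a cproj set).
     \<exists>\<Phi> \<in> proj_Aut (gen_ball r' s' :: 'b cproj set).
     \<exists>(U' :: 'a cproj set) (\<psi> :: nat \<Rightarrow> 'a cproj \<Rightarrow> complex).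
       open U' \<and>
       hpt (\<lambda>i. if i = 0 then 1 else 0) \<in> U' \<and>
       U' \<subseteq> {hpt z | z. z 0 \<noteq> 0} \<inter> \<Xi> -` U \<and>
       (\<forall>j \<in> {1..m - r' - s'}. cproj_holo_fun_on (\<psi> j) U') \<and>
       (\<forall>z. z 0 = 1 \<and> hpt z \<in> U' \<longrightarrow>
          \<Phi> (f (\<Xi> (hpt z))) =
            hpt (\<lambda>i. if i = 0 then 1
                     else if i \<le> r + s then z i
                     else if i \<le> r + s + (s' - s) then 0
                     else \<psi> (i - (r' + s')) (hpt z))))"
proof -
  have n: "r + s < CARD('a)" and m: "r' + s' < CARD('b)"
    using assms(3,4) dim_source dim_target by simp_all
  from local_normal_form[OF n m assms(5-8,10-13)]
  obtain l D c B where "open B" and l1: "\<forall>z\<in>B. z \<noteq> 0 \<and> line z \<in> U \<and> f (line z) \<in> chart_dom l"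
    and l2: "\<forall>z\<in>B. \<forall>k. pos k \<le> r' + s' \<longrightarrow> (D *v z) $ l * chart l (f (line z)) $ k = (D *v z) $ k"
    and l3: "\<forall>z k. \<not> pos k \<le> r' + s' \<longrightarrow> (D *v z) $ k = 0" and c: "c > 0"
    and l4: "\<forall>z w. hform (sg r' s') (D *v z) (D *v w) = of_real c * hform (sg r s) z w"
    and ex: "\<exists>z\<in>B. hq (sg r s) z > 0 \<and> (D *v z) $ l \<noteq> 0"
    by (elim exE conjE)
  note B = \<open>open B\<close> l1[rule_format] and DF = l2[rule_format] and block = l3[rule_format]
    and conf = l4[rule_format]
  have r: "r = r'" and s: "s \<le> s'"
    using signature_le[OF n m conf c block] assms(6) by auto
  note m = m[folded r] and block = block[folded r] and conf = conf[folded r] and DF = DF[folded r]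
  let ?e = "axis (idx 0) 1 :: (complex, 'a) vec"
  have p0: "pos (idx 0 :: 'a) = 0" by (simp add: pos_idx)
  obtain z1 where z1: "z1 \<in> B" "hq (sg r s) z1 > 0" "(D *v z1) $ l \<noteq> 0" using ex by blast
  \<comment> \<open>Scaled to form value 1, the value at the axis 0; the isometry \<open>A\<close>
    can then move \<open>[1, 0, ..., 0]\<close> to a point where the local form is valid.\<close>
  define z1' where "z1' = inverse (of_real (sqrt (hq (sg r s) z1))) *s z1"
  have scal: "inverse (complex_of_real (sqrt (hq (sg r s) z1))) \<noteq> 0" using z1(2) by simp
  have "hform (sg r s) z1' z1' = 1"
  proof -
    have "hq (sg r s) z1' = (inverse (sqrt (hq (sg r s) z1)))\<^sup>2 * hq (sg r s) z1"
      using z1(2) by (simp add: z1'_def hq_scale norm_inverse)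
    then show ?thesis using z1(2) by (simp add: hform_self power_inverse)
  qed
  moreover have "hform (sg r s) ?e ?e = 1"
    unfolding hform_axis_axis by (simp add: sg_def p0)
  ultimately obtain A where A: "isometry (sg r s) A" "A *v ?e = z1'"
    using exists_isometry[of "sg r s" ?e z1'] by auto
  have invA: "invertible A" using A by (simp add: isometry_def)
  have Ane: "A *v v \<noteq> 0" if "v \<noteq> 0" for v using invertible_mult_nonzero[OF invA that] .
  have confA: "hform (sg r s') ((D ** A) *v z) ((D ** A) *v w) = of_real c * hform (sg r s) z w" for z w
    by (simp add: matrix_vector_mul_assoc[symmetric] conf isometry_hform[OF A(1)])
  have blockA: "((D ** A) *v z) $ k = 0" if "\<not> pos k \<le> r + s'" for z k
    using block[OF that] by (simp add: matrix_vector_mul_assoc[symmetric])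
  obtain \<Phi> where \<Phi>: "isometry (sg r s') \<Phi>" "\<And>k v. \<not> pos k \<le> r + s' \<Longrightarrow> (\<Phi> *v v) $ k = v $ k"
    "\<And>v. (\<forall>k. pos k \<le> r + s' \<longrightarrow> v $ k = 0) \<Longrightarrow> \<Phi> *v v = v"
    "\<And>z k. (\<Phi> *v ((D ** A) *v z)) $ k = (if pos k \<le> r + s then of_real (sqrt c) * z $ idx (pos k) else 0)"
    using exists_standard_form[OF n m s confA c blockA] by blast
  have inv\<Phi>: "invertible \<Phi>" using \<Phi>(1) by (simp add: isometry_def)
  define F where "F z = chart l (f (line z))" for z
  \<comment> \<open>Where coordinate \<open>l\<close> of \<open>D *v z\<close> is nonzero,
    \<open>D *v z\<close> determines \<open>f\<close> modulo the radical.\<close>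
  define O' where "O' = {z \<in> B. (D *v z) $ l \<noteq> 0}"
  have "O' = B \<inter> {z. (D *v z) $ l \<noteq> 0}" by (auto simp: O'_def)
  moreover have "open {z. (D *v z) $ l \<noteq> 0}"
    using holo_on_continuous_on[OF holo_on_nth_matrix[of D l UNIV]] by (intro open_Collect_neq continuous_intros)
  ultimately have openO: "open O'" using B(1) by auto
  \<comment> \<open>\<open>B\<close> is not invariant under scalars, so the condition asks for one
    suitable representative.\<close>
  define U' where "U' = {line v |v. v $ idx 0 \<noteq> 0 \<and> (\<exists>t. t \<noteq> 0 \<and> t *s (A *v v) \<in> O')}"
  have U'_iff: "line v \<in> U' \<longleftrightarrow> v $ idx 0 \<noteq> 0 \<and> (\<exists>t. t \<noteq> 0 \<and> t *s (A *v v) \<in> O')" if v: "v \<noteq> 0" for v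
  proof
    assume "line v \<in> U'"
    then obtain w t where w: "line v = line w" "w $ idx 0 \<noteq> 0" "t \<noteq> 0" "t *s (A *v w) \<in> O'"
      by (auto simp: U'_def)
    then have "w \<noteq> 0" by auto
    then obtain a where a: "a \<noteq> 0" "w = a *s v" using line_eq_iff[OF v, of w] w(1) by blast
    then have "(t * a) *s (A *v v) \<in> O'"
      using w(4) by (simp add: vec.linear_scale[OF matrix_vector_mul_linear_gen])
    then show "v $ idx 0 \<noteq> 0 \<and> (\<exists>t. t \<noteq> 0 \<and> t *s (A *v v) \<in> O')"
      using w(2,3) a by (auto intro!: exI[of _ "t * a"])
  qed (auto simp: U'_def)
  have openU': "open U'"
  proof -
    have "v \<noteq> 0 \<and> line v \<in> U' \<longleftrightarrow> v $ idx 0 \<noteq> 0 \<and> (\<exists>t. t \<noteq> 0 \<and> t *s (A *v v) \<in> O')" for v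
      using U'_iff[of v] by (cases "v = 0") auto
    then have eq: "{v. v \<noteq> 0 \<and> line v \<in> U'} = {v. v $ idx 0 \<noteq> 0} \<inter> (\<Union>t\<in>-{0}. {v. t *s (A *v v) \<in> O'})"
      by auto
    have "open {v. t *s (A *v v) \<in> O'}" for t
    proof -
      have comp: "continuous_on UNIV (\<lambda>v. (A *v v) $ k)" for k
        by (rule holo_on_continuous_on[OF holo_on_nth_matrix])
      have "t *s (A *v v) = (\<chi> k. t * (A *v v) $ k)" for v by (simp add: vec_eq_iff)
      then have "continuous_on UNIV (\<lambda>v. t *s (A *v v))"
        by (simp only:) (intro continuous_on_vec_lambda continuous_on_mult continuous_on_const comp)
      then have "open ((\<lambda>v. t *s (A *v v)) -` O')"
        using openO by (simp add: continuous_on_open_vimage)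
      then show ?thesis by (simp add: vimage_def)
    qed
    then show ?thesis unfolding open_cproj_def eq
      by (intro open_Int open_UN ballI open_Collect_neq continuous_intros) auto
  qed
  have U'E: "\<exists>t. t \<noteq> 0 \<and> t *s (A *v v) \<in> O' \<and> line (t *s (A *v v)) = line (A *v v)"
    if "line v \<in> U'" "v \<noteq> 0" for v
    using U'_iff[OF that(2)] that(1) line_scale[OF _ Ane[OF that(2)]] by blast
  \<comment> \<open>The radical coordinates of \<open>f\<close>, scaled so that coordinate 0 of the
    normal form is 1: the chart picks the representative with coordinate 0 equal to 1, and
    \<open>sqrt c\<close> is the factor from \<open>exists_standard_form\<close>. The shift by
    \<open>r + s'\<close> makes \<open>j\<close> start at 1.\<close>
  define \<psi> where "\<psi> j p = (D *v (A *v chart (idx 0) p)) $ l * F (A *v chart (idx 0) p) $ idx (j + (r + s')) / of_real (sqrt c)" for j p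
  have \<psi>_line: "\<psi> j (line v) = inverse (v $ idx 0) * (D *v (A *v v)) $ l * F (A *v v) $ idx (j + (r + s')) / of_real (sqrt c)"
    if v: "v $ idx 0 \<noteq> 0" for j v
  proof -
    have "v \<noteq> 0" using v by auto
    then have "F (inverse (v $ idx 0) *s (A *v v)) = F (A *v v)"
      using v Ane by (simp add: F_def line_scale)
    then show ?thesis using v by (simp add: \<psi>_def chart_line vec.linear_scale[OF matrix_vector_mul_linear_gen])
  qed
  show ?thesis
  proof (intro conjI bexI[of _ "pmap A"] bexI[of _ "pmap \<Phi>"] exI[of _ U'] exI[of _ \<psi>])
    show "r = r'" "s \<le> s'" by fact+
    show "pmap A \<in> proj_Aut (gen_ball r s)" by (rule pmap_isometry_Aut[OF n A(1)])
    show "pmap \<Phi> \<in> proj_Aut (gen_ball r' s')" using pmap_isometry_Aut[OF m \<Phi>(1)] r by simp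
    show "open U'" by (rule openU')
    show "hpt (\<lambda>i. if i = 0 then 1 else 0) \<in> U'"
    proof -
      have "pos k = 0 \<longleftrightarrow> k = idx 0" for k :: 'a using p0 pos_eq_iff[of k "idx 0"] by simp
      then have "(\<chi> k. if pos k = 0 then 1 else 0) = ?e" by (simp add: vec_eq_iff axis_def)
      then have hpt: "hpt (\<lambda>i. if i = 0 then 1 else 0) = line ?e" by (simp add: hpt_def)
      have e1: "?e $ idx 0 = 1" by (simp add: axis_def)
      then have "?e \<noteq> 0" by (metis zero_index zero_neq_one)
      \<comment> \<open>Undoes the normalisation of \<open>z1'\<close>, returning to
        \<open>z1\<close> in \<open>B\<close>.\<close>
      define t where "t = inverse (inverse (complex_of_real (sqrt (hq (sg r s) z1))))"
      have "t \<noteq> 0" using scal unfolding t_def by (rule nonzero_imp_inverse_nonzero)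
      moreover have "t *s (A *v ?e) \<in> O'"
        unfolding t_def A(2) z1'_def vector_smult_assoc using z1 scal by (simp add: O'_def)
      ultimately have "line ?e \<in> U'"
        unfolding U'_iff[OF \<open>?e \<noteq> 0\<close>] using e1 by (metis zero_neq_one)
      then show ?thesis by (simp only: hpt)
    qed
    show "U' \<subseteq> {hpt z |z. z 0 \<noteq> 0} \<inter> pmap A -` U"
    proof
      fix p assume p: "p \<in> U'"
      obtain v where v: "v \<noteq> 0" "p = line v" using ex_line by blast
      have "v $ idx 0 \<noteq> 0" using U'_iff[OF v(1)] p v(2) by blast
      then have "p \<in> {hpt z |z. z 0 \<noteq> 0}" using chart_dom_hpt line_in_chart_dom[OF v(1)] v(2) by blast
      moreover obtain t where t: "t *s (A *v v) \<in> O'" "line (t *s (A *v v)) = line (A *v v)"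
        using U'E[of v] p v by blast
      then have "pmap A p \<in> U"
        using B(2)[of "t *s (A *v v)"] by (simp add: v(2) pmap_line[OF invA v(1)] O'_def)
      ultimately show "p \<in> {hpt z |z. z 0 \<noteq> 0} \<inter> pmap A -` U" by blast
    qed
    show "\<forall>j\<in>{1..m - r' - s'}. cproj_holo_fun_on (\<psi> j) U'"
      unfolding cproj_holo_fun_on_def
    proof (intro ballI allI)
      fix j k
      let ?S = "{z. z $ k = 1 \<and> line z \<in> U'}"
      let ?V = "{v. v \<noteq> 0 \<and> line v \<in> U \<and> f (line v) \<in> chart_dom l}"
      have S: "z \<noteq> 0 \<and> z $ idx 0 \<noteq> 0 \<and> A *v z \<in> ?V" if zS: "z \<in> ?S" for z
      proof -
        have z: "z \<noteq> 0" using zS by auto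
        then obtain t where "t *s (A *v z) \<in> O'" "line (t *s (A *v z)) = line (A *v z)"
          using U'E[of z] zS by blast
        then have "A *v z \<in> ?V" using B(2)[of "t *s (A *v z)"] Ane[OF z] by (simp add: O'_def)
        moreover have "z $ idx 0 \<noteq> 0" using U'_iff[OF z] zS by blast
        ultimately show ?thesis using z by blast
      qed
      have "holo_on (\<lambda>z. F (A *v z) $ i) ?S" for i
        unfolding F_def
      proof (rule holo_on_compose[where g = "\<lambda>v. chart l (f (line v)) $ i" and \<phi> = "(*v) A" and T = ?V])
        show "holo_on (\<lambda>v. chart l (f (line v)) $ i) ?V"
          by (rule cproj_holo_map_lift(2)[OF assms(11,8)])
        show "holo_on (\<lambda>z. (A *v z) $ i) ?S" for i by (rule holo_on_nth_matrix)
        show "(*v) A ` ?S \<subseteq> ?V" by (intro image_subsetI S[THEN conjunct2, THEN conjunct2])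
      qed
      moreover have "holo_on (\<lambda>z. (D *v (A *v z)) $ i) ?S" for i
        unfolding matrix_vector_mul_assoc by (rule holo_on_nth_matrix)
      moreover have "holo_on (\<lambda>z. inverse (z $ idx 0)) ?S"
        by (intro holo_on_inverse holo_on_nth S[THEN conjunct2, THEN conjunct1])
      ultimately have "holo_on (\<lambda>z. inverse (z $ idx 0) * (D *v (A *v z)) $ l * F (A *v z) $ idx (j + (r + s')) / of_real (sqrt c)) ?S"
        using c by (intro holo_on_divide holo_on_mult holo_on_const) simp_all
      then show "holo_on (\<lambda>z. \<psi> j (line z)) ?S"
        by (rule holo_on_cong) (rule \<psi>_line[symmetric, OF S[THEN conjunct2, THEN conjunct1]])
    qed
    show "\<forall>z. z 0 = 1 \<and> hpt z \<in> U' \<longrightarrow>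
          pmap \<Phi> (f (pmap A (hpt z))) =
            hpt (\<lambda>i. if i = 0 then 1 else if i \<le> r + s then z i
              else if i \<le> r + s + (s' - s) then 0 else \<psi> (i - (r' + s')) (hpt z))"
    proof (intro allI impI, elim conjE)
      fix z :: "nat \<Rightarrow> complex" assume z0: "z 0 = 1" and zU: "hpt z \<in> U'"
      define v where "v = ((\<chi> k. z (pos k)) :: (complex, 'a) vec)"
      have v0: "v $ idx 0 = 1" by (simp add: v_def p0 z0)
      then have v: "v \<noteq> 0" by auto
      have hz: "hpt z = line v" by (simp add: hpt_def v_def)
      obtain t where t: "t \<noteq> 0" "t *s (A *v v) \<in> O'" "line (t *s (A *v v)) = line (A *v v)"
        using U'E[of v] zU hz v by auto
      define d where "d = (D *v (A *v v)) $ l"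
      have Dt: "D *v (t *s (A *v v)) = t *s (D *v (A *v v))"
        by (simp add: vec.linear_scale[OF matrix_vector_mul_linear_gen])
      have d: "d \<noteq> 0" using t(1,2) by (auto simp: O'_def Dt d_def)
      have tB: "t *s (A *v v) \<in> B" using t(2) by (simp add: O'_def)
      have fin: "f (line (A *v v)) \<in> chart_dom l" using B(2)[OF tB] t(3) by simp
      have F: "F (A *v v) $ l = 1" "line (F (A *v v)) = f (line (A *v v))"
        using chart_props[OF fin] by (simp_all add: F_def)
      have Fne: "F (A *v v) \<noteq> 0" using F(1) by auto
      have dF: "d * F (A *v v) $ k = (D *v (A *v v)) $ k" if "pos k \<le> r + s'" for k
      proof -
        have "(t * d) * F (A *v v) $ k = t * (D *v (A *v v)) $ k"
          using DF[OF tB that] t(3) by (simp add: Dt d_def F_def)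
        then show ?thesis using t(1) by simp
      qed
      \<comment> \<open>The radical part of the image vector; \<open>\<Phi>\<close> fixes it, so
        these coordinates pass unchanged into the normal form.\<close>
      define R where "R = (\<chi> k. if pos k \<le> r + s' then 0 else d * F (A *v v) $ k)"
      have split: "d *s F (A *v v) = (D ** A) *v v + R"
        using dF block by (simp add: vec_eq_iff R_def matrix_vector_mul_assoc[symmetric])
      have R: "\<Phi> *v R = R" by (rule \<Phi>(3)) (simp add: R_def)
      define y where "y = (\<lambda>i. if i = 0 then 1 else if i \<le> r + s then z i
              else if i \<le> r + s + (s' - s) then 0 else \<psi> (i - (r' + s')) (hpt z))"
      have rc: "complex_of_real (sqrt c) \<noteq> 0" using c by simp
      have "\<Phi> *v (d *s F (A *v v)) = of_real (sqrt c) *s (\<chi> k. y (pos k))"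
      proof -
        have "(\<Phi> *v (d *s F (A *v v))) $ k = of_real (sqrt c) * y (pos k)" for k
        proof -
          have 1: "(\<Phi> *v (d *s F (A *v v))) $ k =
              (if pos k \<le> r + s then of_real (sqrt c) * v $ idx (pos k) else 0) + R $ k"
            unfolding split matrix_vector_right_distrib R by (simp add: \<Phi>(4))
          consider "pos k \<le> r + s" | "\<not> pos k \<le> r + s" "pos k \<le> r + s'" | "\<not> pos k \<le> r + s'"
            by blast
          then show ?thesis
          proof cases
            case 1
            have "pos (idx (pos k) :: 'a) = pos k" using 1 n by (intro pos_idx) simp
            then have "v $ idx (pos k) = y (pos k)" using 1 z0 by (simp add: v_def y_def)
            then show ?thesis unfolding \<open>(\<Phi> *v (d *s F (A *v v))) $ k = _\<close> using 1 s by (simp add: R_def)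
          next
            case 2
            then show ?thesis unfolding \<open>(\<Phi> *v (d *s F (A *v v))) $ k = _\<close> using s by (simp add: R_def y_def)
          next
            case 3
            have "y (pos k) = \<psi> (pos k - (r + s')) (line v)" using 3 s by (simp add: y_def hz r)
            also have "\<dots> = d * F (A *v v) $ k / of_real (sqrt c)"
              using \<psi>_line[of v "pos k - (r + s')"] v0 3 by (simp add: d_def)
            finally show ?thesis unfolding \<open>(\<Phi> *v (d *s F (A *v v))) $ k = _\<close>
              using 3 s rc by (simp add: R_def)
          qed
        qed
        then show ?thesis by (simp add: vec_eq_iff)
      qed
      moreover have "(\<chi> k. y (pos k)) \<noteq> (0 :: (complex, 'b) vec)"
      proof -
        have "pos (idx 0 :: 'b) = 0" by (simp add: pos_idx)
        then have "((\<chi> k. y (pos k)) :: (complex, 'b) vec) $ idx 0 \<noteq> 0" by (simp add: y_def)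
        then show ?thesis by (metis zero_index)
      qed
      ultimately have "line (\<Phi> *v (d *s F (A *v v))) = (hpt y :: 'b cproj)"
        using rc by (simp add: hpt_def line_scale)
      moreover have "pmap \<Phi> (f (pmap A (hpt z))) = line (\<Phi> *v (d *s F (A *v v)))"
      proof -
        have "f (pmap A (hpt z)) = line (d *s F (A *v v))"
          using F(2) d Fne by (simp add: hz pmap_line[OF invA v] line_scale)
        moreover have "d *s F (A *v v) \<noteq> 0" using d Fne by simp
        note pmap_line[OF inv\<Phi> this]
        ultimately show ?thesis by (simp only:)
      qed
      ultimately show "pmap \<Phi> (f (pmap A (hpt z))) =
            hpt (\<lambda>i. if i = 0 then 1 else if i \<le> r + s then z i
              else if i \<le> r + s + (s' - s) then 0 else \<psi> (i - (r' + s')) (hpt z))"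
        by (simp only: y_def)
    qed
  qed
qed

end
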